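(* Let $\alpha=(\alpha_i)_{i\in\mathbb{Z}}$ be a vector of non-negative parameters with $\sum_{i}\alpha_i=a<\infty$. Let $\pi=(\pi_j)_{j\in\mathbb{Z}}$ be a random vector of proportions with distribution $\mathrm{Dirichlet}(\alpha)$, and let $\Pi(n)=(\pi_{ij}(n))_{i,j\in\mathbb{Z}}$, $n=1,2,\dots$, be random matrices such that the vectors $(\pi_{i,i+j}(n))_{j\in\mathbb{Z}}$, for different $i\in\mathbb{Z}$ and $n=1,2,\dots$, are i.i.d. copies of $\pi$. Then the fixed point of the exchange dynamics $\tau^{n+1}=\tau^n\,\Pi(n+1)$ is a vector $\tau^\infty=(\tau^\infty_i)_{i\in\mathbb{Z}}$ of independent $\Gamma(a,\gamma)$-distributed random variables. In particular, if $\tau^0=(\tau^0_i)_{i\in\mathbb{Z}}$ is a sequence of non-negative i.i.d. random variables, independent of $(\Pi(n))_{n\ge1}$, with mean $\mu=\mathbf{E}\tau^0_0<\infty$ and finite variance, then $$\tau^0\,\Pi(1)\Pi(2)\cdots\Pi(n)\Rightarrow\tau^\infty\quad\text{as } n\to\infty,$$ where the components of $\tau^\infty$ are independent with distribution $\Gamma(a,\gamma)$, $\gamma=a/\mu=a/\mathbf{E}\tau^0_0$.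
   Context: $\Gamma(a,\gamma)$ is the Gamma distribution with shape $a$ and rate $\gamma$, with density $\frac{\gamma^a}{\Gamma(a)}x^{a-1}e^{-\gamma x}$, $x>0$. $\mathrm{Dirichlet}(\alpha)$ is the distribution of $(Y_i/Y)_{i\in\mathbb{Z}}$, where $Y_i\sim\Gamma(\alpha_i,1)$ are independent ($Y_i=0$ if $\alpha_i=0$) and $Y=\sum_iY_i$. When finitely many, and at least two, $\alpha_i$ are positive this is the usual Dirichlet distribution on the corresponding coordinates, the others being $0$. Sequences are row vectors: $(\tau\,\Pi(n))_j=\sum_{i\in\mathbb{Z}}\tau_i\pi_{ij}(n)$. The fixed point of the dynamics is the sequence $\tau^\infty$, independent of $\Pi(1)$ and determined up to a distributional copy and scaling by a constant factor, such that $\tau^\infty\,\Pi(1)\stackrel{D}{=}\tau^\infty$ and such that, for every $\tau^0$ as in the claim, $\tau^0\,\Pi(1)\cdots\Pi(n)$ converges weakly to $\tau^\infty$ (up to the scaling factor). $\stackrel{D}{=}$ denotes equality in distribution. The symbol $\Rightarrow$ denotes weak convergence of infinite random sequences, meaning weak convergence of all their finite-dimensional sub-vectors.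
   Formalization: At least two α_i are assumed positive (with exactly one, Π(n) is a deterministic shift and the convergence fails; with none, Dirichlet(α) is undefined), and the mean μ of τ^0_0 is assumed positive so that γ=a/μ makes sense. *)

theory Defs
  imports "HOL-Probability.Probability"
begin

abbreviation seq_space :: "(int \<Rightarrow> real) measure" where
  "seq_space \<equiv> Pi\<^sub>M UNIV (\<lambda>_. borel)"

abbreviation matrix_space :: "(int \<Rightarrow> int \<Rightarrow> real) measure" where
  "matrix_space \<equiv> Pi\<^sub>M UNIV (\<lambda>_. seq_space)"

text \<open>The topological space \<^term>\<open>product_topology (\<lambda>_. euclideanreal) J\<close> is the space of real
  vectors indexed by the finite set \<open>J\<close>; its points are the functions that are undefined off
  \<open>J\<close>, so \<^term>\<open>restrict x J\<close> is the sub-vector of \<open>x\<close> with coordinates in \<open>J\<close>.\<close>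

definition weak_conv_fdd :: "(nat \<Rightarrow> (int \<Rightarrow> real) measure) \<Rightarrow> (int \<Rightarrow> real) measure \<Rightarrow> bool" where
  "weak_conv_fdd N L \<longleftrightarrow>
     (\<forall>J f. finite J \<and>
            continuous_map (product_topology (\<lambda>_. euclideanreal) J) euclideanreal f \<and>
            bounded (f ` (J \<rightarrow>\<^sub>E UNIV)) \<longrightarrow>
        (\<lambda>n. \<integral>x. f (restrict x J) \<partial>N n) \<longlonglongrightarrow> (\<integral>x. f (restrict x J) \<partial>L))"

definition gamma_density :: "real \<Rightarrow> real \<Rightarrow> real \<Rightarrow> real" where
  "gamma_density a \<gamma> x =
     (if x > 0 then \<gamma> powr a / Gamma a * x powr (a - 1) * exp (- \<gamma> * x) else 0)"

definition gamma_distr :: "real \<Rightarrow> real \<Rightarrow> real measure" where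
  "gamma_distr a \<gamma> = density lborel (\<lambda>x. ennreal (gamma_density a \<gamma> x))"

text \<open>If the parameters are non-negative and summable and do not all vanish, then the random
  normalising sum is almost surely finite and positive, so the conventions for divergent sums and
  for division by zero only concern a null set.\<close>

definition dirichlet :: "(int \<Rightarrow> real) \<Rightarrow> (int \<Rightarrow> real) measure" where
  "dirichlet \<alpha> =
     distr (Pi\<^sub>M UNIV (\<lambda>i. if \<alpha> i = 0 then return borel 0 else gamma_distr (\<alpha> i) 1))
       seq_space (\<lambda>y i. y i / (\<Sum>\<^sub>\<infinity>k. y k))"

definition row_mult :: "(int \<Rightarrow> real) \<Rightarrow> (int \<Rightarrow> int \<Rightarrow> real) \<Rightarrow> int \<Rightarrow> real" where
  "row_mult t P j = (\<Sum>\<^sub>\<infinity>i. t i * P i j)"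

definition row_mult_defined :: "(int \<Rightarrow> real) \<Rightarrow> (int \<Rightarrow> int \<Rightarrow> real) \<Rightarrow> bool" where
  "row_mult_defined t P \<longleftrightarrow> (\<forall>j. (\<lambda>i. t i * P i j) summable_on UNIV)"

text \<open>The matrices are numbered from 1; the value of \<open>P\<close> at 0 is never used.\<close>

primrec exchange :: "(int \<Rightarrow> real) \<Rightarrow> (nat \<Rightarrow> int \<Rightarrow> int \<Rightarrow> real) \<Rightarrow> nat \<Rightarrow> int \<Rightarrow> real" where
  "exchange t P 0 = t"
| "exchange t P (Suc n) = row_mult (exchange t P n) (P (Suc n))"

definition iid_dirichlet_rows ::
    "'w measure \<Rightarrow> (int \<Rightarrow> real) \<Rightarrow> (nat \<Rightarrow> 'w \<Rightarrow> int \<Rightarrow> int \<Rightarrow> real) \<Rightarrow> bool" where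
  "iid_dirichlet_rows M \<alpha> P \<longleftrightarrow>
     prob_space.indep_vars M (\<lambda>_. seq_space)
       (\<lambda>(n, i) \<omega> j. P n \<omega> i (i + j)) ({1..} \<times> UNIV) \<and>
     (\<forall>n\<ge>1. \<forall>i. distr M seq_space (\<lambda>\<omega> j. P n \<omega> i (i + j)) = dirichlet \<alpha>)"

text \<open>The common law of the entries of an admissible initial sequence. The mean has to be
  positive for the rate \<open>a / \<mu>\<close> of the limiting Gamma distribution to make sense.\<close>

definition initial_law :: "real measure \<Rightarrow> bool" where
  "initial_law \<rho> \<longleftrightarrow>
     prob_space \<rho> \<and> sets \<rho> = sets borel \<and> (AE x in \<rho>. 0 \<le> x) \<and>
     integrable \<rho> (\<lambda>x. x) \<and> integrable \<rho> (\<lambda>x. x\<^sup>2) \<and> 0 < (\<integral>x. x \<partial>\<rho>)"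

text \<open>A fixed point is given by its law \<open>\<nu>\<close>. On the product space \<^term>\<open>\<nu> \<Otimes>\<^sub>M M\<close> the first
  coordinate is a sequence with law \<open>\<nu>\<close> that is independent of the matrices, which live on the
  second coordinate; likewise an i.i.d. initial sequence independent of the matrices is the first
  coordinate of \<^term>\<open>Pi\<^sub>M UNIV (\<lambda>_. \<rho>) \<Otimes>\<^sub>M M\<close>.\<close>

definition exchange_fixed_point ::
    "'w measure \<Rightarrow> (nat \<Rightarrow> 'w \<Rightarrow> int \<Rightarrow> int \<Rightarrow> real) \<Rightarrow> (int \<Rightarrow> real) measure \<Rightarrow> bool" where
  "exchange_fixed_point M P \<nu> \<longleftrightarrow>
     prob_space \<nu> \<and> sets \<nu> = sets seq_space \<and>
     (AE (t, \<omega>) in \<nu> \<Otimes>\<^sub>M M. row_mult_defined t (P 1 \<omega>)) \<and>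
     distr (\<nu> \<Otimes>\<^sub>M M) seq_space (\<lambda>(t, \<omega>). row_mult t (P 1 \<omega>)) = \<nu> \<and>
     (\<forall>\<rho>. initial_law \<rho> \<longrightarrow>
        (\<exists>c>0. weak_conv_fdd
           (\<lambda>n. distr (Pi\<^sub>M UNIV (\<lambda>_. \<rho>) \<Otimes>\<^sub>M M) seq_space
                  (\<lambda>(t, \<omega>). exchange t (\<lambda>k. P k \<omega>) n))
           (distr \<nu> seq_space (\<lambda>t i. c * t i))))"

text \<open>The last condition is the independence of the sequence from the whole family of matrices, in
  terms of the generated \<open>\<sigma>\<close>-algebras: the library's \<open>indep_var\<close> only covers random
  variables with values in the same type.\<close>

definition initial_sequence ::
    "'w measure \<Rightarrow> (nat \<Rightarrow> 'w \<Rightarrow> int \<Rightarrow> int \<Rightarrow> real) \<Rightarrow> ('w \<Rightarrow> int \<Rightarrow> real) \<Rightarrow> bool" where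
  "initial_sequence M P \<tau> \<longleftrightarrow>
     prob_space.indep_vars M (\<lambda>_. borel) (\<lambda>i \<omega>. \<tau> \<omega> i) UNIV \<and>
     (\<forall>i. distr M borel (\<lambda>\<omega>. \<tau> \<omega> i) = distr M borel (\<lambda>\<omega>. \<tau> \<omega> 0)) \<and>
     initial_law (distr M borel (\<lambda>\<omega>. \<tau> \<omega> 0)) \<and>
     prob_space.indep_set M
       (sets (vimage_algebra (space M) \<tau> seq_space))
       (sets (vimage_algebra (space M) (\<lambda>\<omega> n. P (Suc n) \<omega>) (Pi\<^sub>M UNIV (\<lambda>_. matrix_space))))"

end

theory Submission imports Defs
begin

text \<open>
  The proof rests on the invariance of the Gamma law and on a contraction in mean square.

  Invariance. The total of independent Gamma variables is independent of their proportions
  (\<open>distr_G_sum_normalised\<close>). So if a Gamma variable of shape \<open>a\<close> is distributed over the sites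
  according to an independent Dirichlet vector, the pieces are independent Gamma variables with shapes
  \<open>\<alpha>\<^sub>j\<close>. One step of the dynamics from i.i.d. Gamma entries breaks each entry into such pieces and
  collects them along columns; the shapes in a column add up to \<open>a\<close> again, and different columns use
  different pieces (\<open>row_mult_gamma_invariant\<close>).

  Contraction. Let two independent i.i.d. sequences \<open>X\<close> and \<open>Y\<close> with the same mean run through the same
  matrices. The moments \<open>E X\<^sub>i X\<^sub>k\<close>, \<open>E X\<^sub>i Y\<^sub>k\<close> and \<open>E Y\<^sub>i Y\<^sub>k\<close> depend on \<open>k - i\<close> only and evolve
  under one linear operator. Hence \<open>E (X\<^sub>i - Y\<^sub>i)\<^sup>2\<close> at time \<open>n\<close> is the initial value, the sum of the two
  variances, times a number \<open>ret n\<close> that depends on the matrices alone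
  (\<open>L2_distance_pair_step_pow\<close>): the probability that two walkers in the same random environment, who
  start together, are together at time \<open>n\<close>. With \<open>p = \<alpha> / a\<close> and \<open>s = 1 / (a + 1)\<close>, the second moments
  of the Dirichlet law say that walkers at the same site make the same move with probability \<open>s\<close> and
  otherwise move independently, as they do from different sites. So their difference is a symmetric
  random walk with an additional holding probability at 0. Let \<open>r n\<close> be the probability that the walk without
  holding is at 0 at time \<open>n\<close>. Decomposing at the visits to 0,
  \<open>ret n = r n + s * (\<Sum>k<n. ret k * (r (n - 1 - k) - r (n - k)))\<close>. Here \<open>r n\<close> is the mean over the
  circle of the \<open>n\<close>th power of a characteristic function \<open>\<phi>\<close> with \<open>0 \<le> \<phi> \<le> 1\<close>, and \<open>\<phi> < 1\<close> almost
  everywhere because two of the parameters are positive. So \<open>r\<close> decreases to 0, the weights in the sum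
  are nonnegative with total at most 1, and \<open>s < 1\<close> forces \<open>ret n\<close> to tend to 0 (\<open>ret_tendsto_0\<close>).

  Conclusion. Let \<open>Y\<close> have Gamma entries with the mean of \<open>X\<close>. Its law never changes, while \<open>X - Y\<close>
  tends to 0 in mean square in every coordinate; this gives convergence of the finite-dimensional laws
  (\<open>weak_conv_fdd_if_L2_close\<close>). A fixed point is, up to a factor, the limit from any initial law, and
  such limits are unique (\<open>weak_conv_fdd_unique\<close>), so it has the Gamma form.
\<close>

section \<open>Countable sums and product measures\<close>

lemma summable_on_iff_integrable_count_space:
  fixes f :: "'a \<Rightarrow> real"
  shows "f summable_on UNIV \<longleftrightarrow> integrable (count_space UNIV) f"
  using abs_summable_equivalent[of f UNIV] summable_on_iff_abs_summable_on_real[of f UNIV]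
  by (simp add: Infinite_Set_Sum.abs_summable_on_def)

text \<open>Both sides are 0 when the sum diverges. The identity turns measurability of sums into
  measurability of integrals.\<close>
lemma infsum_eq_integral_count_space:
  fixes f :: "'a \<Rightarrow> real"
  shows "(\<Sum>\<^sub>\<infinity>i. f i) = (\<integral>i. f i \<partial>count_space UNIV)"
proof (cases "f summable_on UNIV")
  case True
  then have "Infinite_Set_Sum.abs_summable_on f UNIV"
    by (simp add: summable_on_iff_integrable_count_space Infinite_Set_Sum.abs_summable_on_def)
  from infsetsum_infsum[OF this] show ?thesis by (simp add: infsetsum_def)
next
  case False
  then show ?thesis
    by (simp add: infsum_not_exists summable_on_iff_integrable_count_space not_integrable_integral_eq)
qed

lemma measurable_pair_count_space_snd:
  fixes f :: "'b \<Rightarrow> 'a::countable \<Rightarrow> 'c"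
  assumes "\<And>i. (\<lambda>x. f x i) \<in> M \<rightarrow>\<^sub>M N"
  shows "(\<lambda>(x, i). f x i) \<in> M \<Otimes>\<^sub>M count_space UNIV \<rightarrow>\<^sub>M N"
  unfolding case_prod_beta'
  by (rule measurable_compose_countable[where g=snd]) (use assms in measurable)

lemma borel_measurable_infsum [measurable (raw)]:
  fixes f :: "'b \<Rightarrow> 'a::countable \<Rightarrow> real"
  assumes [measurable]: "\<And>i. (\<lambda>x. f x i) \<in> borel_measurable M"
  shows "(\<lambda>x. \<Sum>\<^sub>\<infinity>i. f x i) \<in> borel_measurable M"
proof -
  interpret C: sigma_finite_measure "count_space (UNIV :: 'a set)"
    by (rule sigma_finite_measure_count_space)
  note measurable_pair_count_space_snd[OF assms]
  then show ?thesis
    unfolding infsum_eq_integral_count_space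
    by (intro C.borel_measurable_lebesgue_integral) (simp add: case_prod_beta')
qed

lemma summable_on_nonneg_iff:
  fixes f :: "'a \<Rightarrow> real"
  assumes "\<And>i. 0 \<le> f i"
  shows "f summable_on UNIV \<longleftrightarrow> (\<integral>\<^sup>+i. ennreal (f i) \<partial>count_space UNIV) < \<infinity>"
  using assms by (simp add: summable_on_iff_integrable_count_space integrable_iff_bounded)

lemma ennreal_infsum_nonneg:
  fixes f :: "'a \<Rightarrow> real"
  assumes "\<And>i. 0 \<le> f i" and "(\<integral>\<^sup>+i. ennreal (f i) \<partial>count_space UNIV) < \<infinity>"
  shows "ennreal (\<Sum>\<^sub>\<infinity>i. f i) = (\<integral>\<^sup>+i. ennreal (f i) \<partial>count_space UNIV)"
  using assms
  by (simp add: infsum_eq_integral_count_space nn_integral_eq_integral integrable_iff_bounded)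

lemma nn_integral_count_space_Fubini:
  fixes f :: "'a::countable \<Rightarrow> 'b \<Rightarrow> ennreal"
  assumes "sigma_finite_measure M" and [measurable]: "\<And>i. f i \<in> borel_measurable M"
  shows "(\<integral>\<^sup>+x. (\<integral>\<^sup>+i. f i x \<partial>count_space UNIV) \<partial>M) = (\<integral>\<^sup>+i. (\<integral>\<^sup>+x. f i x \<partial>M) \<partial>count_space UNIV)"
proof -
  interpret M: sigma_finite_measure M by fact
  interpret C: sigma_finite_measure "count_space (UNIV :: 'a set)"
    by (rule sigma_finite_measure_count_space)
  interpret pair_sigma_finite M "count_space (UNIV :: 'a set)" ..
  note measurable_pair_count_space_snd[OF assms(2)]
  then show ?thesis
    using Fubini'[of "\<lambda>x i. f i x"] by (simp add: case_prod_beta')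
qed

lemma nn_integral_count_space_measurable [measurable (raw)]:
  fixes f :: "'b \<Rightarrow> 'a::countable \<Rightarrow> ennreal"
  assumes [measurable]: "\<And>i. (\<lambda>x. f x i) \<in> borel_measurable M"
  shows "(\<lambda>x. \<integral>\<^sup>+i. f x i \<partial>count_space UNIV) \<in> borel_measurable M"
proof -
  interpret C: sigma_finite_measure "count_space (UNIV :: 'a set)"
    by (rule sigma_finite_measure_count_space)
  note measurable_pair_count_space_snd[OF assms]
  then show ?thesis
    by (intro C.borel_measurable_nn_integral) (simp add: case_prod_beta')
qed

lemma measurable_into_PiM:
  assumes "\<And>i. (\<lambda>x. f x i) \<in> M \<rightarrow>\<^sub>M N i"
  shows "f \<in> M \<rightarrow>\<^sub>M Pi\<^sub>M UNIV N"
  using assms by (intro measurable_PiM_single') (auto simp: space_PiM dest: measurable_space)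

lemma PiM_coordinates_indep:
  assumes "\<And>i. prob_space (N i)"
  shows "prob_space.indep_vars (Pi\<^sub>M UNIV N) N (\<lambda>i x. x i) UNIV"
proof -
  interpret prob_space "Pi\<^sub>M UNIV N" using assms by (intro prob_space_PiM) auto
  have "distr (Pi\<^sub>M UNIV N) (Pi\<^sub>M UNIV N) (\<lambda>x. \<lambda>i\<in>UNIV. x i) = Pi\<^sub>M UNIV N"
    by (simp add: restrict_UNIV distr_id)
  also have "\<dots> = (\<Pi>\<^sub>M i\<in>UNIV. distr (Pi\<^sub>M UNIV N) (N i) (\<lambda>x. x i))"
    by (intro PiM_cong) (simp_all add: distr_PiM_component assms)
  finally show ?thesis
    by (subst indep_vars_iff_distr_eq_PiM) auto
qed

lemma distr_eq_PiM_if_indep: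
  assumes "prob_space S" and "prob_space.indep_vars S N X UNIV"
  shows "distr S (Pi\<^sub>M UNIV N) (\<lambda>x i. X i x) = (\<Pi>\<^sub>M i\<in>UNIV. distr S (N i) (X i))"
proof -
  interpret prob_space S by fact
  have "\<And>i. random_variable (N i) (X i)" using assms(2) by (auto simp: indep_vars_def)
  then show ?thesis
    using indep_vars_iff_distr_eq_PiM[where I=UNIV and M'=N and X=X] assms(2) by (simp add: restrict_UNIV)
qed

lemma distr_PiM_coordinatewise:
  assumes "\<And>i. prob_space (K i)" and f: "\<And>i. f i \<in> measurable (K i) (N i)"
  shows "distr (Pi\<^sub>M UNIV K) (Pi\<^sub>M UNIV N) (\<lambda>x i. f i (x i)) = (\<Pi>\<^sub>M i\<in>UNIV. distr (K i) (N i) (f i))"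
proof -
  interpret prob_space "Pi\<^sub>M UNIV K" using assms by (intro prob_space_PiM) auto
  have "indep_vars N (\<lambda>i x. f i (x i)) UNIV"
    using indep_vars_compose2[OF PiM_coordinates_indep[OF assms(1)]] f by auto
  then have "distr (Pi\<^sub>M UNIV K) (Pi\<^sub>M UNIV N) (\<lambda>x i. f i (x i))
      = (\<Pi>\<^sub>M i\<in>UNIV. distr (Pi\<^sub>M UNIV K) (N i) (\<lambda>x. f i (x i)))"
    by (intro distr_eq_PiM_if_indep) unfold_locales
  also have "\<dots> = (\<Pi>\<^sub>M i\<in>UNIV. distr (K i) (N i) (f i))"
  proof (intro PiM_cong refl)
    fix i
    have "distr (K i) (N i) (f i) = distr (distr (Pi\<^sub>M UNIV K) (K i) (\<lambda>x. x i)) (N i) (f i)"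
      by (simp add: distr_PiM_component assms)
    also have "\<dots> = distr (Pi\<^sub>M UNIV K) (N i) (\<lambda>x. f i (x i))"
      using f by (subst distr_distr) (auto simp: comp_def)
    finally show "distr (Pi\<^sub>M UNIV K) (N i) (\<lambda>x. f i (x i)) = distr (K i) (N i) (f i)" ..
  qed
  finally show ?thesis .
qed

text \<open>Disjoint blocks of coordinates of a product measure are independent. The array of Gamma
  variables below is grouped once by rows and once by columns.\<close>
lemma distr_PiM_group:
  fixes e :: "'j \<Rightarrow> 'i \<Rightarrow> 'k"
  assumes N: "\<And>k. prob_space (N k)" and inj: "\<And>j i j' i'. e j i = e j' i' \<Longrightarrow> j = j' \<and> i = i'"
  shows "distr (Pi\<^sub>M UNIV N) (\<Pi>\<^sub>M j\<in>UNIV. \<Pi>\<^sub>M i\<in>UNIV. N (e j i)) (\<lambda>z j i. z (e j i))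
    = (\<Pi>\<^sub>M j\<in>UNIV. \<Pi>\<^sub>M i\<in>UNIV. N (e j i))"
proof -
  interpret prob_space "Pi\<^sub>M UNIV N" using N by (intro prob_space_PiM) auto
  define K where "K j = range (e j)" for j
  have "indep_vars (\<lambda>j. PiM (K j) N) (\<lambda>j x. restrict (\<lambda>k. x k) (K j)) UNIV"
    using inj by (intro indep_vars_restrict[OF PiM_coordinates_indep[OF N]])
      (auto simp: K_def disjoint_family_on_def)
  then have "indep_vars (\<lambda>j. \<Pi>\<^sub>M i\<in>UNIV. N (e j i)) (\<lambda>j x. (\<lambda>w i. w (e j i)) (restrict (\<lambda>k. x k) (K j))) UNIV"
  proof (rule indep_vars_compose2)
    fix j show "(\<lambda>w i. w (e j i)) \<in> (Pi\<^sub>M (K j) N) \<rightarrow>\<^sub>M (\<Pi>\<^sub>M i\<in>UNIV. N (e j i))"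
      by (intro measurable_PiM_single') (auto simp: K_def space_PiM PiE_iff intro!: measurable_component_singleton)
  qed
  then have "indep_vars (\<lambda>j. \<Pi>\<^sub>M i\<in>UNIV. N (e j i)) (\<lambda>j x i. x (e j i)) UNIV"
    by (simp add: K_def)
  then have "distr (Pi\<^sub>M UNIV N) (\<Pi>\<^sub>M j\<in>UNIV. \<Pi>\<^sub>M i\<in>UNIV. N (e j i)) (\<lambda>z j i. z (e j i))
    = (\<Pi>\<^sub>M j\<in>UNIV. distr (Pi\<^sub>M UNIV N) (\<Pi>\<^sub>M i\<in>UNIV. N (e j i)) (\<lambda>z i. z (e j i)))"
    by (intro distr_eq_PiM_if_indep) unfold_locales
  also have "\<dots> = (\<Pi>\<^sub>M j\<in>UNIV. \<Pi>\<^sub>M i\<in>UNIV. N (e j i))"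
  proof (intro PiM_cong refl)
    fix j
    show "distr (Pi\<^sub>M UNIV N) (\<Pi>\<^sub>M i\<in>UNIV. N (e j i)) (\<lambda>z i. z (e j i)) = (\<Pi>\<^sub>M i\<in>UNIV. N (e j i))"
      using distr_PiM_reindex[of UNIV N "e j" UNIV] N inj by (simp add: inj_on_def restrict_UNIV)
  qed
  finally show ?thesis .
qed

section \<open>Gamma laws\<close>

text \<open>With \<open>u = exp (- x)\<close> the hypothesis says that two measures on the unit interval have the same
  moments. By the Weierstrass theorem they integrate all continuous functions of \<open>u\<close> alike, and
  indicators of half-lines are pointwise limits of such functions.\<close>
lemma measure_eqI_exp_moments:
  fixes M N :: "real measure"
  assumes "finite_measure M" and "finite_measure N"
    and sM [measurable_cong]: "sets M = sets borel" and sN [measurable_cong]: "sets N = sets borel"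
    and pM: "AE x in M. 0 \<le> x" and pN: "AE x in N. 0 \<le> x"
    and eq: "\<And>k::nat. (\<integral>\<^sup>+x. ennreal (exp (- (real k * x))) \<partial>M) = (\<integral>\<^sup>+x. ennreal (exp (- (real k * x))) \<partial>N)"
  shows "M = N"
proof -
  interpret M: finite_measure M by fact
  interpret N: finite_measure N by fact
  \<comment> \<open>the cut at 0 keeps the values in the unit interval and changes \<open>exp (- x)\<close> on a null set only\<close>
  define e where "e x = exp (- max 0 x)" for x :: real
  have e01: "e x \<in> {0..1}" for x by (auto simp: e_def)
  have e_cont: "continuous_on UNIV e" unfolding e_def by (intro continuous_intros)
  have meas: "(\<lambda>x. f (e x)) \<in> borel_measurable borel" if "continuous_on {0..1} f" for f :: "real \<Rightarrow> real"
    using e01 by (intro borel_measurable_continuous_onI continuous_on_compose2[OF that e_cont]) auto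
  have int: "integrable L (\<lambda>x. f (e x))" if c: "continuous_on {0..1} f"
    and L: "finite_measure L" "sets L = sets borel" for f :: "real \<Rightarrow> real" and L
  proof -
    interpret L: finite_measure L by fact
    obtain B where "\<And>u. u \<in> {0..1} \<Longrightarrow> \<bar>f u\<bar> \<le> B"
      using compact_imp_bounded[OF compact_continuous_image[OF c compact_Icc]]
      by (fastforce simp: bounded_iff)
    then show ?thesis
      using e01 meas[OF c] L by (intro L.integrable_const_bound[where B=B]) (auto simp: measurable_cong_sets[OF L(2) refl])
  qed
  have pow: "(\<integral>x. e x ^ k \<partial>M) = (\<integral>x. e x ^ k \<partial>N)" for k :: nat
  proof -
    have *: "(\<integral>x. e x ^ k \<partial>L) = enn2real (\<integral>\<^sup>+x. ennreal (exp (- (real k * x))) \<partial>L)"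
      if "sets L = sets borel" "AE x in L. 0 \<le> x" for L
    proof -
      have eL: "e \<in> borel_measurable L"
        using borel_measurable_continuous_onI[OF e_cont] by (simp add: measurable_cong_sets[OF that(1) refl])
      have "(\<integral>x. e x ^ k \<partial>L) = enn2real (\<integral>\<^sup>+x. ennreal (e x ^ k) \<partial>L)"
        by (intro integral_eq_nn_integral borel_measurable_power eL) (auto simp: e_def)
      also have "(\<integral>\<^sup>+x. ennreal (e x ^ k) \<partial>L) = (\<integral>\<^sup>+x. ennreal (exp (- (real k * x))) \<partial>L)"
      proof (rule nn_integral_cong_AE)
        show "AE x in L. ennreal (e x ^ k) = ennreal (exp (- (real k * x)))"
          using that(2) by eventually_elim (simp add: e_def exp_of_nat_mult[symmetric])
      qed
      finally show ?thesis .
    qed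
    show ?thesis using *[OF sM pM] *[OF sN pN] eq by simp
  qed
  have cont: "(\<integral>x. f (e x) \<partial>M) = (\<integral>x. f (e x) \<partial>N)" if c: "continuous_on {0..1} f" for f :: "real \<Rightarrow> real"
  proof -
    define C where "C = measure M (space M) + measure N (space N)"
    have "\<bar>(\<integral>x. f (e x) \<partial>M) - (\<integral>x. f (e x) \<partial>N)\<bar> \<le> C * d" if "0 < d" for d
    proof -
      obtain g where g: "real_polynomial_function g" and fg: "\<And>x. x \<in> {0..1} \<Longrightarrow> \<bar>f x - g x\<bar> < d"
        using Stone_Weierstrass_real_polynomial_function[OF compact_Icc c \<open>0 < d\<close>] by metis
      then obtain b n where gb: "g = (\<lambda>x. \<Sum>i\<le>n. b i * x ^ i)"
        by (auto simp: real_polynomial_function_iff_sum)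
      have gc: "continuous_on {0..1} g" unfolding gb by (intro continuous_intros)
      have geq: "(\<integral>x. g (e x) \<partial>M) = (\<integral>x. g (e x) \<partial>N)"
      proof -
        have "integrable M (\<lambda>x. b i * e x ^ i)" "integrable N (\<lambda>x. b i * e x ^ i)" for i
          by (rule int[of "\<lambda>x. b i * x ^ i", OF _ assms(1) sM] int[of "\<lambda>x. b i * x ^ i", OF _ assms(2) sN];
              intro continuous_intros)+
        then show ?thesis unfolding gb by (simp add: pow)
      qed
      have *: "\<bar>(\<integral>x. f (e x) \<partial>L) - (\<integral>x. g (e x) \<partial>L)\<bar> \<le> measure L (space L) * d"
        if L: "finite_measure L" "sets L = sets borel" for L
      proof -
        interpret L: finite_measure L by fact
        have "\<bar>(\<integral>x. f (e x) \<partial>L) - (\<integral>x. g (e x) \<partial>L)\<bar> = \<bar>\<integral>x. f (e x) - g (e x) \<partial>L\<bar>"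
          by (subst Bochner_Integration.integral_diff) (auto intro!: int L c gc)
        also have "\<dots> \<le> (\<integral>x. \<bar>f (e x) - g (e x)\<bar> \<partial>L)" by (rule integral_abs_bound)
        also have "\<dots> \<le> (\<integral>x. d \<partial>L)"
          using fg e01 by (intro integral_mono Bochner_Integration.integrable_abs
            Bochner_Integration.integrable_diff int L c gc) (auto intro: less_imp_le)
        finally show ?thesis by (simp add: mult.commute)
      qed
      show ?thesis using *[OF assms(1) sM] *[OF assms(2) sN] geq by (simp add: C_def algebra_simps abs_le_iff)
    qed
    note bd = this
    show ?thesis
    proof (rule ccontr)
      assume ne: "\<not> ?thesis"
      define D where "D = \<bar>(\<integral>x. f (e x) \<partial>M) - (\<integral>x. f (e x) \<partial>N)\<bar>"
      have D: "D > 0" using ne by (simp add: D_def)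
      have C: "C \<ge> 0" by (simp add: C_def)
      have "D \<le> C * (D / (2 * (C + 1)))" unfolding D_def by (rule bd) (use D C D_def in auto)
      also have "\<dots> < D" using D C by (simp add: field_simps add_nonneg_pos)
      finally show False by simp
    qed
  qed
  have "cdf M t = cdf N t" for t
  proof (cases "t < 0")
    case True
    have "cdf L t = 0" if "sets L = sets borel" "AE x in L. 0 \<le> x" for L
    proof -
      have "emeasure L {..t} = 0"
      proof -
        have "AE x in L. \<not> x \<le> t" using that(2) by eventually_elim (use True in auto)
        from emeasure_eq_0_AE[OF this] show ?thesis
          by (simp add: sets_eq_imp_space_eq[OF that(1)] atMost_def)
      qed
      then show ?thesis by (simp add: cdf_def measure_def)
    qed
    then show ?thesis using sM pM sN pN by simp
  next
    case False
    \<comment> \<open>continuous in \<open>u\<close>, with limit the indicator of \<open>u \<ge> exp (- t)\<close>, that is of \<open>x \<le> t\<close>\<close>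
    define f where "f n u = max 0 (1 - real n * max 0 (exp (- t) - u))" for n u
    have fc: "continuous_on {0..1} (f n)" for n unfolding f_def by (intro continuous_intros)
    have lim: "(\<lambda>n. f n (e x)) \<longlonglongrightarrow> indicator {..t} x" for x
    proof (cases "x \<le> t")
      case True
      then have "exp (- t) \<le> e x" using False by (simp add: e_def)
      then show ?thesis using True by (simp add: f_def)
    next
      case xt: False
      then have "0 < exp (- t) - e x" using False by (simp add: e_def)
      then obtain n0 where n0: "1 < real n0 * (exp (- t) - e x)" using reals_Archimedean3 by blast
      have "f n (e x) = 0" if "n \<ge> n0" for n
      proof -
        have "real n0 * (exp (- t) - e x) \<le> real n * (exp (- t) - e x)"
          using that \<open>0 < exp (- t) - e x\<close> by (intro mult_right_mono) auto
        then have "1 < real n * (exp (- t) - e x)" using n0 by linarith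
        then show ?thesis using \<open>0 < exp (- t) - e x\<close> by (simp add: f_def)
      qed
      then have "eventually (\<lambda>n. f n (e x) = 0) sequentially" by (auto simp: eventually_sequentially)
      then show ?thesis using xt by (simp add: tendsto_eventually)
    qed
    have conv: "(\<lambda>n. \<integral>x. f n (e x) \<partial>L) \<longlonglongrightarrow> cdf L t" if L: "finite_measure L" "sets L = sets borel" for L
    proof -
      interpret L: finite_measure L by fact
      have "(\<lambda>n. \<integral>x. f n (e x) \<partial>L) \<longlonglongrightarrow> (\<integral>x. indicator {..t} x \<partial>L)"
      proof (rule integral_dominated_convergence[where w="\<lambda>_. 1"])
        show "(\<lambda>x. indicator {..t} x :: real) \<in> borel_measurable L"
          using L(2) by (intro borel_measurable_indicator) auto
        show "(\<lambda>x. f n (e x)) \<in> borel_measurable L" for n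
          using meas[OF fc] by (simp add: measurable_cong_sets[OF L(2) refl])
      qed (use lim in \<open>auto simp: f_def\<close>)
      then show ?thesis
        using sets_eq_imp_space_eq[OF L(2)] by (simp add: cdf_def)
    qed
    show ?thesis
      using LIMSEQ_unique[OF conv[OF assms(1) sM]] conv[OF assms(2) sN] cont[OF fc] by simp
  qed
  then have "cdf M = cdf N" by auto
  then show ?thesis
    by (intro cdf_unique') (auto simp: finite_borel_measure_def finite_borel_measure_axioms_def assms)
qed

lemma gamma_density_nonneg: "0 < a \<Longrightarrow> 0 \<le> gamma_density a g x"
  by (simp add: gamma_density_def Gamma_real_pos less_imp_le)

lemma gamma_density_measurable [measurable]: "gamma_density a g \<in> borel_measurable borel"
  unfolding gamma_density_def by measurable

lemma sets_gamma_distr [simp, measurable_cong]: "sets (gamma_distr a g) = sets borel"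
  by (simp add: gamma_distr_def)

lemma space_gamma_distr [simp]: "space (gamma_distr a g) = UNIV"
  by (simp add: gamma_distr_def)

lemma gamma_density_rescale:
  assumes "0 < c" "0 < g"
  shows "c * gamma_density a g (c * x) = gamma_density a (g * c) x"
proof (cases "0 < x")
  case True
  have "c * c powr (a - 1) = c powr a" using assms by (simp add: powr_diff)
  then have "c * (g powr a / Gamma a * (c * x) powr (a - 1) * exp (- g * (c * x)))
    = (g * c) powr a / Gamma a * x powr (a - 1) * exp (- (g * c) * x)"
    using True assms by (simp add: powr_mult mult_ac)
  then show ?thesis using True assms by (simp add: gamma_density_def)
next
  case False
  then show ?thesis using assms by (simp add: gamma_density_def zero_less_mult_iff)
qed

lemma distr_gamma_distr_scale:
  assumes "0 < a" "0 < c" "0 < g"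
  shows "distr (gamma_distr a g) borel (\<lambda>x. x / c) = gamma_distr a (g * c)"
proof (rule measure_eqI)
  fix A assume "A \<in> sets (distr (gamma_distr a g) borel (\<lambda>x. x / c))"
  then have [measurable]: "A \<in> sets borel" by simp
  have [measurable]: "(\<lambda>x. x / c) -` A \<in> sets borel"
    using measurable_sets[of "\<lambda>x. x / c" borel borel A] by simp
  have "emeasure (distr (gamma_distr a g) borel (\<lambda>x. x / c)) A
    = (\<integral>\<^sup>+x. ennreal (gamma_density a g x) * indicator A (x / c) \<partial>lborel)"
    by (simp add: emeasure_distr gamma_distr_def emeasure_density indicator_def vimage_def)
  also have "\<dots> = ennreal c * (\<integral>\<^sup>+x. ennreal (gamma_density a g (c * x)) * indicator A x \<partial>lborel)"
    using assms by (subst nn_integral_real_affine[where t=0 and c=c]) auto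
  also have "\<dots> = (\<integral>\<^sup>+x. ennreal (c * gamma_density a g (c * x)) * indicator A x \<partial>lborel)"
    using assms by (subst nn_integral_cmult[symmetric]) (auto simp: ennreal_mult' mult.assoc)
  also have "\<dots> = emeasure (gamma_distr a (g * c)) A"
    using assms by (simp add: gamma_density_rescale gamma_distr_def emeasure_density)
  finally show "emeasure (distr (gamma_distr a g) borel (\<lambda>x. x / c)) A = emeasure (gamma_distr a (g * c)) A" .
qed simp

lemma prob_space_gamma_distr:
  assumes "0 < a" "0 < g"
  shows "prob_space (gamma_distr a g)"
proof -
  have "ennreal (Gamma a) = (\<integral>\<^sup>+t. ennreal (indicator {0..} t * t powr (a - 1) / exp t) \<partial>lborel)"
    using assms by (simp add: Gamma_conv_nn_integral_real)
  also have "\<dots> = (\<integral>\<^sup>+t. ennreal (Gamma a) * ennreal (gamma_density a 1 t) \<partial>lborel)"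
  proof (rule nn_integral_cong_AE)
    have "AE t in lborel. t \<noteq> (0::real)" by (rule AE_lborel_singleton)
    then show "AE t in lborel. ennreal (indicator {0..} t * t powr (a - 1) / exp t)
      = ennreal (Gamma a) * ennreal (gamma_density a 1 t)"
    proof eventually_elim
      case (elim t)
      show ?case
        using elim Gamma_real_pos[OF assms(1)]
        by (auto simp: gamma_density_def ennreal_mult'[symmetric] exp_minus field_simps indicator_def)
    qed
  qed
  also have "\<dots> = ennreal (Gamma a) * emeasure (gamma_distr a 1) UNIV"
    by (subst nn_integral_cmult) (auto simp: gamma_distr_def emeasure_density)
  finally have "emeasure (gamma_distr a 1) UNIV = 1"
    using Gamma_real_pos[OF assms(1)]
    by (metis ennreal_mult_cancel_left ennreal_neq_top ennreal_eq_0_iff mult.right_neutral not_le)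
  then have "prob_space (gamma_distr a 1)" by (intro prob_spaceI) simp
  then have "prob_space (distr (gamma_distr a 1) borel (\<lambda>x. x / g))"
    by (rule prob_space.prob_space_distr) (simp add: gamma_distr_def)
  then show ?thesis using distr_gamma_distr_scale[of a g 1] assms by simp
qed

lemma AE_gamma_distr_pos: "AE x in gamma_distr a g. 0 < x"
  unfolding gamma_distr_def by (subst AE_density) (auto simp: gamma_density_def)

text \<open>An exponential tilt changes only the rate of a Gamma density; the constant that appears is the
  Laplace transform.\<close>
lemma nn_integral_gamma_distr_tilt:
  assumes "0 < a" "0 < g" "0 \<le> k" and [measurable]: "A \<in> sets borel"
  shows "(\<integral>\<^sup>+x. indicator A x * ennreal (exp (- (k * x))) \<partial>gamma_distr a g)
    = ennreal ((g / (g + k)) powr a) * emeasure (gamma_distr a (g + k)) A"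
proof -
  have "gamma_density a g x * exp (- (k * x)) = (g / (g + k)) powr a * gamma_density a (g + k) x" for x
    using assms by (simp add: gamma_density_def powr_divide exp_add[symmetric] algebra_simps)
  then have *: "ennreal (gamma_density a g x) * ennreal (exp (- (k * x)))
      = ennreal ((g / (g + k)) powr a) * ennreal (gamma_density a (g + k) x)" for x
    by (simp add: ennreal_mult''[symmetric] gamma_density_nonneg assms)
  have "(\<integral>\<^sup>+x. indicator A x * ennreal (exp (- (k * x))) \<partial>gamma_distr a g)
    = (\<integral>\<^sup>+x. ennreal (gamma_density a g x) * (indicator A x * ennreal (exp (- (k * x)))) \<partial>lborel)"
    unfolding gamma_distr_def by (subst nn_integral_density) auto
  also have "\<dots> = (\<integral>\<^sup>+x. ennreal ((g / (g + k)) powr a) * (ennreal (gamma_density a (g + k) x) * indicator A x) \<partial>lborel)"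
    using arg_cong[OF *, of "\<lambda>z. z * indicator A _"] by (intro nn_integral_cong) (simp add: mult_ac)
  also have "\<dots> = ennreal ((g / (g + k)) powr a) * emeasure (gamma_distr a (g + k)) A"
    by (subst nn_integral_cmult) (auto simp: gamma_distr_def emeasure_density)
  finally show ?thesis .
qed

text \<open>Multiplication of the density by \<open>x\<close> raises the shape by one. Two applications give the first two
  moments.\<close>
lemma nn_integral_gamma_distr_mult:
  assumes "0 < a" "0 < g" and [measurable]: "f \<in> borel_measurable borel"
  shows "(\<integral>\<^sup>+x. ennreal x * f x \<partial>gamma_distr a g) = ennreal (a / g) * (\<integral>\<^sup>+x. f x \<partial>gamma_distr (a + 1) g)"
proof -
  have "ennreal (gamma_density a g x) * ennreal x = ennreal (a / g) * ennreal (gamma_density (a + 1) g x)" for x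
  proof (cases "x > 0")
    case True
    have "Gamma (a + 1) = a * Gamma a" using assms by (intro Gamma_plus1) (auto simp: nonpos_Ints_def)
    moreover have "x powr a = x * x powr (a - 1)" using True by (simp add: powr_diff)
    ultimately have "gamma_density a g x * x = a / g * gamma_density (a + 1) g x"
      using True assms Gamma_real_pos[of a] by (simp add: gamma_density_def powr_add field_simps)
    then show ?thesis
      using True assms by (simp add: ennreal_mult''[symmetric] gamma_density_nonneg)
  qed (simp add: gamma_density_def)
  note * = this
  have "(\<integral>\<^sup>+x. ennreal x * f x \<partial>gamma_distr a g)
    = (\<integral>\<^sup>+x. ennreal (gamma_density a g x) * (ennreal x * f x) \<partial>lborel)"
    unfolding gamma_distr_def by (subst nn_integral_density) auto
  also have "\<dots> = (\<integral>\<^sup>+x. ennreal (a / g) * (ennreal (gamma_density (a + 1) g x) * f x) \<partial>lborel)"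
    using arg_cong[OF *, of "\<lambda>z. z * f _"] by (intro nn_integral_cong) (simp add: mult_ac)
  also have "\<dots> = ennreal (a / g) * (\<integral>\<^sup>+x. f x \<partial>gamma_distr (a + 1) g)"
    unfolding gamma_distr_def by (subst nn_integral_density, simp, simp, subst nn_integral_cmult) auto
  finally show ?thesis .
qed

text \<open>The Gamma law with shape 0 is the unit mass at 0. With this convention the formulas for scaling,
  tilting and moments hold for all shapes \<open>a \<ge> 0\<close>, as they must for the coordinates of a Dirichlet
  vector whose parameter vanishes.\<close>
definition gamma0 :: "real \<Rightarrow> real \<Rightarrow> real measure" where
  "gamma0 a g = (if a = 0 then return borel 0 else gamma_distr a g)"

lemma sets_gamma0 [simp, measurable_cong]: "sets (gamma0 a g) = sets borel"
  by (simp add: gamma0_def)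

lemma space_gamma0 [simp]: "space (gamma0 a g) = UNIV"
  by (simp add: gamma0_def)

lemma prob_space_gamma0: "0 \<le> a \<Longrightarrow> 0 < g \<Longrightarrow> prob_space (gamma0 a g)"
  by (simp add: gamma0_def prob_space_gamma_distr prob_space_return)

lemma AE_gamma0_nonneg: "AE x in gamma0 a g. 0 \<le> x"
proof (cases "a = 0")
  case False
  have "AE x in gamma_distr a g. 0 \<le> x" using AE_gamma_distr_pos[of a g] by eventually_elim simp
  moreover have eq: "gamma0 a g = gamma_distr a g" using False by (simp add: gamma0_def)
  ultimately show ?thesis unfolding eq by simp
next
  case True
  then have eq: "gamma0 a g = return borel 0" by (simp add: gamma0_def)
  show ?thesis unfolding eq by (simp add: AE_return)
qed

lemma distr_gamma0_scale:
  assumes "0 \<le> a" "0 < c" "0 < g"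
  shows "distr (gamma0 a g) borel (\<lambda>x. x / c) = gamma0 a (g * c)"
  using assms by (simp add: gamma0_def distr_gamma_distr_scale distr_return)

lemma nn_integral_gamma0_tilt:
  assumes "0 \<le> a" "0 < g" "0 \<le> k" and [measurable]: "A \<in> sets borel"
  shows "(\<integral>\<^sup>+x. indicator A x * ennreal (exp (- (k * x))) \<partial>gamma0 a g)
    = ennreal ((g / (g + k)) powr a) * emeasure (gamma0 a (g + k)) A"
  using assms by (simp add: gamma0_def nn_integral_gamma_distr_tilt nn_integral_return)

lemma nn_integral_gamma0_ident:
  assumes "0 \<le> a" "0 < g"
  shows "(\<integral>\<^sup>+x. ennreal x \<partial>gamma0 a g) = ennreal (a / g)"
proof (cases "a = 0")
  case False
  then interpret prob_space "gamma_distr (a + 1) g" using assms by (intro prob_space_gamma_distr) auto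
  show ?thesis
    using nn_integral_gamma_distr_mult[of a g "\<lambda>_. 1"] assms False emeasure_space_1 by (simp add: gamma0_def)
qed (simp add: gamma0_def nn_integral_return)

lemma nn_integral_gamma0_square:
  assumes "0 \<le> a" "0 < g"
  shows "(\<integral>\<^sup>+x. ennreal x * ennreal x \<partial>gamma0 a g) = ennreal (a * (a + 1) / g\<^sup>2)"
proof (cases "a = 0")
  case False
  then interpret prob_space "gamma_distr (a + 1 + 1) g" using assms by (intro prob_space_gamma_distr) auto
  show ?thesis
    using nn_integral_gamma_distr_mult[of a g "\<lambda>x. ennreal x * 1"]
      nn_integral_gamma_distr_mult[of "a + 1" g "\<lambda>x. 1"] assms False emeasure_space_1
    by (simp add: gamma0_def ennreal_mult'[symmetric] power2_eq_square)
qed (simp add: gamma0_def nn_integral_return)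

section \<open>Totals and proportions of independent Gamma variables\<close>

text \<open>The intervals exhaust the integers. Adding the finite set \<open>J\<close> keeps all coordinates of a cylinder
  over \<open>J\<close> inside every finite approximation.\<close>
lemma filterlim_int_intervals:
  "finite J \<Longrightarrow> filterlim (\<lambda>n::nat. {- int n..int n} \<union> J) (finite_subsets_at_top UNIV) sequentially"
  unfolding filterlim_finite_subsets_at_top
proof (intro allI impI)
  fix X :: "int set" assume J: "finite J" and "finite X \<and> X \<subseteq> UNIV"
  then have X: "finite X" by simp
  define N where "N = (\<Sum>x\<in>X. nat \<bar>x\<bar>)"
  have "nat \<bar>x\<bar> \<le> N" if "x \<in> X" for x
    unfolding N_def by (rule member_le_sum[OF that]) (use X in auto)
  then have "\<And>x. x \<in> X \<Longrightarrow> \<bar>x\<bar> \<le> int N" by (metis nat_le_iff)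
  then have "finite ({- int n..int n} \<union> J) \<and> X \<subseteq> {- int n..int n} \<union> J" if "n \<ge> N" for n
    using that J by (fastforce simp: abs_le_iff)
  then show "\<forall>\<^sub>F n in sequentially. finite ({- int n..int n} \<union> J) \<and> X \<subseteq> {- int n..int n} \<union> J \<and> {- int n..int n} \<union> J \<subseteq> UNIV"
    by (auto simp: eventually_sequentially)
qed

lemma has_sum_LIMSEQ_int:
  fixes f :: "int \<Rightarrow> real"
  assumes "(f has_sum s) UNIV" "finite J"
  shows "(\<lambda>n. \<Sum>i\<in>{- int n..int n} \<union> J. f i) \<longlonglongrightarrow> s"
  using filterlim_compose[OF _ filterlim_int_intervals[OF assms(2)], of "sum f"] assms(1)
  by (simp add: has_sum_def)

lemma nn_integral_PiM_prod:
  fixes f :: "'i \<Rightarrow> 'a \<Rightarrow> ennreal"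
  assumes N: "\<And>i. prob_space (N i)" and "finite F" and f: "\<And>i. f i \<in> borel_measurable (N i)"
  shows "(\<integral>\<^sup>+x. (\<Prod>i\<in>F. f i (x i)) \<partial>Pi\<^sub>M UNIV N) = (\<Prod>i\<in>F. \<integral>\<^sup>+x. f i x \<partial>N i)"
proof -
  interpret prob_space "Pi\<^sub>M UNIV N" using N by (intro prob_space_PiM) auto
  have "indep_vars (\<lambda>_. borel) (\<lambda>i x. f i (x i)) UNIV"
    by (rule indep_vars_compose2[where Y=f and X="\<lambda>i x. x i", OF PiM_coordinates_indep[OF N] f])
  then have "indep_vars (\<lambda>_. borel) (\<lambda>i x. f i (x i)) F" by (rule indep_vars_subset) simp
  then have "(\<integral>\<^sup>+x. (\<Prod>i\<in>F. f i (x i)) \<partial>Pi\<^sub>M UNIV N) = (\<Prod>i\<in>F. \<integral>\<^sup>+x. f i (x i) \<partial>Pi\<^sub>M UNIV N)"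
    using assms(2) by (intro indep_vars_nn_integral) auto
  also have "\<dots> = (\<Prod>i\<in>F. \<integral>\<^sup>+x. f i x \<partial>N i)"
  proof (intro prod.cong refl)
    fix i
    have "(\<integral>\<^sup>+x. f i x \<partial>N i) = (\<integral>\<^sup>+x. f i x \<partial>distr (Pi\<^sub>M UNIV N) (N i) (\<lambda>x. x i))"
      by (simp add: distr_PiM_component N)
    also have "\<dots> = (\<integral>\<^sup>+x. f i (x i) \<partial>Pi\<^sub>M UNIV N)"
      by (rule nn_integral_distr) (use f in auto)
    finally show "(\<integral>\<^sup>+x. f i (x i) \<partial>Pi\<^sub>M UNIV N) = (\<integral>\<^sup>+x. f i x \<partial>N i)" ..
  qed
  finally show ?thesis .
qed

locale summable_shapes =
  fixes \<alpha> :: "int \<Rightarrow> real" and a :: real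
  assumes shape_nonneg: "\<And>i. 0 \<le> \<alpha> i" and shape_sum: "(\<alpha> has_sum a) UNIV" and total_pos: "0 < a"
begin

text \<open>The independent variables \<open>Y\<^sub>i\<close> of common rate \<open>g\<close> whose proportions form the Dirichlet vector.\<close>
abbreviation G :: "real \<Rightarrow> (int \<Rightarrow> real) measure" where
  "G g \<equiv> Pi\<^sub>M UNIV (\<lambda>i. gamma0 (\<alpha> i) g)"

lemma nn_shape_sum: "(\<integral>\<^sup>+i. ennreal (\<alpha> i) \<partial>count_space UNIV) = ennreal a"
proof -
  have "(\<integral>\<^sup>+i. ennreal (\<alpha> i) \<partial>count_space UNIV) < \<infinity>"
    using summable_on_nonneg_iff[of \<alpha>] shape_nonneg has_sum_imp_summable[OF shape_sum] by simp
  from ennreal_infsum_nonneg[OF shape_nonneg this] show ?thesis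
    using infsumI[OF shape_sum] by simp
qed

lemma prob_space_G: "0 < g \<Longrightarrow> prob_space (G g)"
  by (intro prob_space_PiM prob_space_gamma0 shape_nonneg)

lemma AE_G_nonneg: "0 < g \<Longrightarrow> AE y in G g. \<forall>i. 0 \<le> y i"
  unfolding AE_all_countable
  by (intro allI AE_PiM_component prob_space_gamma0 shape_nonneg AE_gamma0_nonneg) auto

lemma AE_G_summable:
  assumes "0 < g"
  shows "AE y in G g. y summable_on UNIV"
proof -
  interpret prob_space "G g" using assms by (rule prob_space_G)
  have "(\<integral>\<^sup>+y. (\<integral>\<^sup>+i. ennreal (y i) \<partial>count_space UNIV) \<partial>G g)
      = (\<integral>\<^sup>+i. (\<integral>\<^sup>+y. ennreal (y i) \<partial>G g) \<partial>count_space UNIV)"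
    by (rule nn_integral_count_space_Fubini) (unfold_locales, measurable)
  also have "\<dots> = (\<integral>\<^sup>+i. ennreal (\<alpha> i / g) \<partial>count_space UNIV)"
    using nn_integral_PiM_prod[of "\<lambda>i. gamma0 (\<alpha> i) g" "{_}" "\<lambda>i. ennreal"] assms
    by (intro nn_integral_cong) (simp add: prob_space_gamma0 shape_nonneg nn_integral_gamma0_ident)
  also have "\<dots> = (\<integral>\<^sup>+i. ennreal (1 / g) * ennreal (\<alpha> i) \<partial>count_space UNIV)"
    using assms by (intro nn_integral_cong) (simp add: ennreal_mult'[symmetric] shape_nonneg)
  also have "\<dots> = ennreal (1 / g) * ennreal a"
    by (subst nn_integral_cmult) (auto simp: nn_shape_sum)
  also have "\<dots> < \<infinity>" by (simp add: ennreal_mult_less_top)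
  finally have fin: "(\<integral>\<^sup>+y. (\<integral>\<^sup>+i. ennreal (y i) \<partial>count_space UNIV) \<partial>G g) \<noteq> \<infinity>" by simp
  have "AE y in G g. (\<integral>\<^sup>+i. ennreal (y i) \<partial>count_space UNIV) \<noteq> \<infinity>"
    by (rule nn_integral_PInf_AE[OF _ fin]) measurable
  then show ?thesis
    using AE_G_nonneg[OF assms]
    by eventually_elim (subst summable_on_nonneg_iff, auto simp: less_top)
qed

lemma distr_G_scale:
  assumes "0 < c" "0 < g"
  shows "distr (G g) seq_space (\<lambda>y i. y i / c) = G (g * c)"
  using distr_PiM_coordinatewise[of "\<lambda>i. gamma0 (\<alpha> i) g" "\<lambda>i x. x / c" "\<lambda>_. borel"] assms
  by (simp add: prob_space_gamma0 shape_nonneg distr_gamma0_scale)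

lemma sets_G [simp, measurable_cong]: "sets (G g) = sets seq_space"
  by (intro sets_PiM_cong) auto

text \<open>Tilting by \<open>exp (- k S)\<close>, where \<open>S\<close> is the total of all coordinates, replaces the rate 1 by
  \<open>1 + k\<close>. For the sum over a finite index set this holds coordinate by coordinate, with a constant
  whose exponent is the sum of the shapes; dominated convergence along growing finite sets gives the
  infinite total and the exponent \<open>a\<close>.\<close>
lemma nn_integral_G_tilt:
  assumes k: "0 \<le> k" and A: "A \<in> sets seq_space"
  shows "(\<integral>\<^sup>+y. indicator A y * ennreal (exp (- (k * (\<Sum>\<^sub>\<infinity>i. y i)))) \<partial>G 1)
    = ennreal ((1 / (1 + k)) powr a) * emeasure (G (1 + k)) A"
proof -
  interpret G1: prob_space "G 1" by (rule prob_space_G) simp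
  interpret Gk: product_prob_space "\<lambda>i. gamma0 (\<alpha> i) (1 + k)" UNIV
    by (intro product_prob_spaceI prob_space_gamma0 shape_nonneg) (use k in auto)
  define c where "c = (1 + k) powr a"
  have c: "c > 0" using k by (simp add: c_def)
  have cinv: "(1 / (1 + k)) powr a = 1 / c" using k by (simp add: c_def powr_divide)
  \<comment> \<open>the tilted law with its normalising constant; it is compared with the product law on cylinders\<close>
  define D where "D = density (G 1) (\<lambda>y. ennreal c * ennreal (exp (- (k * (\<Sum>\<^sub>\<infinity>i. y i)))))"
  have D_em: "emeasure D A = ennreal c * (\<integral>\<^sup>+y. indicator A y * ennreal (exp (- (k * (\<Sum>\<^sub>\<infinity>i. y i)))) \<partial>G 1)"
    if [measurable]: "A \<in> sets seq_space" for A
  proof -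
    have "emeasure D A = (\<integral>\<^sup>+y. ennreal c * (indicator A y * ennreal (exp (- (k * (\<Sum>\<^sub>\<infinity>i. y i))))) \<partial>G 1)"
      unfolding D_def by (subst emeasure_density) (auto intro!: nn_integral_cong simp: mult_ac)
    then show ?thesis by (simp add: nn_integral_cmult)
  qed
  have "D = G (1 + k)"
  proof (rule Gk.PiM_eq)
    show "sets D = sets (G (1 + k))" by (simp add: D_def)
    fix J F assume J: "finite J" "J \<subseteq> UNIV" and "\<And>j. j \<in> J \<Longrightarrow> F j \<in> sets (gamma0 (\<alpha> j) (1 + k))"
    then have F: "\<And>j. j \<in> J \<Longrightarrow> F j \<in> sets borel" by simp
    define B where "B = prod_emb UNIV (\<lambda>i. gamma0 (\<alpha> i) (1 + k)) J (Pi\<^sub>E J F)"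
    have B: "B \<in> sets seq_space"
      using sets_PiM_I[OF J, of F "\<lambda>i. gamma0 (\<alpha> i) (1 + k)"] F
      by (simp add: B_def)
    have memB: "y \<in> B \<longleftrightarrow> (\<forall>j\<in>J. y j \<in> F j)" for y
      by (auto simp: B_def prod_emb_def PiE_iff)
    define I where "I n = {- int n..int n} \<union> J" for n
    have I: "finite (I n)" "J \<subseteq> I n" for n by (auto simp: I_def J)
    define h where "h n y = indicator B y * ennreal (exp (- (k * (\<Sum>i\<in>I n. y i))))" for n and y :: "int \<Rightarrow> real"
    \<comment> \<open>the coordinates outside \<open>J\<close> carry the trivial event, so that the tilt factorises\<close>
    define E where "E i = (if i \<in> J then F i else UNIV)" for i
    have E: "E i \<in> sets borel" for i using F by (simp add: E_def)
    have h_prod: "h n y = (\<Prod>i\<in>I n. indicator (E i) (y i) * ennreal (exp (- (k * y i))))" for n y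
    proof -
      have "(\<Prod>i\<in>I n. indicator (E i) (y i) :: ennreal) = indicator B y"
      proof (cases "y \<in> B")
        case True
        then show ?thesis by (auto intro!: prod.neutral simp: memB E_def indicator_def)
      next
        case False
        then obtain j where "j \<in> J" "y j \<notin> F j" by (auto simp: memB)
        then show ?thesis using False I[of n] by (auto simp: indicator_def E_def intro!: prod_zero)
      qed
      moreover have "(\<Prod>i\<in>I n. ennreal (exp (- (k * y i)))) = ennreal (exp (- (k * (\<Sum>i\<in>I n. y i))))"
        by (simp add: prod_ennreal exp_sum I sum_distrib_left sum_negf[symmetric])
      ultimately show ?thesis by (simp add: h_def prod.distrib)
    qed
    have int_h: "(\<integral>\<^sup>+y. h n y \<partial>G 1)
        = ennreal ((1 / (1 + k)) powr (\<Sum>i\<in>I n. \<alpha> i)) * (\<Prod>j\<in>J. emeasure (gamma0 (\<alpha> j) (1 + k)) (F j))" for n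
    proof -
      have "(\<integral>\<^sup>+y. h n y \<partial>G 1)
          = (\<Prod>i\<in>I n. \<integral>\<^sup>+x. indicator (E i) x * ennreal (exp (- (k * x))) \<partial>gamma0 (\<alpha> i) 1)"
        unfolding h_prod using E
        by (intro nn_integral_PiM_prod) (auto simp: prob_space_gamma0 shape_nonneg I)
      also have "\<dots> = (\<Prod>i\<in>I n. ennreal ((1 / (1 + k)) powr \<alpha> i) * emeasure (gamma0 (\<alpha> i) (1 + k)) (E i))"
        using E k by (intro prod.cong refl nn_integral_gamma0_tilt) (auto simp: shape_nonneg)
      also have "\<dots> = ennreal (\<Prod>i\<in>I n. (1 / (1 + k)) powr \<alpha> i) * (\<Prod>i\<in>I n. emeasure (gamma0 (\<alpha> i) (1 + k)) (E i))"
        by (simp add: prod.distrib prod_ennreal)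
      also have "(\<Prod>i\<in>I n. (1 / (1 + k)) powr \<alpha> i) = (1 / (1 + k)) powr (\<Sum>i\<in>I n. \<alpha> i)"
        using k by (intro powr_sum[symmetric]) (auto simp: I)
      also have "(\<Prod>i\<in>I n. emeasure (gamma0 (\<alpha> i) (1 + k)) (E i)) = (\<Prod>j\<in>J. emeasure (gamma0 (\<alpha> j) (1 + k)) (F j))"
      proof -
        have "emeasure (gamma0 (\<alpha> i) (1 + k)) UNIV = 1" for i
          using prob_space.emeasure_space_1[OF prob_space_gamma0[OF shape_nonneg[of i], of "1 + k"]] k by simp
        then have "(\<Prod>i\<in>I n. emeasure (gamma0 (\<alpha> i) (1 + k)) (E i)) = (\<Prod>i\<in>J. emeasure (gamma0 (\<alpha> i) (1 + k)) (E i))"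
          by (intro prod.mono_neutral_right I) (auto simp: E_def)
        then show ?thesis by (simp add: E_def)
      qed
      finally show ?thesis .
    qed
    have "(\<lambda>n. \<integral>\<^sup>+y. h n y \<partial>G 1) \<longlonglongrightarrow> (\<integral>\<^sup>+y. indicator B y * ennreal (exp (- (k * (\<Sum>\<^sub>\<infinity>i. y i)))) \<partial>G 1)"
    proof (rule nn_integral_dominated_convergence[where w="\<lambda>_. 1"])
      show "h n \<in> borel_measurable (G 1)" for n unfolding h_def using B by measurable
      show "AE y in G 1. h n y \<le> 1" for n
        using AE_G_nonneg[of 1, simplified]
        by eventually_elim (auto simp: h_def indicator_def k intro!: mult_nonneg_nonneg sum_nonneg)
      show "AE y in G 1. (\<lambda>n. h n y) \<longlonglongrightarrow> indicator B y * ennreal (exp (- (k * (\<Sum>\<^sub>\<infinity>i. y i))))"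
        using AE_G_summable[of 1, simplified]
      proof eventually_elim
        case (elim y)
        have "(\<lambda>n. \<Sum>i\<in>I n. y i) \<longlonglongrightarrow> (\<Sum>\<^sub>\<infinity>i. y i)"
          unfolding I_def by (rule has_sum_LIMSEQ_int[OF has_sum_infsum[OF elim] J(1)])
        then have "(\<lambda>n. ennreal (exp (- (k * (\<Sum>i\<in>I n. y i))))) \<longlonglongrightarrow> ennreal (exp (- (k * (\<Sum>\<^sub>\<infinity>i. y i))))"
          by (intro tendsto_intros)
        then show ?case unfolding h_def by (intro tendsto_mult_ennreal tendsto_const) (auto simp: indicator_def)
      qed
    qed (use B G1.emeasure_space_1 in \<open>auto intro: measurable_compose\<close>)
    moreover have "(\<lambda>n. \<integral>\<^sup>+y. h n y \<partial>G 1) \<longlonglongrightarrow> ennreal ((1 / (1 + k)) powr a) * (\<Prod>j\<in>J. emeasure (gamma0 (\<alpha> j) (1 + k)) (F j))"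
    proof -
      have "(\<lambda>n. \<Sum>i\<in>I n. \<alpha> i) \<longlonglongrightarrow> a" unfolding I_def by (rule has_sum_LIMSEQ_int[OF shape_sum J(1)])
      then have "(\<lambda>n. ennreal ((1 / (1 + k)) powr (\<Sum>i\<in>I n. \<alpha> i))) \<longlonglongrightarrow> ennreal ((1 / (1 + k)) powr a)"
        using k by (intro tendsto_intros) auto
      then show ?thesis unfolding int_h
        by (intro tendsto_mult_ennreal tendsto_const) (use c in \<open>auto simp: cinv\<close>)
    qed
    ultimately have *: "(\<integral>\<^sup>+y. indicator B y * ennreal (exp (- (k * (\<Sum>\<^sub>\<infinity>i. y i)))) \<partial>G 1)
        = ennreal (1 / c) * (\<Prod>j\<in>J. emeasure (gamma0 (\<alpha> j) (1 + k)) (F j))"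
      unfolding cinv by (rule LIMSEQ_unique)
    show "emeasure D (prod_emb UNIV (\<lambda>i. gamma0 (\<alpha> i) (1 + k)) J (Pi\<^sub>E J F)) = (\<Prod>j\<in>J. emeasure (gamma0 (\<alpha> j) (1 + k)) (F j))"
      using D_em[OF B] * c by (simp add: B_def mult.assoc[symmetric] ennreal_mult'[symmetric])
  qed
  then have "ennreal (1 / c) * emeasure (G (1 + k)) A = ennreal (1 / c) * emeasure D A" by simp
  also have "\<dots> = (\<integral>\<^sup>+y. indicator A y * ennreal (exp (- (k * (\<Sum>\<^sub>\<infinity>i. y i)))) \<partial>G 1)"
    using c by (simp add: D_em[OF A] mult.assoc[symmetric] ennreal_mult'[symmetric])
  finally show ?thesis by (simp add: cinv)
qed

end

lemma measurable_divide_infsum [measurable]: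
  "(\<lambda>y i. y i / (\<Sum>\<^sub>\<infinity>k. y k)) \<in> seq_space \<rightarrow>\<^sub>M (seq_space :: (int \<Rightarrow> real) measure)"
  by (rule measurable_into_PiM) measurable

lemma measurable_divide_const [measurable]:
  "(\<lambda>y i. y i / c) \<in> seq_space \<rightarrow>\<^sub>M (seq_space :: (int \<Rightarrow> real) measure)"
  by (rule measurable_into_PiM) measurable

lemma measurable_scale_sequence [measurable]:
  "(\<lambda>(t, q) j. t * q j) \<in> borel \<Otimes>\<^sub>M seq_space \<rightarrow>\<^sub>M (seq_space :: (int \<Rightarrow> real) measure)"
  unfolding case_prod_beta' by (rule measurable_into_PiM) measurable

lemma measurable_scale_sequence' [measurable]:
  "(\<lambda>x j. fst x * snd x j) \<in> borel \<Otimes>\<^sub>M seq_space \<rightarrow>\<^sub>M (seq_space :: (int \<Rightarrow> real) measure)"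
  by (rule measurable_into_PiM) measurable

context summable_shapes
begin

lemma measurable_G_iff: "f \<in> G g \<rightarrow>\<^sub>M N \<longleftrightarrow> f \<in> seq_space \<rightarrow>\<^sub>M N"
  by (simp only: measurable_cong_sets[OF sets_G refl])

lemma dirichlet_eq_distr_G: "dirichlet \<alpha> = distr (G 1) seq_space (\<lambda>y i. y i / (\<Sum>\<^sub>\<infinity>k. y k))"
  unfolding dirichlet_def gamma0_def ..

lemma nn_integral_G_exp_sum:
  "0 \<le> k \<Longrightarrow> (\<integral>\<^sup>+y. ennreal (exp (- (k * (\<Sum>\<^sub>\<infinity>i. y i)))) \<partial>G 1) = ennreal ((1 / (1 + k)) powr a)"
  using nn_integral_G_tilt[of k UNIV] prob_space.emeasure_space_1[OF prob_space_G[of "1 + k"]]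
    sets.top[of seq_space] by (simp add: space_PiM)

lemma AE_G_sum_nonneg: "0 < g \<Longrightarrow> AE y in G g. 0 \<le> (\<Sum>\<^sub>\<infinity>i. y i)"
  using AE_G_nonneg[of g] by (auto elim!: eventually_mono intro: infsum_nonneg)

text \<open>The tilt of the whole space is the Laplace transform of the total.\<close>
lemma distr_G_sum_1: "distr (G 1) borel (\<lambda>y. \<Sum>\<^sub>\<infinity>i. y i) = gamma_distr a 1"
proof -
  interpret G1: prob_space "G 1" by (rule prob_space_G) simp
  interpret GD: prob_space "gamma_distr a 1" by (rule prob_space_gamma_distr) (use total_pos in auto)
  have meas [measurable]: "(\<lambda>y. \<Sum>\<^sub>\<infinity>i. y i) \<in> borel_measurable (G 1)" by measurable
  show ?thesis
  proof (rule measure_eqI_exp_moments)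
    show "finite_measure (distr (G 1) borel (\<lambda>y. \<Sum>\<^sub>\<infinity>i. y i))"
      using G1.prob_space_distr[OF meas] by (simp add: prob_space_def)
    show "finite_measure (gamma_distr a 1)" by unfold_locales
    show "AE x in distr (G 1) borel (\<lambda>y. \<Sum>\<^sub>\<infinity>i. y i). 0 \<le> x"
      using AE_G_sum_nonneg[of 1] by (subst AE_distr_iff) auto
    show "AE x in gamma_distr a 1. 0 \<le> x" using AE_gamma_distr_pos[of a 1] by eventually_elim simp
    fix k :: nat
    have "(\<integral>\<^sup>+x. ennreal (exp (- (real k * x))) \<partial>gamma_distr a 1) = ennreal ((1 / (1 + real k)) powr a)"
      using nn_integral_gamma_distr_tilt[of a 1 k UNIV] total_pos
        prob_space.emeasure_space_1[OF prob_space_gamma_distr[of a "1 + k"]] by simp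
    then show "(\<integral>\<^sup>+x. ennreal (exp (- (real k * x))) \<partial>distr (G 1) borel (\<lambda>y. \<Sum>\<^sub>\<infinity>i. y i))
        = (\<integral>\<^sup>+x. ennreal (exp (- (real k * x))) \<partial>gamma_distr a 1)"
      by (simp add: nn_integral_distr nn_integral_G_exp_sum)
  qed simp_all
qed

lemma distr_G_sum:
  assumes "0 < g"
  shows "distr (G g) borel (\<lambda>y. \<Sum>\<^sub>\<infinity>i. y i) = gamma_distr a g"
proof -
  have *: "(\<Sum>\<^sub>\<infinity>i. y i / g) = (\<Sum>\<^sub>\<infinity>i. y i) / g" for y :: "int \<Rightarrow> real"
    using infsum_cmult_left'[of y "1 / g" UNIV] by simp
  have "distr (G g) borel (\<lambda>y. \<Sum>\<^sub>\<infinity>i. y i) = distr (distr (G 1) seq_space (\<lambda>y i. y i / g)) borel (\<lambda>y. \<Sum>\<^sub>\<infinity>i. y i)"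
    using assms by (simp add: distr_G_scale)
  also have "\<dots> = distr (distr (G 1) borel (\<lambda>y. \<Sum>\<^sub>\<infinity>i. y i)) borel (\<lambda>x. x / g)"
    by (subst (1 2) distr_distr) (auto simp: comp_def * measurable_G_iff)
  also have "\<dots> = gamma_distr a g"
    using assms total_pos by (simp add: distr_G_sum_1 distr_gamma_distr_scale)
  finally show ?thesis .
qed

text \<open>The proportions do not change when all coordinates are divided by \<open>1 + k\<close>, and this division is
  what the tilt by \<open>exp (- k S)\<close> does to the law. So an event about the proportions keeps its
  probability under the tilt.\<close>
lemma emeasure_G_normalised_tilt:
  assumes k: "0 \<le> k" and [measurable]: "B \<in> sets seq_space"
  shows "(\<integral>\<^sup>+y. indicator B (\<lambda>i. y i / (\<Sum>\<^sub>\<infinity>k. y k)) * ennreal (exp (- (k * (\<Sum>\<^sub>\<infinity>i. y i)))) \<partial>G 1)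
    = emeasure (dirichlet \<alpha>) B * ennreal ((1 / (1 + k)) powr a)"
proof -
  define A where "A = {y. (\<lambda>i. y i / (\<Sum>\<^sub>\<infinity>k. y k)) \<in> B}"
  have A [measurable]: "A \<in> sets seq_space"
  proof -
    from measurable_sets[OF measurable_divide_infsum assms(2)] show ?thesis by (simp add: A_def vimage_def space_PiM)
  qed
  have scale: "(\<lambda>i. y i / (1 + k)) \<in> A \<longleftrightarrow> y \<in> A" for y :: "int \<Rightarrow> real"
  proof -
    have "(\<Sum>\<^sub>\<infinity>i. y i / (1 + k)) = (\<Sum>\<^sub>\<infinity>i. y i) / (1 + k)"
      using infsum_cmult_left'[of y "1 / (1 + k)" UNIV] by simp
    then show ?thesis using k by (simp add: A_def)
  qed
  have "emeasure (G (1 + k)) A = emeasure (distr (G 1) seq_space (\<lambda>y i. y i / (1 + k))) A"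
    using distr_G_scale[of "1 + k" 1] k by simp
  also have "\<dots> = emeasure (G 1) A"
    by (subst emeasure_distr) (auto simp: scale space_PiM vimage_def)
  also have "\<dots> = emeasure (dirichlet \<alpha>) B"
    unfolding dirichlet_eq_distr_G by (subst emeasure_distr) (auto simp: A_def space_PiM vimage_def)
  finally have "emeasure (G (1 + k)) A = emeasure (dirichlet \<alpha>) B" .
  then show ?thesis
    using nn_integral_G_tilt[OF k A] by (simp add: A_def indicator_def mult.commute)
qed

lemma sets_dirichlet [simp, measurable_cong]: "sets (dirichlet \<alpha>) = sets seq_space"
  by (simp add: dirichlet_def)

lemma prob_space_dirichlet: "prob_space (dirichlet \<alpha>)"
  unfolding dirichlet_eq_distr_G
  by (intro prob_space.prob_space_distr prob_space_G) (auto simp: measurable_G_iff)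

text \<open>The total and the proportions are independent. For a fixed event \<open>B\<close> the measure of
  \<open>{S \<in> A, Y / S \<in> B}\<close> as a function of \<open>A\<close> and the product of the two probabilities have the
  same exponential moments, by the previous lemma; no change of variables is involved, so the
  argument covers infinitely many coordinates.\<close>
lemma distr_G_sum_normalised:
  "distr (G 1) (borel \<Otimes>\<^sub>M seq_space) (\<lambda>y. (\<Sum>\<^sub>\<infinity>i. y i, \<lambda>i. y i / (\<Sum>\<^sub>\<infinity>k. y k)))
    = gamma_distr a 1 \<Otimes>\<^sub>M dirichlet \<alpha>" (is "?J = _")
proof (rule pair_measure_eqI[symmetric])
  interpret G1: prob_space "G 1" by (rule prob_space_G) simp
  interpret D: prob_space "dirichlet \<alpha>" by (rule prob_space_dirichlet)
  interpret GD: prob_space "gamma_distr a 1" by (rule prob_space_gamma_distr) (use total_pos in auto)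
  show "sigma_finite_measure (gamma_distr a 1)" "sigma_finite_measure (dirichlet \<alpha>)" by unfold_locales
  show "sets (gamma_distr a 1 \<Otimes>\<^sub>M dirichlet \<alpha>) = sets ?J"
    by (simp cong: sets_pair_measure_cong)
  fix A B assume "A \<in> sets (gamma_distr a 1)" "B \<in> sets (dirichlet \<alpha>)"
  then have A [measurable]: "A \<in> sets borel" and B [measurable]: "B \<in> sets seq_space" by auto
  define S where "S y = (\<Sum>\<^sub>\<infinity>i. y i)" for y :: "int \<Rightarrow> real"
  define U where "U y = (\<lambda>i. y i / S y)" for y :: "int \<Rightarrow> real"
  have [measurable]: "S \<in> borel_measurable seq_space" unfolding S_def by measurable
  have [measurable]: "U \<in> seq_space \<rightarrow>\<^sub>M seq_space"
    unfolding U_def S_def by (rule measurable_divide_infsum)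
  define c where "c = emeasure (dirichlet \<alpha>) B"
  have c: "c \<le> 1" unfolding c_def by (rule D.emeasure_le_1)
  \<comment> \<open>the law of the total on the event that the proportions lie in \<open>B\<close>\<close>
  define M1 where "M1 = distr (density (G 1) (\<lambda>y. indicator B (U y))) borel S"
  have emM1: "emeasure M1 X = emeasure ?J (X \<times> B)" if [measurable]: "X \<in> sets borel" for X
  proof -
    have [measurable]: "S -` X \<in> sets seq_space"
      using measurable_sets[of S seq_space borel X] by (simp add: space_PiM)
    have [measurable]: "(\<lambda>y. (S y, U y)) -` (X \<times> B) \<inter> space (G 1) \<in> sets seq_space"
      using measurable_sets[of "\<lambda>y. (S y, U y)" seq_space "borel \<Otimes>\<^sub>M seq_space" "X \<times> B"]
      by (simp add: space_PiM)
    have "emeasure M1 X = emeasure (density (G 1) (\<lambda>y. indicator B (U y))) (S -` X \<inter> space (G 1))"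
      unfolding M1_def by (subst emeasure_distr) (auto simp: space_PiM)
    also have "\<dots> = (\<integral>\<^sup>+y. indicator B (U y) * indicator (S -` X \<inter> space (G 1)) y \<partial>G 1)"
      by (subst emeasure_density) (auto simp: space_PiM)
    also have "\<dots> = (\<integral>\<^sup>+y. indicator (((\<lambda>y. (S y, U y)) -` (X \<times> B)) \<inter> space (G 1)) y \<partial>G 1)"
      by (intro nn_integral_cong) (auto simp: indicator_def)
    also have "\<dots> = emeasure (G 1) (((\<lambda>y. (S y, U y)) -` (X \<times> B)) \<inter> space (G 1))"
      by (subst nn_integral_indicator) auto
    also have "\<dots> = emeasure ?J (X \<times> B)"
      unfolding S_def[symmetric] U_def[symmetric] by (subst emeasure_distr) auto
    finally show ?thesis .
  qed
  have "M1 = scale_measure c (gamma_distr a 1)"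
  proof (rule measure_eqI_exp_moments)
    show "sets M1 = sets borel" by (simp add: M1_def)
    show "finite_measure M1"
    proof (rule finite_measureI)
      have "emeasure M1 UNIV = emeasure ?J (UNIV \<times> B)" by (rule emM1) simp
      also have "\<dots> \<le> emeasure ?J (space ?J)" by (rule emeasure_space)
      also have "\<dots> < \<infinity>"
        by (subst emeasure_distr) (auto simp: G1.emeasure_eq_measure measurable_G_iff)
      finally show "emeasure M1 (space M1) \<noteq> \<infinity>" by (simp add: M1_def)
    qed
    show "finite_measure (scale_measure c (gamma_distr a 1))"
    proof (rule finite_measureI)
      show "emeasure (scale_measure c (gamma_distr a 1)) (space (scale_measure c (gamma_distr a 1))) \<noteq> \<infinity>"
        using c GD.emeasure_space_1 by (auto simp: space_scale_measure top_unique)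
    qed
    have "AE y in density (G 1) (\<lambda>y. indicator B (U y)). 0 \<le> S y"
      using AE_G_sum_nonneg[of 1] by (subst AE_density) (auto simp: S_def elim!: eventually_mono)
    then show "AE x in M1. 0 \<le> x"
      unfolding M1_def by (subst AE_distr_iff) auto
    have "AE x in gamma_distr a 1. 0 \<le> x" using AE_gamma_distr_pos[of a 1] by eventually_elim simp
    then obtain Z where "Z \<in> null_sets (gamma_distr a 1)" "{x. \<not> 0 \<le> x} \<subseteq> Z"
      by (auto simp: eventually_ae_filter)
    then show "AE x in scale_measure c (gamma_distr a 1). 0 \<le> x"
      by (intro AE_I'[of Z]) (auto simp: null_sets_def space_scale_measure)
    fix k :: nat
    have "(\<integral>\<^sup>+x. ennreal (exp (- (real k * x))) \<partial>M1)
        = (\<integral>\<^sup>+y. indicator B (U y) * ennreal (exp (- (real k * S y))) \<partial>G 1)"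
      unfolding M1_def by (subst nn_integral_distr, simp, simp, subst nn_integral_density) auto
    also have "\<dots> = c * ennreal ((1 / (1 + real k)) powr a)"
      using emeasure_G_normalised_tilt[of "real k" B] by (simp add: S_def U_def c_def)
    also have "\<dots> = (\<integral>\<^sup>+x. ennreal (exp (- (real k * x))) \<partial>scale_measure c (gamma_distr a 1))"
      using nn_integral_gamma_distr_tilt[of a 1 k UNIV] total_pos
        prob_space.emeasure_space_1[OF prob_space_gamma_distr[of a "1 + k"]]
      by (subst nn_integral_scale_measure) auto
    finally show "(\<integral>\<^sup>+x. ennreal (exp (- (real k * x))) \<partial>M1)
        = (\<integral>\<^sup>+x. ennreal (exp (- (real k * x))) \<partial>scale_measure c (gamma_distr a 1))" .
  qed simp
  then have "emeasure ?J (A \<times> B) = emeasure (scale_measure c (gamma_distr a 1)) A"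
    using emM1[OF A] by simp
  then show "emeasure (gamma_distr a 1) A * emeasure (dirichlet \<alpha>) B = emeasure ?J (A \<times> B)"
    by (simp add: c_def mult.commute)
qed

text \<open>In \<open>Y = S * (Y / S)\<close> the total may be replaced by an independent variable with the same law.\<close>
lemma distr_gamma_times_dirichlet_1:
  "distr (gamma_distr a 1 \<Otimes>\<^sub>M dirichlet \<alpha>) seq_space (\<lambda>(t, q) j. t * q j) = G 1"
proof -
  have "distr (gamma_distr a 1 \<Otimes>\<^sub>M dirichlet \<alpha>) seq_space (\<lambda>(t, q) j. t * q j)
    = distr (G 1) seq_space (\<lambda>y j. (\<Sum>\<^sub>\<infinity>i. y i) * (y j / (\<Sum>\<^sub>\<infinity>i. y i)))"
    unfolding distr_G_sum_normalised[symmetric]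
    by (subst distr_distr) (auto simp: comp_def measurable_G_iff)
  also have "\<dots> = distr (G 1) seq_space (\<lambda>y. y)"
  proof (rule distr_cong_AE)
    have "AE x in distr (G 1) borel (\<lambda>y. \<Sum>\<^sub>\<infinity>i. y i). 0 < x"
      unfolding distr_G_sum_1 by (rule AE_gamma_distr_pos)
    then have "AE y in G 1. 0 < (\<Sum>\<^sub>\<infinity>i. y i)" by (subst (asm) AE_distr_iff) auto
    then show "AE y in G 1. (\<lambda>j. (\<Sum>\<^sub>\<infinity>i. y i) * (y j / (\<Sum>\<^sub>\<infinity>i. y i))) = y"
      by eventually_elim auto
  qed (auto simp: measurable_G_iff intro!: measurable_into_PiM)
  also have "\<dots> = G 1" by (rule distr_id2) simp
  finally show ?thesis .
qed

lemma distr_gamma_times_dirichlet: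
  assumes g: "0 < g"
  shows "distr (gamma_distr a g \<Otimes>\<^sub>M dirichlet \<alpha>) seq_space (\<lambda>(t, q) j. t * q j) = G g"
proof -
  interpret D: prob_space "dirichlet \<alpha>" by (rule prob_space_dirichlet)
  have "gamma_distr a g \<Otimes>\<^sub>M dirichlet \<alpha>
      = distr (gamma_distr a 1) borel (\<lambda>x. x / g) \<Otimes>\<^sub>M distr (dirichlet \<alpha>) seq_space (\<lambda>q. q)"
    using g total_pos by (simp add: distr_gamma_distr_scale distr_id2)
  also have "\<dots> = distr (gamma_distr a 1 \<Otimes>\<^sub>M dirichlet \<alpha>) (borel \<Otimes>\<^sub>M seq_space) (\<lambda>(x, q). (x / g, q))"
    by (rule pair_measure_distr) (auto simp: distr_id2 D.sigma_finite_measure_axioms)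
  finally have "distr (gamma_distr a g \<Otimes>\<^sub>M dirichlet \<alpha>) seq_space (\<lambda>(t, q) j. t * q j)
      = distr (gamma_distr a 1 \<Otimes>\<^sub>M dirichlet \<alpha>) seq_space (\<lambda>(t, q) j. t / g * q j)"
    by (simp add: distr_distr comp_def case_prod_beta' del: distr_id2)
  also have "\<dots> = distr (distr (gamma_distr a 1 \<Otimes>\<^sub>M dirichlet \<alpha>) seq_space (\<lambda>(t, q) j. t * q j)) seq_space (\<lambda>y i. y i / g)"
    by (subst distr_distr) (auto simp: comp_def case_prod_beta')
  also have "\<dots> = G g" using g by (simp add: distr_gamma_times_dirichlet_1 distr_G_scale)
  finally show ?thesis .
qed

lemma AE_dirichlet_nonneg: "AE q in dirichlet \<alpha>. \<forall>j. 0 \<le> q j"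
  unfolding dirichlet_eq_distr_G
proof (subst AE_distr_iff)
  show "AE y in G 1. \<forall>j. 0 \<le> y j / (\<Sum>\<^sub>\<infinity>k. y k)"
    using AE_G_nonneg[of 1] by (auto elim!: eventually_mono intro!: divide_nonneg_nonneg infsum_nonneg)
qed (auto simp: measurable_G_iff)

text \<open>If \<open>h\<close> is homogeneous with multiplier \<open>m\<close>, then \<open>h\<close> of the product of an independent Gamma variable
  and a Dirichlet vector factorises, while this product is a vector of independent Gamma variables. So
  the moments of the Dirichlet law are quotients of Gamma moments.\<close>
lemma nn_integral_dirichlet_product:
  fixes h :: "(int \<Rightarrow> real) \<Rightarrow> ennreal" and m :: "real \<Rightarrow> ennreal"
  assumes [measurable]: "h \<in> borel_measurable seq_space" "m \<in> borel_measurable borel"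
    and hom: "\<And>t q. 0 \<le> t \<Longrightarrow> (\<And>j. 0 \<le> q j) \<Longrightarrow> h (\<lambda>j. t * q j) = m t * h q"
  shows "(\<integral>\<^sup>+t. m t \<partial>gamma_distr a 1) * (\<integral>\<^sup>+q. h q \<partial>dirichlet \<alpha>) = (\<integral>\<^sup>+y. h y \<partial>G 1)"
proof -
  interpret D: prob_space "dirichlet \<alpha>" by (rule prob_space_dirichlet)
  have "(\<integral>\<^sup>+y. h y \<partial>G 1) = (\<integral>\<^sup>+x. h (\<lambda>j. fst x * snd x j) \<partial>(gamma_distr a 1 \<Otimes>\<^sub>M dirichlet \<alpha>))"
    unfolding distr_gamma_times_dirichlet_1[symmetric]
    by (subst nn_integral_distr) (auto simp: case_prod_beta')
  also have "\<dots> = (\<integral>\<^sup>+t. (\<integral>\<^sup>+q. h (\<lambda>j. t * q j) \<partial>dirichlet \<alpha>) \<partial>gamma_distr a 1)"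
    by (subst D.nn_integral_fst[symmetric]) auto
  also have "\<dots> = (\<integral>\<^sup>+t. m t * (\<integral>\<^sup>+q. h q \<partial>dirichlet \<alpha>) \<partial>gamma_distr a 1)"
  proof (rule nn_integral_cong_AE)
    show "AE t in gamma_distr a 1. (\<integral>\<^sup>+q. h (\<lambda>j. t * q j) \<partial>dirichlet \<alpha>) = m t * (\<integral>\<^sup>+q. h q \<partial>dirichlet \<alpha>)"
      using AE_gamma_distr_pos[of a 1]
    proof eventually_elim
      case (elim t)
      have "(\<integral>\<^sup>+q. h (\<lambda>j. t * q j) \<partial>dirichlet \<alpha>) = (\<integral>\<^sup>+q. m t * h q \<partial>dirichlet \<alpha>)"
        using AE_dirichlet_nonneg elim by (intro nn_integral_cong_AE) (auto elim!: eventually_mono simp: hom)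
      then show ?case by (simp add: nn_integral_cmult)
    qed
  qed
  also have "\<dots> = (\<integral>\<^sup>+t. m t \<partial>gamma_distr a 1) * (\<integral>\<^sup>+q. h q \<partial>dirichlet \<alpha>)"
    by (subst nn_integral_multc) auto
  finally show ?thesis ..
qed

lemma ennreal_divide_eqI: "0 < c \<Longrightarrow> 0 \<le> b \<Longrightarrow> ennreal c * x = ennreal b \<Longrightarrow> x = ennreal (b / c)"
  for b c :: real
  by (metis ennreal_divide_eq_top_iff divide_ennreal ennreal_eq_0_iff ennreal_neq_top
      mult_divide_eq_ennreal mult.commute not_le)

lemma nn_integral_G_component: "(\<integral>\<^sup>+y. ennreal (y i) \<partial>G 1) = ennreal (\<alpha> i)"
  using nn_integral_PiM_prod[of "\<lambda>i. gamma0 (\<alpha> i) 1" "{i}" "\<lambda>i. ennreal"]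
  by (simp add: prob_space_gamma0 shape_nonneg nn_integral_gamma0_ident)

lemma nn_integral_G_component2:
  "(\<integral>\<^sup>+y. ennreal (y i) * ennreal (y j) \<partial>G 1) = ennreal (\<alpha> i * \<alpha> j + (if i = j then \<alpha> i else 0))"
proof (cases "i = j")
  case True
  then show ?thesis
    using nn_integral_PiM_prod[of "\<lambda>i. gamma0 (\<alpha> i) 1" "{i}" "\<lambda>i x. ennreal x * ennreal x"]
    by (simp add: prob_space_gamma0 shape_nonneg nn_integral_gamma0_square algebra_simps)
next
  case False
  then show ?thesis
    using nn_integral_PiM_prod[of "\<lambda>i. gamma0 (\<alpha> i) 1" "{i, j}" "\<lambda>i. ennreal"]
    by (simp add: prob_space_gamma0 shape_nonneg nn_integral_gamma0_ident ennreal_mult)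
qed

lemma nn_integral_dirichlet_component: "(\<integral>\<^sup>+q. ennreal (q i) \<partial>dirichlet \<alpha>) = ennreal (\<alpha> i / a)"
proof (rule ennreal_divide_eqI)
  show "ennreal a * (\<integral>\<^sup>+q. ennreal (q i) \<partial>dirichlet \<alpha>) = ennreal (\<alpha> i)"
    using nn_integral_dirichlet_product[of "\<lambda>q. ennreal (q i)" ennreal] total_pos
      nn_integral_gamma0_ident[of a 1, unfolded gamma0_def]
    by (simp add: nn_integral_G_component ennreal_mult)
qed (use total_pos shape_nonneg in auto)

lemma nn_integral_dirichlet_component2:
  "(\<integral>\<^sup>+q. ennreal (q i) * ennreal (q j) \<partial>dirichlet \<alpha>)
    = ennreal ((\<alpha> i * \<alpha> j + (if i = j then \<alpha> i else 0)) / (a * (a + 1)))"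
proof (rule ennreal_divide_eqI)
  show "ennreal (a * (a + 1)) * (\<integral>\<^sup>+q. ennreal (q i) * ennreal (q j) \<partial>dirichlet \<alpha>)
      = ennreal (\<alpha> i * \<alpha> j + (if i = j then \<alpha> i else 0))"
    using nn_integral_dirichlet_product[of "\<lambda>q. ennreal (q i) * ennreal (q j)" "\<lambda>t. ennreal t * ennreal t"]
      nn_integral_gamma0_square[of a 1, unfolded gamma0_def] total_pos
    by (simp add: nn_integral_G_component2 ennreal_mult mult_ac)
qed (use total_pos shape_nonneg in auto)

end

section \<open>Invariance of the Gamma law\<close>

text \<open>Two independent families of independent variables, combined index by index, form an independent
  family. On a cylinder the second family is integrated out while the first is held fixed.\<close>
lemma distr_pair_PiM_coordinatewise:
  assumes M: "\<And>i. prob_space (M i)" and N: "\<And>i. prob_space (N i)"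
    and f: "\<And>i. (\<lambda>z. f i (fst z) (snd z)) \<in> M i \<Otimes>\<^sub>M N i \<rightarrow>\<^sub>M R i"
  shows "distr (Pi\<^sub>M UNIV M \<Otimes>\<^sub>M Pi\<^sub>M UNIV N) (Pi\<^sub>M UNIV R) (\<lambda>z i. f i (fst z i) (snd z i))
    = (\<Pi>\<^sub>M i\<in>UNIV. distr (M i \<Otimes>\<^sub>M N i) (R i) (\<lambda>z. f i (fst z) (snd z)))" (is "?D = Pi\<^sub>M UNIV ?R")
proof -
  interpret PM: prob_space "Pi\<^sub>M UNIV M" by (intro prob_space_PiM M)
  interpret PN: prob_space "Pi\<^sub>M UNIV N" by (intro prob_space_PiM N)
  interpret N: prob_space "N i" for i by (rule N)
  interpret M: prob_space "M i" for i by (rule M)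
  interpret pr: pair_prob_space "M i" "N i" for i ..
  interpret PR: product_prob_space ?R UNIV
    using f by (intro product_prob_spaceI pr.prob_space_distr)
  define g where "g = (\<lambda>z i. f i (fst z i) (snd z i))"
  have f' [measurable]: "(\<lambda>w. f i (fst w i) (snd w i)) \<in> Pi\<^sub>M UNIV M \<Otimes>\<^sub>M Pi\<^sub>M UNIV N \<rightarrow>\<^sub>M R i" for i
    using measurable_compose[OF _ f[of i], of "\<lambda>w. (fst w i, snd w i)" "Pi\<^sub>M UNIV M \<Otimes>\<^sub>M Pi\<^sub>M UNIV N"]
    by simp
  have g [measurable]: "g \<in> Pi\<^sub>M UNIV M \<Otimes>\<^sub>M Pi\<^sub>M UNIV N \<rightarrow>\<^sub>M Pi\<^sub>M UNIV R"
    unfolding g_def by (rule measurable_into_PiM) (rule f')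
  have "distr (Pi\<^sub>M UNIV M \<Otimes>\<^sub>M Pi\<^sub>M UNIV N) (Pi\<^sub>M UNIV R) g = Pi\<^sub>M UNIV ?R"
  proof (rule PR.PiM_eq)
    show "sets (distr (Pi\<^sub>M UNIV M \<Otimes>\<^sub>M Pi\<^sub>M UNIV N) (Pi\<^sub>M UNIV R) g) = sets (Pi\<^sub>M UNIV ?R)"
      by (simp cong: sets_PiM_cong)
    fix J F assume J: "finite J" "J \<subseteq> UNIV" and "\<And>j. j \<in> J \<Longrightarrow> F j \<in> sets (?R j)"
    then have F: "\<And>j. j \<in> J \<Longrightarrow> F j \<in> sets (R j)" by simp
    define E where "E j = (if j \<in> J then F j else space (R j))" for j
    have E [measurable]: "E j \<in> sets (R j)" for j using F by (simp add: E_def)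
    define B where "B = prod_emb UNIV ?R J (Pi\<^sub>E J F)"
    have B [measurable]: "B \<in> sets (Pi\<^sub>M UNIV R)"
      using sets_PiM_I[OF J, of F R] F by (simp add: B_def prod_emb_def space_PiM)
    have ind: "indicator B (g z) = (\<Prod>j\<in>J. indicator (E j) (f j (fst z j) (snd z j)) :: ennreal)"
      if z: "z \<in> space (Pi\<^sub>M UNIV M \<Otimes>\<^sub>M Pi\<^sub>M UNIV N)" for z
    proof -
      have "g z \<in> space (Pi\<^sub>M UNIV R)" using measurable_space[OF g z] .
      then have "g z \<in> B \<longleftrightarrow> (\<forall>j\<in>J. g z j \<in> E j)"
        by (auto simp: B_def prod_emb_def PiE_iff space_PiM E_def)
      then show ?thesis using J(1) by (auto simp: g_def indicator_def intro!: prod.neutral[symmetric] prod_zero)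
    qed
    have meas1: "(\<lambda>z. indicator (E j) (f j (fst z) (snd z)) :: ennreal) \<in> borel_measurable (M j \<Otimes>\<^sub>M N j)" for j
      using measurable_compose[OF f[of j], of "indicator (E j)" borel] E by simp
    have "emeasure (distr (Pi\<^sub>M UNIV M \<Otimes>\<^sub>M Pi\<^sub>M UNIV N) (Pi\<^sub>M UNIV R) g) B
        = (\<integral>\<^sup>+z. indicator B (g z) \<partial>(Pi\<^sub>M UNIV M \<Otimes>\<^sub>M Pi\<^sub>M UNIV N))"
      by (subst nn_integral_distr[symmetric, of g _ "Pi\<^sub>M UNIV R"]) auto
    also have "\<dots> = (\<integral>\<^sup>+z. (\<Prod>j\<in>J. indicator (E j) (f j (fst z j) (snd z j))) \<partial>(Pi\<^sub>M UNIV M \<Otimes>\<^sub>M Pi\<^sub>M UNIV N))"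
      by (intro nn_integral_cong ind)
    also have "\<dots> = (\<integral>\<^sup>+x. (\<integral>\<^sup>+y. (\<Prod>j\<in>J. indicator (E j) (f j (x j) (y j))) \<partial>Pi\<^sub>M UNIV N) \<partial>Pi\<^sub>M UNIV M)"
      by (subst PN.nn_integral_fst[symmetric]) auto
    also have "\<dots> = (\<integral>\<^sup>+x. (\<Prod>j\<in>J. \<integral>\<^sup>+y. indicator (E j) (f j (x j) y) \<partial>N j) \<partial>Pi\<^sub>M UNIV M)"
    proof (intro nn_integral_cong)
      fix x assume "x \<in> space (Pi\<^sub>M UNIV M)"
      then have "x j \<in> space (M j)" for j by (auto simp: space_PiM)
      then have "(\<lambda>y. indicator (E j) (f j (x j) y) :: ennreal) \<in> borel_measurable (N j)" for j
        using measurable_compose[OF measurable_Pair1' meas1[of j], of "x j"] by simp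
      then show "(\<integral>\<^sup>+y. (\<Prod>j\<in>J. indicator (E j) (f j (x j) (y j))) \<partial>Pi\<^sub>M UNIV N)
          = (\<Prod>j\<in>J. \<integral>\<^sup>+y. indicator (E j) (f j (x j) y) \<partial>N j)"
        by (intro nn_integral_PiM_prod N J(1))
    qed
    also have "\<dots> = (\<Prod>j\<in>J. \<integral>\<^sup>+x. (\<integral>\<^sup>+y. indicator (E j) (f j x y) \<partial>N j) \<partial>M j)"
      using N.borel_measurable_nn_integral_fst[OF meas1]
      by (intro nn_integral_PiM_prod M J(1)) simp
    also have "\<dots> = (\<Prod>j\<in>J. emeasure (?R j) (F j))"
    proof (intro prod.cong refl)
      fix j assume j: "j \<in> J"
      have "(\<integral>\<^sup>+x. (\<integral>\<^sup>+y. indicator (E j) (f j x y) \<partial>N j) \<partial>M j)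
          = (\<integral>\<^sup>+z. indicator (E j) (f j (fst z) (snd z)) \<partial>(M j \<Otimes>\<^sub>M N j))"
        using N.nn_integral_fst[OF meas1[of j]] by simp
      also have "\<dots> = (\<integral>\<^sup>+w. indicator (E j) w \<partial>?R j)"
        by (subst nn_integral_distr) (use f in auto)
      finally show "(\<integral>\<^sup>+x. (\<integral>\<^sup>+y. indicator (E j) (f j x y) \<partial>N j) \<partial>M j) = emeasure (?R j) (F j)"
        using j F[OF j] by (simp add: E_def)
    qed
    finally show "emeasure (distr (Pi\<^sub>M UNIV M \<Otimes>\<^sub>M Pi\<^sub>M UNIV N) (Pi\<^sub>M UNIV R) g) (prod_emb UNIV ?R J (Pi\<^sub>E J F))
        = (\<Prod>j\<in>J. emeasure (?R j) (F j))" by (simp add: B_def)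
  qed
  then show ?thesis by (simp add: g_def)
qed

text \<open>The law of one random matrix. A row \<open>r i\<close> is listed relative to the diagonal, so that the entry
  in column \<open>j\<close> is its component \<open>j - i\<close>.\<close>
definition matrix_law :: "(int \<Rightarrow> real) \<Rightarrow> (int \<Rightarrow> int \<Rightarrow> real) measure" where
  "matrix_law \<alpha> = distr (Pi\<^sub>M UNIV (\<lambda>_::int. dirichlet \<alpha>)) matrix_space (\<lambda>r i j. r i (j - i))"

lemma measurable_entry:
  assumes "f \<in> M \<rightarrow>\<^sub>M matrix_space"
  shows "(\<lambda>x. f x i j) \<in> borel_measurable M"
proof -
  have "(\<lambda>x. f x i) \<in> M \<rightarrow>\<^sub>M seq_space"
    by (rule measurable_compose[OF assms measurable_component_singleton]) simp
  then show ?thesis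
    by (rule measurable_compose[OF _ measurable_component_singleton]) simp
qed

lemma measurable_entry_at [measurable]: "(\<lambda>P. P i j) \<in> borel_measurable matrix_space"
  by (rule measurable_entry) simp

lemma measurable_entry_snd [measurable]: "(\<lambda>z. snd z i j) \<in> borel_measurable (M \<Otimes>\<^sub>M matrix_space)"
  by (rule measurable_entry) simp

lemma measurable_row_mult' [measurable]:
  "(\<lambda>z. row_mult (fst z) (snd z)) \<in> seq_space \<Otimes>\<^sub>M matrix_space \<rightarrow>\<^sub>M seq_space"
  unfolding row_mult_def by (rule measurable_into_PiM) measurable

lemma measurable_row_mult [measurable (raw)]:
  assumes "f \<in> M \<rightarrow>\<^sub>M seq_space" and "g \<in> M \<rightarrow>\<^sub>M matrix_space"
  shows "(\<lambda>x. row_mult (f x) (g x)) \<in> M \<rightarrow>\<^sub>M seq_space"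
  using measurable_compose[OF measurable_Pair[OF assms] measurable_row_mult'] by simp

lemma measurable_shift_rows [measurable]:
  "(\<lambda>r i j. r i (j - i)) \<in> matrix_space \<rightarrow>\<^sub>M matrix_space"
  by (intro measurable_into_PiM) measurable

context summable_shapes
begin

lemma sets_PiM_dirichlet [simp, measurable_cong]: "sets (Pi\<^sub>M UNIV (\<lambda>_. dirichlet \<alpha>)) = sets matrix_space"
  by (intro sets_PiM_cong) auto

lemma sets_matrix_law [simp, measurable_cong]: "sets (matrix_law \<alpha>) = sets matrix_space"
  by (simp add: matrix_law_def)

lemma prob_space_matrix_law: "prob_space (matrix_law \<alpha>)"
  unfolding matrix_law_def
  by (intro prob_space.prob_space_distr prob_space_PiM prob_space_dirichlet) measurable

text \<open>The shapes that meet in column \<open>j\<close>.\<close>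
lemma reflected_shapes: "summable_shapes (\<lambda>i. \<alpha> (j - i)) a"
proof
  have "bij_betw (\<lambda>i. j - i) UNIV (UNIV :: int set)"
    by (rule bij_betwI[where g="\<lambda>i. j - i"]) auto
  from has_sum_reindex_bij_betw[OF this, of \<alpha> a] show "((\<lambda>i. \<alpha> (j - i)) has_sum a) UNIV"
    using shape_sum by simp
qed (use shape_nonneg total_pos in auto)

text \<open>Multiplying the Gamma entries with the Dirichlet rows produces an array of independent Gamma
  variables, the one in row \<open>i\<close> and column \<open>j\<close> having shape \<open>\<alpha> (j - i)\<close>. The new sequence consists
  of the column totals; the columns are disjoint blocks, and the shapes in each of them add up to
  \<open>a\<close> again.\<close>
lemma row_mult_gamma_invariant:
  assumes g: "0 < g"
  shows "distr (Pi\<^sub>M UNIV (\<lambda>_. gamma_distr a g) \<Otimes>\<^sub>M matrix_law \<alpha>) seq_space (\<lambda>z. row_mult (fst z) (snd z))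
    = Pi\<^sub>M UNIV (\<lambda>_. gamma_distr a g)"
proof -
  define T where "T = Pi\<^sub>M UNIV (\<lambda>_::int. gamma_distr a g)"
  define R where "R = Pi\<^sub>M UNIV (\<lambda>_::int. dirichlet \<alpha>)"
  have sT [measurable_cong]: "sets T = sets seq_space" unfolding T_def by (intro sets_PiM_cong) auto
  have sR [measurable_cong]: "sets R = sets matrix_space" unfolding R_def by simp
  interpret T: prob_space T unfolding T_def using total_pos g by (intro prob_space_PiM prob_space_gamma_distr)
  interpret R: prob_space R unfolding R_def by (intro prob_space_PiM prob_space_dirichlet)
  interpret K: prob_space "matrix_law \<alpha>" by (rule prob_space_matrix_law)
  interpret gk: prob_space "gamma0 (\<alpha> k) g" for k using shape_nonneg g by (intro prob_space_gamma0)
  let ?N = "\<lambda>z :: int \<times> int. gamma0 (\<alpha> (snd z)) g"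
  have rows: "distr (T \<Otimes>\<^sub>M R) matrix_space (\<lambda>z i k. fst z i * snd z i k) = (\<Pi>\<^sub>M i\<in>UNIV. G g)"
    unfolding T_def R_def
    using distr_pair_PiM_coordinatewise[of "\<lambda>_. gamma_distr a g" "\<lambda>_. dirichlet \<alpha>" "\<lambda>_ t q k. t * q k" "\<lambda>_. seq_space"]
      distr_gamma_times_dirichlet[OF g] total_pos g
    by (simp add: prob_space_gamma_distr prob_space_dirichlet case_prod_beta')
  have "distr (T \<Otimes>\<^sub>M matrix_law \<alpha>) seq_space (\<lambda>z. row_mult (fst z) (snd z))
      = distr (T \<Otimes>\<^sub>M R) seq_space (\<lambda>z. row_mult (fst z) (\<lambda>i j. snd z i (j - i)))"
  proof -
    have "T \<Otimes>\<^sub>M matrix_law \<alpha> = distr T T (\<lambda>x. x) \<Otimes>\<^sub>M distr R matrix_space (\<lambda>r i j. r i (j - i))"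
      by (simp add: matrix_law_def R_def distr_id)
    also have "\<dots> = distr (T \<Otimes>\<^sub>M R) (T \<Otimes>\<^sub>M matrix_space) (\<lambda>(x, r). (x, \<lambda>i j. r i (j - i)))"
      using K.sigma_finite_measure_axioms
      by (intro pair_measure_distr) (auto simp: matrix_law_def R_def)
    finally show ?thesis
      by (simp only:) (subst distr_distr, auto simp: comp_def case_prod_beta')
  qed
  also have "\<dots> = distr (distr (T \<Otimes>\<^sub>M R) matrix_space (\<lambda>z i k. fst z i * snd z i k)) seq_space (\<lambda>v j. \<Sum>\<^sub>\<infinity>i. v i (j - i))"
    by (subst distr_distr) (auto simp: comp_def row_mult_def[abs_def] intro!: measurable_into_PiM)
  also have "\<dots> = distr (distr (Pi\<^sub>M UNIV ?N) (\<Pi>\<^sub>M i\<in>UNIV. G g) (\<lambda>z i k. z (i, k))) seq_space (\<lambda>v j. \<Sum>\<^sub>\<infinity>i. v i (j - i))"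
    unfolding rows using distr_PiM_group[of ?N "\<lambda>i k. (i, k)"] gk.prob_space_axioms by simp
  also have "\<dots> = distr (distr (Pi\<^sub>M UNIV ?N) (\<Pi>\<^sub>M j\<in>UNIV. \<Pi>\<^sub>M i\<in>UNIV. gamma0 (\<alpha> (j - i)) g) (\<lambda>z j i. z (i, j - i)))
      seq_space (\<lambda>v j. \<Sum>\<^sub>\<infinity>i. v j i)"
    by (subst (1 2) distr_distr) (auto simp: comp_def intro!: measurable_into_PiM)
  also have "\<dots> = distr (\<Pi>\<^sub>M j\<in>UNIV. \<Pi>\<^sub>M i\<in>UNIV. gamma0 (\<alpha> (j - i)) g) seq_space (\<lambda>v j. \<Sum>\<^sub>\<infinity>i. v j i)"
    using distr_PiM_group[of ?N "\<lambda>j i. (i, j - i)"] gk.prob_space_axioms by simp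
  also have "\<dots> = (\<Pi>\<^sub>M j\<in>UNIV. distr (\<Pi>\<^sub>M i\<in>UNIV. gamma0 (\<alpha> (j - i)) g) borel (\<lambda>y. \<Sum>\<^sub>\<infinity>i. y i))"
  proof (rule distr_PiM_coordinatewise[where K="\<lambda>j. \<Pi>\<^sub>M i\<in>UNIV. gamma0 (\<alpha> (j - i)) g"
        and N="\<lambda>_. borel" and f="\<lambda>_ y. \<Sum>\<^sub>\<infinity>i. y i"])
    show "prob_space (\<Pi>\<^sub>M i\<in>UNIV. gamma0 (\<alpha> (j - i)) g)" for j
      by (rule prob_space_PiM) (rule gk.prob_space_axioms)
    show "(\<lambda>y. \<Sum>\<^sub>\<infinity>i. y i) \<in> borel_measurable (\<Pi>\<^sub>M i\<in>UNIV. gamma0 (\<alpha> (j - i)) g)" for j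
      unfolding summable_shapes.measurable_G_iff[OF reflected_shapes] by measurable
  qed
  also have "\<dots> = T"
    unfolding T_def by (intro PiM_cong refl summable_shapes.distr_G_sum[OF reflected_shapes g])
  finally show ?thesis unfolding T_def .
qed

end

section \<open>Two random walkers in a common random environment\<close>

lemma measurable_pair_pmf_snd:
  fixes f :: "'b \<Rightarrow> 'a::countable \<Rightarrow> 'c"
  assumes "\<And>i. (\<lambda>x. f x i) \<in> M \<rightarrow>\<^sub>M N"
  shows "(\<lambda>(x, i). f x i) \<in> M \<Otimes>\<^sub>M measure_pmf q \<rightarrow>\<^sub>M N"
proof -
  have "sets (M \<Otimes>\<^sub>M measure_pmf q) = sets (M \<Otimes>\<^sub>M count_space (UNIV :: 'a set))"
    by (rule sets_pair_measure_cong) auto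
  then show ?thesis
    using measurable_pair_count_space_snd[OF assms]
    by (simp only: measurable_cong_sets[of "M \<Otimes>\<^sub>M measure_pmf q" "M \<Otimes>\<^sub>M count_space UNIV" N N])
qed

lemma integrable_pmf_bounded:
  fixes f :: "'a \<Rightarrow> real"
  assumes "\<And>x. \<bar>f x\<bar> \<le> B"
  shows "integrable (measure_pmf p) f"
  using assms by (intro measure_pmf.integrable_const_bound[where B=B]) auto

lemma integral_pmf_bounded:
  fixes f :: "'a \<Rightarrow> real"
  assumes "\<And>x. \<bar>f x\<bar> \<le> B"
  shows "\<bar>\<integral>x. f x \<partial>measure_pmf p\<bar> \<le> B"
proof -
  have "\<bar>\<integral>x. f x \<partial>measure_pmf p\<bar> \<le> (\<integral>x. \<bar>f x\<bar> \<partial>measure_pmf p)" by (rule integral_abs_bound)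
  also have "\<dots> \<le> (\<integral>x. B \<partial>measure_pmf p)"
  proof (rule integral_mono)
    show "integrable (measure_pmf p) (\<lambda>x. \<bar>f x\<bar>)" by (rule integrable_pmf_bounded[of _ B]) (use assms in simp)
  qed (use assms in auto)
  finally show ?thesis by simp
qed

lemma integral_pair_pmf_bounded:
  fixes f :: "'a \<times> 'b \<Rightarrow> real"
  assumes bd: "\<And>x. \<bar>f x\<bar> \<le> B"
  shows "(\<integral>x. f x \<partial>measure_pmf (pair_pmf p q)) = (\<integral>a. (\<integral>b. f (a, b) \<partial>measure_pmf q) \<partial>measure_pmf p)"
proof -
  have nonneg: "(\<integral>x. g x \<partial>measure_pmf (pair_pmf p q)) = (\<integral>a. (\<integral>b. g (a, b) \<partial>measure_pmf q) \<partial>measure_pmf p)"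
    if g: "\<And>x. 0 \<le> g x" "\<And>x. g x \<le> C" for g :: "'a \<times> 'b \<Rightarrow> real" and C
  proof -
    have gb: "\<bar>g x\<bar> \<le> C" for x using g by simp
    have inner: "(\<integral>\<^sup>+b. ennreal (g (a, b)) \<partial>measure_pmf q) = ennreal (\<integral>b. g (a, b) \<partial>measure_pmf q)" for a
      using g gb by (intro nn_integral_eq_integral integrable_pmf_bounded[of _ C]) auto
    have "ennreal (\<integral>x. g x \<partial>measure_pmf (pair_pmf p q)) = (\<integral>\<^sup>+x. ennreal (g x) \<partial>measure_pmf (pair_pmf p q))"
      using g gb by (intro nn_integral_eq_integral[symmetric] integrable_pmf_bounded[of _ C]) auto
    also have "\<dots> = (\<integral>\<^sup>+a. ennreal (\<integral>b. g (a, b) \<partial>measure_pmf q) \<partial>measure_pmf p)"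
      by (simp add: nn_integral_pair_pmf' inner)
    also have "\<dots> = ennreal (\<integral>a. (\<integral>b. g (a, b) \<partial>measure_pmf q) \<partial>measure_pmf p)"
      using g gb by (intro nn_integral_eq_integral integrable_pmf_bounded[of _ C] integral_pmf_bounded) auto
    finally show ?thesis by (subst (asm) ennreal_inj) (auto simp: g)
  qed
  have "(\<integral>x. f x + B \<partial>measure_pmf (pair_pmf p q)) = (\<integral>a. (\<integral>b. f (a, b) + B \<partial>measure_pmf q) \<partial>measure_pmf p)"
  proof (rule nonneg[where C="B + B"])
    show "0 \<le> f x + B" "f x + B \<le> B + B" for x using bd[of x] by (auto simp: abs_le_iff)
  qed
  moreover have "integrable (measure_pmf r) h" if "\<And>x. \<bar>h x\<bar> \<le> B" for r :: "'c pmf" and h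
    using integrable_pmf_bounded[OF that] .
  ultimately show ?thesis
    using bd integrable_pmf_bounded[of f B "pair_pmf p q"]
      integrable_pmf_bounded[of "\<lambda>b. f (_, b)" B q]
      integrable_pmf_bounded[of "\<lambda>a. \<integral>b. f (a, b) \<partial>measure_pmf q" B p]
      integral_pmf_bounded[of "\<lambda>b. f (_, b)" B q]
    by simp
qed

text \<open>Normalised Lebesgue measure on \<open>{-pi..pi}\<close>; integrals against it are Fourier coefficients.\<close>
definition circle :: "real measure" where
  "circle = density lborel (\<lambda>x. ennreal (indicator {-pi..pi} x / (2 * pi)))"

lemma sets_circle [simp, measurable_cong]: "sets circle = sets borel"
  by (simp add: circle_def)

lemma prob_space_circle: "prob_space circle"
proof
  have "emeasure circle (space circle) = (\<integral>\<^sup>+x. ennreal (1 / (2 * pi)) * indicator {-pi..pi} x \<partial>lborel)"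
    unfolding circle_def by (subst emeasure_density) (auto intro!: nn_integral_cong simp: indicator_def)
  also have "\<dots> = ennreal (1 / (2 * pi)) * ennreal (2 * pi)"
    by (subst nn_integral_cmult_indicator) auto
  also have "\<dots> = 1" by (simp add: ennreal_mult'[symmetric])
  finally show "emeasure circle (space circle) = 1" .
qed

interpretation circle: prob_space circle by (rule prob_space_circle)

lemma circle_integrable:
  fixes f :: "real \<Rightarrow> real"
  assumes f: "f \<in> borel_measurable borel" and B: "\<And>x. \<bar>f x\<bar> \<le> B"
  shows "integrable circle f"
proof (rule circle.integrable_const_bound)
  show "AE x in circle. norm (f x) \<le> B" using B by simp
  show "f \<in> borel_measurable circle" using f by (simp only: measurable_cong_sets[OF sets_circle refl])
qed

lemma integral_circle_cos:
  fixes d :: int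
  shows "(\<integral>x. cos (of_int d * x) \<partial>circle) = (if d = 0 then 1 else 0)"
proof (cases "d = 0")
  case True
  then show ?thesis using circle.prob_space by simp
next
  case False
  have "(\<integral>x. cos (of_int d * x) \<partial>circle)
      = (\<integral>x. (indicator {-pi..pi} x / (2 * pi)) *\<^sub>R cos (of_int d * x) \<partial>lborel)"
    unfolding circle_def by (subst integral_density) auto
  also have "\<dots> = (\<integral>x. indicator {-pi..pi} x *\<^sub>R (cos (of_int d * x) / (2 * pi)) \<partial>lborel)"
    by (intro Bochner_Integration.integral_cong) auto
  also have "\<dots> = sin (of_int d * pi) / (of_int d * (2 * pi)) - sin (of_int d * (- pi)) / (of_int d * (2 * pi))"
  proof (rule integral_FTC_atLeastAtMost)
    fix x :: real
    have "((\<lambda>x. sin (of_int d * x) / (of_int d * (2 * pi))) has_field_derivative cos (of_int d * x) / (2 * pi)) (at x within {-pi..pi})"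
      using False by (auto intro!: derivative_eq_intros)
    then show "((\<lambda>x. sin (of_int d * x) / (of_int d * (2 * pi))) has_vector_derivative cos (of_int d * x) / (2 * pi)) (at x within {-pi..pi})"
      by (simp add: has_real_derivative_iff_has_vector_derivative)
  qed (auto intro!: continuous_intros)
  also have "\<dots> = 0"
    using sin_zero_iff_int2[of "of_int d * pi"] by simp
  finally show ?thesis using False by simp
qed

lemma cos_int_mult_measurable [measurable]: "(\<lambda>x::real. cos (of_int m * x)) \<in> borel_measurable borel"
  by (intro borel_measurable_continuous_onI continuous_intros)

text \<open>If \<open>u\<close> is eventually at most \<open>C\<close>, then the inequality makes it eventually at most
  \<open>s C + o(1)\<close>: the late terms carry weights of total at most 1, and the finitely many early ones
  carry weights that tend to 0. Since \<open>s < 1\<close>, iterating this drives the bound to 0.\<close>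
lemma convolution_renewal_tendsto_0:
  fixes u r w :: "nat \<Rightarrow> real"
  assumes s: "0 \<le> s" "s < 1" and u0: "\<And>n. 0 \<le> u n" and ub: "\<And>n. u n \<le> B"
    and w0: "\<And>n. 0 \<le> w n" and w_sum: "\<And>n. (\<Sum>k<n. w k) \<le> 1" and wl: "w \<longlonglongrightarrow> 0" and rl: "r \<longlonglongrightarrow> 0"
    and eq: "\<And>n. u n \<le> r n + s * (\<Sum>k<n. u k * w (n - 1 - k))"
  shows "u \<longlonglongrightarrow> 0"
proof -
  \<comment> \<open>any factor strictly between \<open>s\<close> and 1 absorbs the terms that tend to 0\<close>
  define t where "t = (1 + s) / 2"
  have t: "0 < t" "t < 1" "s < t" using s by (auto simp: t_def)
  have B: "0 \<le> B" using u0[of 0] ub[of 0] by linarith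
  have step: "eventually (\<lambda>n. u n \<le> t * C) sequentially" if ev: "eventually (\<lambda>n. u n \<le> C) sequentially" and C: "0 < C" for C
  proof -
    obtain N where N: "\<And>n. n \<ge> N \<Longrightarrow> u n \<le> C" using ev by (auto simp: eventually_sequentially)
    define h where "h n = r n + B * (\<Sum>k<N. w (n - 1 - k))" for n
    have "(\<lambda>n. w (n - 1 - k)) \<longlonglongrightarrow> 0" for k
      using filterlim_compose[OF wl filterlim_minus_const_nat_at_top[of "Suc k"]] by (simp add: diff_diff_eq2)
    then have "h \<longlonglongrightarrow> 0 + B * (\<Sum>k<N. 0)"
      unfolding h_def by (intro tendsto_intros rl) auto
    then have "eventually (\<lambda>n. h n < (t - s) * C) sequentially"
      using C t by (intro order_tendstoD) auto
    then show ?thesis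
      using eventually_ge_at_top[of N]
    proof eventually_elim
      case (elim n)
      have "(\<Sum>k<n. u k * w (n - 1 - k)) = (\<Sum>k<N. u k * w (n - 1 - k)) + (\<Sum>k=N..<n. u k * w (n - 1 - k))"
        using elim(2) by (simp add: lessThan_atLeast0 sum.atLeastLessThan_concat)
      also have "(\<Sum>k<N. u k * w (n - 1 - k)) \<le> (\<Sum>k<N. B * w (n - 1 - k))"
        using ub w0 by (intro sum_mono mult_right_mono) auto
      also have "(\<Sum>k=N..<n. u k * w (n - 1 - k)) \<le> (\<Sum>k=N..<n. C * w (n - 1 - k))"
        using N w0 by (intro sum_mono mult_right_mono) auto
      also have "(\<Sum>k=N..<n. C * w (n - 1 - k)) \<le> (\<Sum>k<n. C * w (n - 1 - k))"
        using C w0 by (intro sum_mono2) auto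
      also have "(\<Sum>k<n. C * w (n - 1 - k)) = C * (\<Sum>k<n. w k)"
        using sum.nat_diff_reindex[of w n] by (simp flip: sum_distrib_left)
      also have "\<dots> \<le> C" using w_sum[of n] C by (simp add: mult_left_le)
      finally have *: "(\<Sum>k<n. u k * w (n - 1 - k)) \<le> (\<Sum>k<N. B * w (n - 1 - k)) + C" by simp
      have nn: "0 \<le> (\<Sum>k<N. B * w (n - 1 - k))" using B w0 by (intro sum_nonneg) auto
      have "u n \<le> r n + s * ((\<Sum>k<N. B * w (n - 1 - k)) + C)"
        using eq[of n] mult_left_mono[OF * s(1)] by linarith
      also have "\<dots> \<le> r n + (\<Sum>k<N. B * w (n - 1 - k)) + s * C"
        using mult_left_le_one_le[OF nn] s by (simp add: algebra_simps mult_left_le)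
      also have "\<dots> \<le> t * C" using elim(1) by (simp add: h_def sum_distrib_left algebra_simps)
      finally show ?case .
    qed
  qed
  have all: "eventually (\<lambda>n. u n \<le> (B + 1) * t ^ m) sequentially" for m
  proof (induction m)
    case 0
    have "u n \<le> B + 1" for n using ub[of n] by simp
    then show ?case by simp
  next
    case (Suc m)
    from step[OF Suc] B t show ?case by (simp add: mult_ac)
  qed
  have lim: "(\<lambda>m. (B + 1) * t ^ m) \<longlonglongrightarrow> 0"
    using t by (intro tendsto_mult_right_zero LIMSEQ_realpow_zero) auto
  show ?thesis
  proof (rule order_tendstoI)
    fix e :: real assume "0 < e"
    then have "eventually (\<lambda>m. (B + 1) * t ^ m < e) sequentially" using lim by (intro order_tendstoD) auto
    then obtain m where m: "(B + 1) * t ^ m < e" by (auto simp: eventually_sequentially)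
    show "eventually (\<lambda>n. u n < e) sequentially" using all[of m] by eventually_elim (use m in linarith)
  next
    fix e :: real assume "e < 0"
    then show "eventually (\<lambda>n. e < u n) sequentially" using u0 by (intro always_eventually) (auto intro: less_le_trans)
  qed
qed

text \<open>Two walkers move through the same matrices, where \<open>p\<close> is the mean of a row. At different sites
  they use different rows and move independently. At the same site they use the same row, and for
  Dirichlet rows this means that they make the same move with probability \<open>s\<close> and move independently
  otherwise.\<close>
locale step_law =
  fixes p :: "int pmf" and s :: real
  assumes two_points: "\<exists>i\<in>set_pmf p. \<exists>j\<in>set_pmf p. i \<noteq> j" and s01: "0 \<le> s" "s < 1"
begin

definition q :: "int pmf" where "q = map_pmf (\<lambda>(k, l). k - l) (pair_pmf p p)"

definition \<delta> :: "int \<Rightarrow> real" where "\<delta> d = (if d = 0 then 1 else 0)"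

text \<open>The difference of two walkers that always move independently is a random walk with step law \<open>q\<close>;
  this is its transition operator.\<close>
definition walk_op :: "(int \<Rightarrow> real) \<Rightarrow> int \<Rightarrow> real" where
  "walk_op c d = (\<integral>m. c (d + m) \<partial>measure_pmf q)"

text \<open>One step of the difference of the two walkers: at 0 it stays put with probability \<open>s\<close> and moves like
  the walk otherwise. The argument is a bounded weight function, which need not be summable: below it
  is the correlation of two entries as a function of their distance.\<close>
definition corr_op :: "(int \<Rightarrow> real) \<Rightarrow> int \<Rightarrow> real" where
  "corr_op c d = walk_op c d + s * c 0 * (\<delta> d - walk_op \<delta> d)"

definition \<phi> :: "real \<Rightarrow> real" where
  "\<phi> x = (\<integral>m. cos (of_int m * x) \<partial>measure_pmf q)"

lemma integral_q:
  fixes f :: "int \<Rightarrow> real"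
  assumes "\<And>m. \<bar>f m\<bar> \<le> B"
  shows "(\<integral>m. f m \<partial>measure_pmf q) = (\<integral>k. (\<integral>l. f (k - l) \<partial>measure_pmf p) \<partial>measure_pmf p)"
  unfolding q_def using integral_pair_pmf_bounded[of "\<lambda>x. f (fst x - snd x)" B p p] assms
  by (simp add: case_prod_beta')

text \<open>Since \<open>q\<close> is the law of a difference of two independent copies, its characteristic function is real
  and equals the squared modulus of the characteristic function of \<open>p\<close>.\<close>
lemma
  shows \<phi>_eq: "\<phi> x = (\<integral>k. cos (of_int k * x) \<partial>measure_pmf p)\<^sup>2 + (\<integral>k. sin (of_int k * x) \<partial>measure_pmf p)\<^sup>2"
    and integral_q_sin: "(\<integral>m. sin (of_int m * x) \<partial>measure_pmf q) = 0"
proof -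
  have i: "integrable (measure_pmf p) (\<lambda>k. cos (of_int k * x))" "integrable (measure_pmf p) (\<lambda>k. sin (of_int k * x))"
    by (auto intro: integrable_pmf_bounded[of _ 1])
  have "\<phi> x = (\<integral>k. (\<integral>l. cos (of_int k * x) * cos (of_int l * x) + sin (of_int k * x) * sin (of_int l * x) \<partial>measure_pmf p) \<partial>measure_pmf p)"
    unfolding \<phi>_def by (subst integral_q[of _ 1]) (auto simp: left_diff_distrib cos_diff)
  also have "\<dots> = (\<integral>k. cos (of_int k * x) \<partial>measure_pmf p)\<^sup>2 + (\<integral>k. sin (of_int k * x) \<partial>measure_pmf p)\<^sup>2"
    using i by (simp add: power2_eq_square)
  finally show "\<phi> x = (\<integral>k. cos (of_int k * x) \<partial>measure_pmf p)\<^sup>2 + (\<integral>k. sin (of_int k * x) \<partial>measure_pmf p)\<^sup>2" .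
  have "(\<integral>m. sin (of_int m * x) \<partial>measure_pmf q)
      = (\<integral>k. (\<integral>l. sin (of_int k * x) * cos (of_int l * x) - cos (of_int k * x) * sin (of_int l * x) \<partial>measure_pmf p) \<partial>measure_pmf p)"
    by (subst integral_q[of _ 1]) (auto simp: left_diff_distrib sin_diff)
  also have "\<dots> = 0"
    using i by simp
  finally show "(\<integral>m. sin (of_int m * x) \<partial>measure_pmf q) = 0" .
qed

lemma \<phi>_nonneg: "0 \<le> \<phi> x" by (simp add: \<phi>_eq)

lemma \<phi>_le_1: "\<phi> x \<le> 1"
  using integral_pmf_bounded[of "\<lambda>m. cos (of_int m * x)" 1 q] by (simp add: \<phi>_def abs_le_iff)

lemma \<phi>_measurable [measurable]: "\<phi> \<in> borel_measurable borel"
proof -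
  have "(\<lambda>(x :: real, m). cos (of_int m * x)) \<in> borel_measurable (borel \<Otimes>\<^sub>M measure_pmf q)"
    by (rule measurable_pair_pmf_snd) (rule cos_int_mult_measurable)
  then show ?thesis unfolding \<phi>_def[abs_def] by (rule measure_pmf.borel_measurable_lebesgue_integral)
qed

text \<open>Equality \<open>\<phi> x = 1\<close> forces \<open>cos (m x) = 1\<close> for every \<open>m\<close> of positive mass. Two different points in
  the support of \<open>p\<close> provide such an \<open>m \<noteq> 0\<close>, which leaves countably many \<open>x\<close>.\<close>
lemma AE_\<phi>_less_1: "AE x in circle. \<phi> x < 1"
proof -
  obtain i j where ij: "i \<in> set_pmf p" "j \<in> set_pmf p" "i \<noteq> j" using two_points by auto
  have mq: "i - j \<in> set_pmf q" unfolding q_def using ij by (auto intro!: image_eqI[of _ _ "(i, j)"])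
  \<comment> \<open>the solutions of \<open>cos ((i - j) x) = 1\<close>\<close>
  define Z where "Z = range (\<lambda>n::int. of_int n * 2 * pi / of_int (i - j) :: real)"
  have "x \<in> Z" if "\<not> \<phi> x < 1" for x
  proof -
    have "(\<integral>m. 1 - cos (of_int m * x) \<partial>measure_pmf q) = 1 - \<phi> x"
      unfolding \<phi>_def by (subst Bochner_Integration.integral_diff) (auto intro: integrable_pmf_bounded[of _ 1])
    also have "\<dots> = 0" using that \<phi>_le_1[of x] by simp
    finally have zero: "(\<integral>m. 1 - cos (of_int m * x) \<partial>measure_pmf q) = 0" .
    have "integrable (measure_pmf q) (\<lambda>m. 1 - cos (of_int m * x))"
      by (intro Bochner_Integration.integrable_diff integrable_pmf_bounded[of _ 1]) auto
    from zero integral_nonneg_eq_0_iff_AE[OF this] have "AE m in measure_pmf q. 1 - cos (of_int m * x) = 0"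
      by simp
    then have "cos (of_int (i - j) * x) = 1" using mq by (auto simp: AE_measure_pmf_iff)
    then obtain n :: int where "of_int (i - j) * x = of_int n * 2 * pi" by (auto simp: cos_one_2pi_int)
    then have "x = of_int n * 2 * pi / of_int (i - j)" using ij(3) by (simp add: field_simps)
    then show "x \<in> Z" by (auto simp: Z_def)
  qed
  moreover have "AE x in lborel. x \<notin> Z"
    unfolding Z_def by (intro AE_not_in countable_imp_null_set_lborel countable_image) auto
  ultimately have "AE x in lborel. \<phi> x < 1" by (auto elim!: eventually_mono)
  then show ?thesis unfolding circle_def by (subst AE_density) (auto elim!: eventually_mono)
qed

text \<open>The probability that the random walk with step law \<open>q\<close>, started at 0, is at \<open>d\<close> after \<open>n\<close> steps,
  in the form given by Fourier inversion.\<close>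
definition walk :: "nat \<Rightarrow> int \<Rightarrow> real" where
  "walk n d = (\<integral>x. \<phi> x ^ n * cos (of_int d * x) \<partial>circle)"

lemma \<phi>_power_bounds: "0 \<le> \<phi> x ^ n" "\<phi> x ^ n \<le> 1"
  using \<phi>_nonneg \<phi>_le_1 by (auto intro: power_le_one)

lemma abs_\<phi>_power_cos: "\<bar>\<phi> x ^ n * cos y\<bar> \<le> 1"
proof -
  have "\<bar>\<phi> x ^ n * cos y\<bar> = \<phi> x ^ n * \<bar>cos y\<bar>" using \<phi>_power_bounds(1)[of x n] by (simp only: abs_mult abs_of_nonneg)
  also have "\<dots> \<le> 1 * 1" using \<phi>_power_bounds[of x n] by (intro mult_mono) auto
  finally show ?thesis by simp
qed

lemma \<phi>_power_cos_measurable: "(\<lambda>x. \<phi> x ^ n * cos (of_int d * x)) \<in> borel_measurable borel"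
  by (intro borel_measurable_times borel_measurable_power \<phi>_measurable cos_int_mult_measurable)

lemma integrable_\<phi>_power_cos: "integrable circle (\<lambda>x. \<phi> x ^ n * cos (of_int d * x))"
proof (rule circle_integrable)
  show "(\<lambda>x. \<phi> x ^ n * cos (of_int d * x)) \<in> borel_measurable borel" by (rule \<phi>_power_cos_measurable)
  show "\<bar>\<phi> x ^ n * cos (of_int d * x)\<bar> \<le> 1" for x by (rule abs_\<phi>_power_cos)
qed

lemma abs_walk_le_1: "\<bar>walk n d\<bar> \<le> 1"
proof -
  have "\<bar>walk n d\<bar> \<le> (\<integral>x. \<bar>\<phi> x ^ n * cos (of_int d * x)\<bar> \<partial>circle)" unfolding walk_def by (rule integral_abs_bound)
  also have "\<dots> \<le> (\<integral>x. 1 \<partial>circle)"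
  proof (rule integral_mono)
    show "integrable circle (\<lambda>x. \<bar>\<phi> x ^ n * cos (of_int d * x)\<bar>)"
      by (rule Bochner_Integration.integrable_abs[OF integrable_\<phi>_power_cos])
    show "integrable circle (\<lambda>x. 1 :: real)" by simp
  qed (rule abs_\<phi>_power_cos)
  finally show ?thesis using circle.prob_space by simp
qed

lemma walk_0: "walk 0 = \<delta>"
  by (auto simp: fun_eq_iff walk_def \<delta>_def integral_circle_cos)

text \<open>Averaging \<open>cos ((d + m) x)\<close> over the steps \<open>m\<close> multiplies \<open>cos (d x)\<close> by \<open>\<phi> x\<close>, because the sine
  part vanishes.\<close>
lemma walk_op_walk: "walk_op (walk n) = walk (Suc n)"
proof
  fix d
  interpret pair_sigma_finite "measure_pmf q" circle ..
  interpret P: pair_prob_space "measure_pmf q" circle ..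
  define h where "h m x = \<phi> x ^ n * cos (of_int (d + m) * x)" for m :: int and x
  have "(\<lambda>(x, m). h m x) \<in> borel_measurable (circle \<Otimes>\<^sub>M measure_pmf q)"
    unfolding h_def
    by (rule measurable_pair_pmf_snd) (simp only: measurable_cong_sets[OF sets_circle refl] \<phi>_power_cos_measurable)
  note swap = measurable_pair_swap[OF this]
  have "(\<lambda>(x, y). case (y, x) of (x, m) \<Rightarrow> h m x) = case_prod h" by (simp add: fun_eq_iff)
  with swap have meas: "case_prod h \<in> borel_measurable (measure_pmf q \<Otimes>\<^sub>M circle)" by (simp only:)
  have "walk_op (walk n) d = (\<integral>m. (\<integral>x. h m x \<partial>circle) \<partial>measure_pmf q)" by (simp add: walk_op_def walk_def h_def)
  also have "\<dots> = (\<integral>x. (\<integral>m. h m x \<partial>measure_pmf q) \<partial>circle)"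
  proof (intro Fubini_integral[symmetric] P.integrable_const_bound[OF _ meas])
    show "AE z in measure_pmf q \<Otimes>\<^sub>M circle. norm (case_prod h z) \<le> 1"
      by (simp add: h_def abs_\<phi>_power_cos case_prod_beta')
  qed
  also have "\<dots> = walk (Suc n) d"
    unfolding walk_def
  proof (intro Bochner_Integration.integral_cong refl)
    fix x
    have "(\<integral>m. h m x \<partial>measure_pmf q)
      = (\<integral>m. \<phi> x ^ n * (cos (of_int d * x) * cos (of_int m * x) - sin (of_int d * x) * sin (of_int m * x)) \<partial>measure_pmf q)"
      by (simp add: h_def distrib_right cos_add)
    also have "\<dots> = \<phi> x ^ n * (cos (of_int d * x) * \<phi> x)"
      by (subst Bochner_Integration.integral_mult_right_zero, subst Bochner_Integration.integral_diff)
        (auto intro: integrable_pmf_bounded[of _ 1] simp: abs_mult mult_le_one integral_q_sin \<phi>_def[symmetric])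
    finally show "(\<integral>m. h m x \<partial>measure_pmf q) = \<phi> x ^ Suc n * cos (of_int d * x)" by simp
  qed
  finally show "walk_op (walk n) d = walk (Suc n) d" .
qed

lemma walk_0_decreasing: "walk (Suc n) 0 \<le> walk n 0" and walk_0_nonneg: "0 \<le> walk n 0"
proof -
  have "\<phi> x ^ Suc n \<le> \<phi> x ^ n" for x using \<phi>_nonneg \<phi>_le_1 by (intro power_decreasing) auto
  then show "walk (Suc n) 0 \<le> walk n 0"
    using integrable_\<phi>_power_cos[of _ 0] unfolding walk_def by (intro integral_mono) (simp_all del: power_Suc)
  show "0 \<le> walk n 0" unfolding walk_def using \<phi>_nonneg by (intro Bochner_Integration.integral_nonneg) auto
qed

lemma walk_0_tendsto: "(\<lambda>n. walk n 0) \<longlonglongrightarrow> 0"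
proof -
  have "(\<lambda>n. \<integral>x. \<phi> x ^ n \<partial>circle) \<longlonglongrightarrow> (\<integral>x. 0 \<partial>circle)"
  proof (rule integral_dominated_convergence[where w="\<lambda>_. 1"])
    show "AE x in circle. (\<lambda>n. \<phi> x ^ n) \<longlonglongrightarrow> 0"
      using AE_\<phi>_less_1 by eventually_elim (use \<phi>_nonneg in \<open>auto intro!: LIMSEQ_realpow_zero\<close>)
    show "(\<lambda>x. \<phi> x ^ n) \<in> borel_measurable circle" for n
      unfolding measurable_cong_sets[OF sets_circle refl]
      by (intro borel_measurable_power \<phi>_measurable)
    show "AE x in circle. norm (\<phi> x ^ n) \<le> 1" for n
    proof (rule AE_I2)
      show "norm (\<phi> x ^ n) \<le> 1" for x using \<phi>_power_bounds[of x n] by simp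
    qed
  qed simp_all
  then show ?thesis by (simp add: walk_def)
qed

text \<open>The probability that two walkers who start at the same site are together at time \<open>n\<close>.\<close>
definition ret :: "nat \<Rightarrow> real" where "ret n = (corr_op ^^ n) \<delta> 0"

text \<open>Each visit of the difference to 0, at time \<open>k\<close>, replaces with weight \<open>s\<close> one step of the unperturbed
  walk by a step of length 0.\<close>
lemma corr_op_pow_\<delta>: "(corr_op ^^ n) \<delta> d = walk n d + s * (\<Sum>k<n. ret k * (walk (n - 1 - k) d - walk (n - k) d))"
proof (induction n arbitrary: d)
  case 0
  then show ?case by (simp add: walk_0)
next
  case (Suc n)
  have int: "integrable (measure_pmf q) (\<lambda>m. walk n (d + m))" for n d
    by (rule integrable_pmf_bounded[of _ 1]) (rule abs_walk_le_1)
  have "walk_op ((corr_op ^^ n) \<delta>) d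
      = (\<integral>m. walk n (d + m) + s * (\<Sum>k<n. ret k * (walk (n - 1 - k) (d + m) - walk (n - k) (d + m))) \<partial>measure_pmf q)"
    unfolding walk_op_def by (simp add: Suc)
  also have "\<dots> = walk_op (walk n) d + s * (\<Sum>k<n. ret k * (walk_op (walk (n - 1 - k)) d - walk_op (walk (n - k)) d))"
    unfolding walk_op_def using int by simp
  also have "\<dots> = walk (Suc n) d + s * (\<Sum>k<n. ret k * (walk (Suc (n - 1 - k)) d - walk (Suc (n - k)) d))"
    by (simp add: walk_op_walk)
  also have "(\<Sum>k<n. ret k * (walk (Suc (n - 1 - k)) d - walk (Suc (n - k)) d)) = (\<Sum>k<n. ret k * (walk (n - k) d - walk (Suc n - k) d))"
    by (intro sum.cong) (auto simp: Suc_diff_Suc Suc_diff_le)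
  finally have "(corr_op ^^ Suc n) \<delta> d = walk (Suc n) d + s * (\<Sum>k<n. ret k * (walk (n - k) d - walk (Suc n - k) d)) + s * ret n * (\<delta> d - walk_op \<delta> d)"
    by (simp add: corr_op_def[of "(corr_op ^^ n) \<delta>"] ret_def)
  also have "walk_op \<delta> = walk 1" using walk_op_walk[of 0] by (simp add: walk_0)
  finally show ?case by (simp add: walk_0 algebra_simps)
qed

text \<open>The weights in \<open>corr_op_pow_\<delta>\<close>, at the site 0, are the decrements of the return probabilities
  \<open>walk n 0\<close>. These decrease from 1 to 0, so the weights are nonnegative with sum at most 1, and the
  renewal inequality applies.\<close>
lemma ret_tendsto_0: "ret \<longlonglongrightarrow> 0"
proof (rule convolution_renewal_tendsto_0[OF s01])
  define r where "r n = walk n 0" for n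
  define w where "w n = walk n 0 - walk (Suc n) 0" for n
  show w0: "0 \<le> w n" for n using walk_0_decreasing by (simp add: w_def)
  have f00: "walk 0 0 = 1" by (simp add: walk_0 \<delta>_def)
  show w_sum: "(\<Sum>k<n. w k) \<le> 1" for n
  proof -
    have "(\<Sum>k<n. w k) = walk 0 0 - walk n 0" unfolding w_def by (induction n) auto
    then show ?thesis using f00 walk_0_nonneg[of n] by simp
  qed
  show "r \<longlonglongrightarrow> 0" unfolding r_def by (rule walk_0_tendsto)
  have "w \<longlonglongrightarrow> 0 - 0" unfolding w_def by (intro tendsto_intros walk_0_tendsto LIMSEQ_Suc)
  then show "w \<longlonglongrightarrow> 0" by simp
  show eq: "ret n \<le> r n + s * (\<Sum>k<n. ret k * w (n - 1 - k))" for n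
  proof -
    have "(\<Sum>k<n. ret k * (walk (n - 1 - k) 0 - walk (n - k) 0)) = (\<Sum>k<n. ret k * w (n - 1 - k))"
      by (intro sum.cong) (auto simp: w_def Suc_diff_Suc)
    then show ?thesis using corr_op_pow_\<delta>[of n 0] by (simp add: ret_def[symmetric] r_def)
  qed
  have eq': "ret n = r n + s * (\<Sum>k<n. ret k * w (n - 1 - k))" for n
  proof -
    have "(\<Sum>k<n. ret k * (walk (n - 1 - k) 0 - walk (n - k) 0)) = (\<Sum>k<n. ret k * w (n - 1 - k))"
      by (intro sum.cong) (auto simp: w_def Suc_diff_Suc)
    then show ?thesis using corr_op_pow_\<delta>[of n 0] by (simp add: ret_def[symmetric] r_def)
  qed
  show u0: "0 \<le> ret n" for n
  proof (induction n rule: less_induct)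
    case (less n)
    then show ?case
      unfolding eq'[of n] r_def
      by (intro add_nonneg_nonneg mult_nonneg_nonneg sum_nonneg walk_0_nonneg s01 w0) simp
  qed
  show "ret n \<le> 1 / (1 - s)" for n
  proof (induction n rule: less_induct)
    case (less n)
    have "(\<Sum>k<n. ret k * w (n - 1 - k)) \<le> (\<Sum>k<n. 1 / (1 - s) * w (n - 1 - k))"
      using less w0 by (intro sum_mono mult_right_mono) auto
    also have "\<dots> = 1 / (1 - s) * (\<Sum>k<n. w k)"
      using sum.nat_diff_reindex[of w n] by (simp add: sum_divide_distrib[symmetric])
    also have "\<dots> \<le> 1 / (1 - s)" using w_sum[of n] s01 by (simp add: divide_right_mono)
    finally have "s * (\<Sum>k<n. ret k * w (n - 1 - k)) \<le> s * (1 / (1 - s))" by (rule mult_left_mono[OF _ s01(1)])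
    moreover have "r n \<le> 1" using abs_walk_le_1[of n 0] by (simp add: r_def abs_le_iff)
    ultimately have "ret n \<le> 1 + s * (1 / (1 - s))" unfolding eq'[of n] by linarith
    also have "\<dots> = 1 / (1 - s)" using s01 by (simp add: field_simps)
    finally show ?case .
  qed
qed

lemma abs_walk_op_bounded: "(\<And>d. \<bar>c d\<bar> \<le> C) \<Longrightarrow> \<bar>walk_op c d\<bar> \<le> C"
  unfolding walk_op_def by (rule integral_pmf_bounded)

lemma abs_corr_op_bounded:
  assumes "\<And>d. \<bar>c d\<bar> \<le> C"
  shows "\<bar>corr_op c d\<bar> \<le> C + s * C * 2"
proof -
  have d: "\<bar>\<delta> d\<bar> \<le> 1" for d by (simp add: \<delta>_def)
  have "\<bar>\<delta> d - walk_op \<delta> d\<bar> \<le> 2" using d[of d] abs_walk_op_bounded[of \<delta> 1 d, OF d] by linarith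
  moreover have "\<bar>s * c 0\<bar> \<le> s * C" using assms[of 0] s01 by (simp add: abs_mult mult_left_mono)
  ultimately have "\<bar>s * c 0 * (\<delta> d - walk_op \<delta> d)\<bar> \<le> s * C * 2" unfolding abs_mult[of "s * c 0"] by (intro mult_mono) auto
  then show ?thesis using abs_walk_op_bounded[of c C d, OF assms] unfolding corr_op_def by linarith
qed

text \<open>Linearity, in the one combination that expresses a mean squared difference.\<close>
lemma corr_op_combination:
  assumes "\<And>d. \<bar>b d\<bar> \<le> C" "\<And>d. \<bar>c d\<bar> \<le> C'" "\<And>d. \<bar>e d\<bar> \<le> C''"
    and eq: "\<And>d. b d - 2 * c d + e d = v * h d"
  shows "corr_op b d - 2 * corr_op c d + corr_op e d = v * corr_op h d"
proof -
  have i: "integrable (measure_pmf q) (\<lambda>m. b (d + m))" "integrable (measure_pmf q) (\<lambda>m. c (d + m))"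
      "integrable (measure_pmf q) (\<lambda>m. e (d + m))"
    by (rule integrable_pmf_bounded, rule assms)+
  have "walk_op b d - 2 * walk_op c d + walk_op e d = (\<integral>m. b (d + m) - 2 * c (d + m) + e (d + m) \<partial>measure_pmf q)"
    unfolding walk_op_def using i by simp
  also have "\<dots> = v * walk_op h d" unfolding eq walk_op_def by simp
  finally have "walk_op b d - 2 * walk_op c d + walk_op e d = v * walk_op h d" .
  moreover have "corr_op b d - 2 * corr_op c d + corr_op e d = (walk_op b d - 2 * walk_op c d + walk_op e d) + s * (b 0 - 2 * c 0 + e 0) * (\<delta> d - walk_op \<delta> d)"
    by (simp add: corr_op_def algebra_simps)
  ultimately have "corr_op b d - 2 * corr_op c d + corr_op e d = v * walk_op h d + s * (v * h 0) * (\<delta> d - walk_op \<delta> d)"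
    by (simp only: eq)
  then show ?thesis by (simp add: corr_op_def algebra_simps)
qed

lemma corr_op_pow_bounded:
  assumes "\<And>d. \<bar>c d\<bar> \<le> C"
  shows "\<exists>C'. \<forall>d. \<bar>(corr_op ^^ n) c d\<bar> \<le> C'"
proof (induction n)
  case 0 then show ?case using assms by auto
next
  case (Suc n)
  then obtain C' where "\<And>d. \<bar>(corr_op ^^ n) c d\<bar> \<le> C'" by auto
  from abs_corr_op_bounded[of "(corr_op ^^ n) c" C', OF this] show ?case by auto
qed

lemma corr_op_pow_combination:
  assumes "\<And>d. \<bar>b d\<bar> \<le> C" "\<And>d. \<bar>c d\<bar> \<le> C'" "\<And>d. \<bar>e d\<bar> \<le> C''"
    and "\<And>d. b d - 2 * c d + e d = v * h d"
  shows "(corr_op ^^ n) b d - 2 * (corr_op ^^ n) c d + (corr_op ^^ n) e d = v * (corr_op ^^ n) h d"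
proof (induction n arbitrary: d)
  case 0 then show ?case using assms by simp
next
  case (Suc n)
  obtain D1 where D1: "\<And>d. \<bar>(corr_op ^^ n) b d\<bar> \<le> D1" using corr_op_pow_bounded[of b C n, OF assms(1)] by auto
  obtain D2 where D2: "\<And>d. \<bar>(corr_op ^^ n) c d\<bar> \<le> D2" using corr_op_pow_bounded[of c C' n, OF assms(2)] by auto
  obtain D3 where D3: "\<And>d. \<bar>(corr_op ^^ n) e d\<bar> \<le> D3" using corr_op_pow_bounded[of e C'' n, OF assms(3)] by auto
  show ?case using corr_op_combination[OF D1 D2 D3 Suc] by simp
qed

abbreviation dsum :: "(int \<Rightarrow> int \<Rightarrow> ennreal) \<Rightarrow> ennreal" where
  "dsum F \<equiv> \<integral>\<^sup>+i. (\<integral>\<^sup>+k. F i k \<partial>count_space UNIV) \<partial>count_space UNIV"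

lemma nn_integral_count_space_reflect:
  "(\<integral>\<^sup>+i. h (j - i) \<partial>count_space UNIV) = (\<integral>\<^sup>+i. h i \<partial>count_space UNIV)" for j :: int
  by (rule nn_integral_bij_count_space) (rule bij_betwI[where g="\<lambda>i. j - i"], auto)

text \<open>The substitutions \<open>j - i\<close> and \<open>j' - k\<close> turn the double sum into an expectation over two independent
  steps.\<close>
lemma dsum_pmf:
  assumes c: "\<And>d. 0 \<le> c d" "\<And>d. c d \<le> C"
  shows "dsum (\<lambda>i k. ennreal (c (k - i) * (pmf p (j - i) * pmf p (j' - k)))) = ennreal (walk_op c (j' - j))"
proof -
  have cb: "\<bar>c d\<bar> \<le> C" for d using c[of d] by simp
  have inner: "(\<integral>\<^sup>+k. ennreal (c (k - i) * (pmf p (j - i) * pmf p (j' - k))) \<partial>count_space UNIV)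
      = ennreal (pmf p (j - i)) * (\<integral>\<^sup>+l. ennreal (c (j' - l - i)) \<partial>measure_pmf p)" for i
  proof -
    have "(\<integral>\<^sup>+k. ennreal (c (k - i) * (pmf p (j - i) * pmf p (j' - k))) \<partial>count_space UNIV)
      = (\<integral>\<^sup>+k. ennreal (pmf p (j - i)) * (ennreal (pmf p (j' - k)) * ennreal (c (j' - (j' - k) - i))) \<partial>count_space UNIV)"
      using c by (intro nn_integral_cong) (simp add: ennreal_mult[symmetric] mult_ac)
    also have "\<dots> = ennreal (pmf p (j - i)) * (\<integral>\<^sup>+k. ennreal (pmf p (j' - k)) * ennreal (c (j' - (j' - k) - i)) \<partial>count_space UNIV)"
      by (rule nn_integral_cmult) simp
    also have "(\<integral>\<^sup>+k. ennreal (pmf p (j' - k)) * ennreal (c (j' - (j' - k) - i)) \<partial>count_space UNIV)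
        = (\<integral>\<^sup>+l. ennreal (pmf p l) * ennreal (c (j' - l - i)) \<partial>count_space UNIV)"
      by (rule nn_integral_count_space_reflect[of "\<lambda>l. ennreal (pmf p l) * ennreal (c (j' - l - i))"])
    finally show ?thesis by (simp add: nn_integral_measure_pmf)
  qed
  have l: "(\<integral>\<^sup>+l. ennreal (c (j' - l - (j - k))) \<partial>measure_pmf p) = ennreal (\<integral>l. c (j' - j + (k - l)) \<partial>measure_pmf p)" for k
    using c cb by (subst nn_integral_eq_integral) (auto simp: algebra_simps intro: integrable_pmf_bounded[of _ C])
  have "dsum (\<lambda>i k. ennreal (c (k - i) * (pmf p (j - i) * pmf p (j' - k))))
      = (\<integral>\<^sup>+i. ennreal (pmf p (j - i)) * (\<integral>\<^sup>+l. ennreal (c (j' - l - (j - (j - i)))) \<partial>measure_pmf p) \<partial>count_space UNIV)"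
    by (simp add: inner)
  also have "\<dots> = (\<integral>\<^sup>+k. ennreal (pmf p k) * (\<integral>\<^sup>+l. ennreal (c (j' - l - (j - k))) \<partial>measure_pmf p) \<partial>count_space UNIV)"
    by (rule nn_integral_count_space_reflect[of "\<lambda>k. ennreal (pmf p k) * (\<integral>\<^sup>+l. ennreal (c (j' - l - (j - k))) \<partial>measure_pmf p)"])
  also have "\<dots> = (\<integral>\<^sup>+k. ennreal (\<integral>l. c (j' - j + (k - l)) \<partial>measure_pmf p) \<partial>measure_pmf p)"
    unfolding l by (simp add: nn_integral_measure_pmf)
  also have "\<dots> = ennreal (\<integral>k. (\<integral>l. c (j' - j + (k - l)) \<partial>measure_pmf p) \<partial>measure_pmf p)"
    using c by (intro nn_integral_eq_integral integrable_pmf_bounded[of _ C] integral_pmf_bounded cb) auto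
  also have "(\<integral>k. (\<integral>l. c (j' - j + (k - l)) \<partial>measure_pmf p) \<partial>measure_pmf p) = walk_op c (j' - j)"
    unfolding walk_op_def using integral_q[of "\<lambda>m. c (j' - j + m)" C] cb by simp
  finally show ?thesis .
qed

text \<open>The mean of the product of the entries \<open>(i, j)\<close> and \<open>(k, j')\<close> of the random matrix: the product of the
  means, with a correction of weight \<open>s\<close> when both entries belong to the same row.\<close>
definition \<kappa> :: "int \<Rightarrow> int \<Rightarrow> int \<Rightarrow> int \<Rightarrow> real" where
  "\<kappa> i k j j' = pmf p (j - i) * pmf p (j' - k)
    + s * \<delta> (k - i) * (\<delta> (j' - j) * pmf p (j - i) - pmf p (j - i) * pmf p (j' - k))"

lemma ennreal_add_eq_imp_diff:
  assumes "m + ennreal y = ennreal x" "0 \<le> x" "0 \<le> y"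
  shows "m = ennreal (x - y) \<and> 0 \<le> x - y"
proof (cases m)
  case (real r)
  with assms have "r + y = x" by (simp flip: ennreal_plus)
  with real show ?thesis by auto
qed (use assms in auto)

text \<open>The correction in \<open>\<kappa>\<close> has both signs. Its negative part is moved to the other side, so that the
  sums can be computed in \<open>[0, \<infinity>]\<close> and subtracted only at the end.\<close>
lemma dsum_\<kappa>:
  assumes c: "\<And>d. 0 \<le> c d" "\<And>d. c d \<le> C" and \<kappa>_nonneg: "\<And>i k. 0 \<le> \<kappa> i k j j'"
  shows "dsum (\<lambda>i k. ennreal (c (k - i)) * ennreal (\<kappa> i k j j')) = ennreal (corr_op c (j' - j)) \<and> 0 \<le> corr_op c (j' - j)"
proof -
  have \<delta>: "0 \<le> \<delta> d" "\<delta> d \<le> 1" for d by (auto simp: \<delta>_def)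
  have walk_op_nonneg: "0 \<le> walk_op b d" if "\<And>d. 0 \<le> b d" for b d
    unfolding walk_op_def using that by (intro Bochner_Integration.integral_nonneg) auto
  have sc: "0 \<le> s * c 0" using s01 c by simp
  have diag: "dsum (\<lambda>i k. ennreal (s * c 0) * ennreal (\<delta> (k - i) * (\<delta> (j' - j) * pmf p (j - i)))) = ennreal (s * c 0 * \<delta> (j' - j))"
  proof -
    have "(\<integral>\<^sup>+k. ennreal (s * c 0) * ennreal (\<delta> (k - i) * (\<delta> (j' - j) * pmf p (j - i))) \<partial>count_space UNIV)
        = ennreal (s * c 0 * \<delta> (j' - j)) * ennreal (pmf p (j - i))" for i
    proof -
      have "(\<integral>\<^sup>+k. ennreal (s * c 0) * ennreal (\<delta> (k - i) * (\<delta> (j' - j) * pmf p (j - i))) \<partial>count_space UNIV)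
          = (\<integral>\<^sup>+k. ennreal (s * c 0 * \<delta> (j' - j)) * ennreal (pmf p (j - i)) * indicator {i} k \<partial>count_space UNIV)"
        using sc \<delta> by (intro nn_integral_cong) (auto simp: \<delta>_def indicator_def ennreal_mult)
      also have "\<dots> = ennreal (s * c 0 * \<delta> (j' - j)) * ennreal (pmf p (j - i)) * emeasure (count_space UNIV) {i}"
        by (rule nn_integral_cmult_indicator) simp
      finally show ?thesis by simp
    qed
    then have "dsum (\<lambda>i k. ennreal (s * c 0) * ennreal (\<delta> (k - i) * (\<delta> (j' - j) * pmf p (j - i))))
        = ennreal (s * c 0 * \<delta> (j' - j)) * (\<integral>\<^sup>+i. ennreal (pmf p (j - i)) \<partial>count_space UNIV)"
      by (simp add: nn_integral_cmult)
    also have "(\<integral>\<^sup>+i. ennreal (pmf p (j - i)) \<partial>count_space UNIV) = 1"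
      using nn_integral_count_space_reflect[of "\<lambda>i. ennreal (pmf p i)" j] nn_integral_pmf[where p=p and A=UNIV]
        measure_pmf.emeasure_space_1[of p] by simp
    finally show ?thesis by simp
  qed
  let ?m = "dsum (\<lambda>i k. ennreal (c (k - i)) * ennreal (\<kappa> i k j j'))"
  have pw: "ennreal (c (k - i)) * ennreal (\<kappa> i k j j') + ennreal (s * c 0) * ennreal (\<delta> (k - i) * (pmf p (j - i) * pmf p (j' - k)))
      = ennreal (c (k - i) * (pmf p (j - i) * pmf p (j' - k)))
        + ennreal (s * c 0) * ennreal (\<delta> (k - i) * (\<delta> (j' - j) * pmf p (j - i)))" for i k
  proof -
    have "c (k - i) * \<kappa> i k j j' + s * c 0 * (\<delta> (k - i) * (pmf p (j - i) * pmf p (j' - k)))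
      = c (k - i) * (pmf p (j - i) * pmf p (j' - k)) + s * c 0 * (\<delta> (k - i) * (\<delta> (j' - j) * pmf p (j - i)))"
      by (cases "k = i") (auto simp: \<kappa>_def \<delta>_def algebra_simps)
    then show ?thesis
      using c \<kappa>_nonneg sc \<delta> by (simp add: ennreal_mult[symmetric] ennreal_plus[symmetric] del: ennreal_plus)
  qed
  have "?m + ennreal (s * c 0) * dsum (\<lambda>i k. ennreal (\<delta> (k - i) * (pmf p (j - i) * pmf p (j' - k))))
      = dsum (\<lambda>i k. ennreal (c (k - i)) * ennreal (\<kappa> i k j j') + ennreal (s * c 0) * ennreal (\<delta> (k - i) * (pmf p (j - i) * pmf p (j' - k))))"
    by (simp add: nn_integral_add nn_integral_cmult)
  also have "\<dots> = dsum (\<lambda>i k. ennreal (c (k - i) * (pmf p (j - i) * pmf p (j' - k))))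
      + dsum (\<lambda>i k. ennreal (s * c 0) * ennreal (\<delta> (k - i) * (\<delta> (j' - j) * pmf p (j - i))))"
    unfolding pw by (simp add: nn_integral_add)
  also have "\<dots> = ennreal (walk_op c (j' - j) + s * c 0 * \<delta> (j' - j))"
    unfolding dsum_pmf[of c C, OF c] diag using walk_op_nonneg[of c, OF c(1)] sc \<delta> by (simp add: ennreal_plus)
  finally have "?m + ennreal (s * c 0 * walk_op \<delta> (j' - j)) = ennreal (walk_op c (j' - j) + s * c 0 * \<delta> (j' - j))"
    unfolding dsum_pmf[of \<delta> 1, OF \<delta>] using sc walk_op_nonneg[of \<delta>, OF \<delta>(1)] by (simp add: ennreal_mult)
  moreover have "0 \<le> walk_op c (j' - j) + s * c 0 * \<delta> (j' - j)" "0 \<le> s * c 0 * walk_op \<delta> (j' - j)"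
    using walk_op_nonneg[of c, OF c(1)] walk_op_nonneg[of \<delta>, OF \<delta>(1)] sc \<delta> by auto
  ultimately show ?thesis
    using ennreal_add_eq_imp_diff[of ?m "s * c 0 * walk_op \<delta> (j' - j)" "walk_op c (j' - j) + s * c 0 * \<delta> (j' - j)"]
    by (simp add: corr_op_def algebra_simps)
qed

end

section \<open>Second moments along the dynamics\<close>

lemma AE_pair_fst:
  assumes "prob_space M" "prob_space N" "AE x in M. Q x"
  shows "AE w in M \<Otimes>\<^sub>M N. Q (fst w)"
proof -
  interpret N: prob_space N by fact
  have eq: "distr (M \<Otimes>\<^sub>M N) M fst = M" by (rule N.distr_pair_fst)
  have "AE x in distr (M \<Otimes>\<^sub>M N) M fst. Q x" unfolding eq by fact
  then show ?thesis by (rule AE_distrD[OF measurable_fst])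
qed

lemma distr_pair_snd_marginal:
  assumes "prob_space M" "prob_space N"
  shows "distr (M \<Otimes>\<^sub>M N) N snd = N"
proof (rule measure_eqI)
  interpret M: prob_space M by fact
  interpret N: prob_space N by fact
  fix X assume "X \<in> sets (distr (M \<Otimes>\<^sub>M N) N snd)"
  then have X: "X \<in> sets N" by simp
  then have "snd -` X \<inter> space (M \<Otimes>\<^sub>M N) = space M \<times> X"
    using sets.sets_into_space[OF X] by (auto simp: space_pair_measure)
  then show "emeasure (distr (M \<Otimes>\<^sub>M N) N snd) X = emeasure N X"
    using X by (simp add: emeasure_distr N.emeasure_pair_measure_Times M.emeasure_space_1)
qed simp

lemma AE_pair_snd:
  assumes "prob_space M" "prob_space N" "AE x in N. Q x"
  shows "AE w in M \<Otimes>\<^sub>M N. Q (snd w)"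
proof -
  have "AE x in distr (M \<Otimes>\<^sub>M N) N snd. Q x"
    unfolding distr_pair_snd_marginal[OF assms(1,2)] by fact
  then show ?thesis by (rule AE_distrD[OF measurable_snd])
qed

lemma nn_integral_pair_mult:
  assumes "prob_space M" "prob_space N" and [measurable]: "g \<in> borel_measurable M" "h \<in> borel_measurable N"
  shows "(\<integral>\<^sup>+w. g (fst w) * h (snd w) \<partial>(M \<Otimes>\<^sub>M N)) = (\<integral>\<^sup>+x. g x \<partial>M) * (\<integral>\<^sup>+y. h y \<partial>N)"
proof -
  interpret N: prob_space N by fact
  have "(\<integral>\<^sup>+w. g (fst w) * h (snd w) \<partial>(M \<Otimes>\<^sub>M N)) = (\<integral>\<^sup>+x. (\<integral>\<^sup>+y. g x * h y \<partial>N) \<partial>M)"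
    by (subst N.nn_integral_fst[symmetric]) auto
  also have "\<dots> = (\<integral>\<^sup>+x. g x * (\<integral>\<^sup>+y. h y \<partial>N) \<partial>M)"
    by (intro nn_integral_cong nn_integral_cmult) auto
  also have "\<dots> = (\<integral>\<^sup>+x. g x \<partial>M) * (\<integral>\<^sup>+y. h y \<partial>N)"
    by (rule nn_integral_multc) auto
  finally show ?thesis .
qed

lemma nn_integral_PiM_component:
  fixes f :: "'a \<Rightarrow> ennreal"
  assumes N: "\<And>i. prob_space (N i)" and f: "f \<in> borel_measurable (N i)"
  shows "(\<integral>\<^sup>+x. f (x i) \<partial>Pi\<^sub>M UNIV N) = (\<integral>\<^sup>+x. f x \<partial>N i)"
proof -
  have "(\<integral>\<^sup>+x. f x \<partial>N i) = (\<integral>\<^sup>+x. f x \<partial>distr (Pi\<^sub>M UNIV N) (N i) (\<lambda>x. x i))"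
    by (simp add: distr_PiM_component N)
  also have "\<dots> = (\<integral>\<^sup>+x. f (x i) \<partial>Pi\<^sub>M UNIV N)"
    by (rule nn_integral_distr) (use f in simp_all)
  finally show ?thesis ..
qed

lemma nn_integral_PiM_component2:
  fixes f g :: "'a \<Rightarrow> ennreal"
  assumes N: "\<And>i. prob_space (N i)" and "i \<noteq> k"
    and f: "f \<in> borel_measurable (N i)" and g: "g \<in> borel_measurable (N k)"
  shows "(\<integral>\<^sup>+x. f (x i) * g (x k) \<partial>Pi\<^sub>M UNIV N) = (\<integral>\<^sup>+x. f x \<partial>N i) * (\<integral>\<^sup>+x. g x \<partial>N k)"
proof -
  define h where "h m = (if m = i then f else if m = k then g else (\<lambda>_. 1))" for m
  have "h m \<in> borel_measurable (N m)" for m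
    using f g by (cases "m = i"; cases "m = k") (simp_all add: h_def)
  from nn_integral_PiM_prod[of N "{i, k}" h, OF N _ this] show ?thesis
    using assms(2) by (simp add: h_def)
qed

lemma row_mult_eq_nn_integral:
  assumes "\<And>i. 0 \<le> t i" "\<And>i j. 0 \<le> P i j"
    and fin: "\<And>j. (\<integral>\<^sup>+i. ennreal (t i) * ennreal (P i j) \<partial>count_space UNIV) < \<infinity>"
  shows "row_mult_defined t P"
    and "ennreal (row_mult t P j) = (\<integral>\<^sup>+i. ennreal (t i) * ennreal (P i j) \<partial>count_space UNIV)"
    and "0 \<le> row_mult t P j"
proof -
  have eq: "(\<integral>\<^sup>+i. ennreal (t i * P i j) \<partial>count_space UNIV) = (\<integral>\<^sup>+i. ennreal (t i) * ennreal (P i j) \<partial>count_space UNIV)" for j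
    using assms by (simp add: ennreal_mult)
  show "row_mult_defined t P"
    unfolding row_mult_defined_def using assms eq by (auto simp: summable_on_nonneg_iff)
  show "ennreal (row_mult t P j) = (\<integral>\<^sup>+i. ennreal (t i) * ennreal (P i j) \<partial>count_space UNIV)"
    unfolding row_mult_def using assms eq[of j] by (subst ennreal_infsum_nonneg) auto
  show "0 \<le> row_mult t P j" unfolding row_mult_def using assms by (intro infsum_nonneg) auto
qed

locale dirichlet_exchange = summable_shapes +
  assumes two_pos: "\<exists>i j. i \<noteq> j \<and> 0 < \<alpha> i \<and> 0 < \<alpha> j"
begin

definition mean_pmf :: "int pmf" where "mean_pmf = embed_pmf (\<lambda>i. \<alpha> i / a)"

lemma pmf_mean: "pmf mean_pmf i = \<alpha> i / a"
  unfolding mean_pmf_def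
proof (rule pmf_embed_pmf)
  show "0 \<le> \<alpha> i / a" for i using shape_nonneg total_pos by (simp add: less_imp_le)
  have "(\<integral>\<^sup>+i. ennreal (\<alpha> i / a) \<partial>count_space UNIV) = (\<integral>\<^sup>+i. ennreal (1 / a) * ennreal (\<alpha> i) \<partial>count_space UNIV)"
    using total_pos shape_nonneg by (intro nn_integral_cong) (simp add: ennreal_mult[symmetric])
  also have "\<dots> = ennreal (1 / a) * ennreal a" by (subst nn_integral_cmult) (auto simp: nn_shape_sum)
  also have "\<dots> = 1" using total_pos by (simp add: ennreal_mult[symmetric])
  finally show "(\<integral>\<^sup>+i. ennreal (\<alpha> i / a) \<partial>count_space UNIV) = 1" .
qed

sublocale step_law mean_pmf "1 / (a + 1)"
proof
  obtain i j where "i \<noteq> j" "0 < \<alpha> i" "0 < \<alpha> j" using two_pos by auto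
  then show "\<exists>i\<in>set_pmf mean_pmf. \<exists>j\<in>set_pmf mean_pmf. i \<noteq> j"
    using total_pos by (intro bexI[of _ i] bexI[of _ j]) (auto simp: set_pmf_iff pmf_mean)
qed (use total_pos in auto)

abbreviation K :: "(int \<Rightarrow> int \<Rightarrow> real) measure" where "K \<equiv> matrix_law \<alpha>"

abbreviation pair_space :: "((int \<Rightarrow> real) \<times> (int \<Rightarrow> real)) measure" where
  "pair_space \<equiv> seq_space \<Otimes>\<^sub>M seq_space"

lemma dirichlet_coordinate_measurable [measurable]: "(\<lambda>q. ennreal (q k)) \<in> borel_measurable (dirichlet \<alpha>)"
  unfolding measurable_cong_sets[OF sets_dirichlet refl] by measurable

lemma dirichlet_coordinate2_measurable [measurable]:
  "(\<lambda>q. ennreal (q k) * ennreal (q l)) \<in> borel_measurable (dirichlet \<alpha>)"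
  unfolding measurable_cong_sets[OF sets_dirichlet refl] by measurable

lemma AE_K_nonneg: "AE P in K. \<forall>i j. 0 \<le> P i j"
proof -
  have "AE r in Pi\<^sub>M UNIV (\<lambda>_::int. dirichlet \<alpha>). \<forall>i. \<forall>k. 0 \<le> r i k"
    unfolding AE_all_countable[of "\<lambda>i r. \<forall>k. 0 \<le> r i k"]
    by (intro allI AE_PiM_component prob_space_dirichlet AE_dirichlet_nonneg) auto
  then have "AE r in Pi\<^sub>M UNIV (\<lambda>_::int. dirichlet \<alpha>). \<forall>i j. 0 \<le> r i (j - i)" by eventually_elim auto
  then show ?thesis unfolding matrix_law_def by (subst AE_distr_iff) auto
qed

lemma nn_integral_K_entry: "(\<integral>\<^sup>+P. ennreal (P i j) \<partial>K) = ennreal (pmf mean_pmf (j - i))"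
proof -
  have "(\<integral>\<^sup>+P. ennreal (P i j) \<partial>K) = (\<integral>\<^sup>+r. ennreal (r i (j - i)) \<partial>Pi\<^sub>M UNIV (\<lambda>_::int. dirichlet \<alpha>))"
    unfolding matrix_law_def by (subst nn_integral_distr) auto
  also have "\<dots> = (\<integral>\<^sup>+q. ennreal (q (j - i)) \<partial>dirichlet \<alpha>)"
    by (rule nn_integral_PiM_component[OF prob_space_dirichlet dirichlet_coordinate_measurable])
  finally show ?thesis by (simp add: nn_integral_dirichlet_component pmf_mean)
qed

text \<open>Within one row the mean of a product is \<open>(1 - s) p k * p l\<close>, plus \<open>s * p k\<close> if \<open>k = l\<close>, for
  \<open>s = 1 / (a + 1)\<close>; this is the place where the Dirichlet law enters the dynamics of the walkers.\<close>
lemma nn_integral_K_entry2: "(\<integral>\<^sup>+P. ennreal (P i j) * ennreal (P k l) \<partial>K) = ennreal (\<kappa> i k j l)"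
  and \<kappa>_nonneg: "0 \<le> \<kappa> i k j l"
proof -
  have rows: "(\<integral>\<^sup>+P. ennreal (P i j) * ennreal (P k l) \<partial>K)
      = (\<integral>\<^sup>+r. ennreal (r i (j - i)) * ennreal (r k (l - k)) \<partial>Pi\<^sub>M UNIV (\<lambda>_::int. dirichlet \<alpha>))"
    unfolding matrix_law_def by (subst nn_integral_distr) auto
  have "(\<integral>\<^sup>+r. ennreal (r i (j - i)) * ennreal (r k (l - k)) \<partial>Pi\<^sub>M UNIV (\<lambda>_::int. dirichlet \<alpha>)) = ennreal (\<kappa> i k j l)
      \<and> 0 \<le> \<kappa> i k j l"
  proof (cases "i = k")
    case True
    have \<kappa>: "\<kappa> i k j l = (\<alpha> (j - i) * \<alpha> (l - i) + (if j - i = l - i then \<alpha> (j - i) else 0)) / (a * (a + 1))"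
    proof -
      have "\<alpha> (j - i) / a * (\<alpha> (l - i) / a) + 1 / (a + 1) * (D * (\<alpha> (j - i) / a) - \<alpha> (j - i) / a * (\<alpha> (l - i) / a))
          = (\<alpha> (j - i) * \<alpha> (l - i) + D * \<alpha> (j - i)) / (a * (a + 1))" for D
        using total_pos by (simp add: divide_simps) (simp add: algebra_simps)
      from this[of "\<delta> (l - j)"] show ?thesis using True by (simp add: \<kappa>_def pmf_mean \<delta>_def)
    qed
    have "0 \<le> \<kappa> i k j l" unfolding \<kappa> using shape_nonneg total_pos by auto
    moreover have "(\<integral>\<^sup>+r. ennreal (r i (j - i)) * ennreal (r k (l - k)) \<partial>Pi\<^sub>M UNIV (\<lambda>_::int. dirichlet \<alpha>))
        = (\<integral>\<^sup>+q. ennreal (q (j - i)) * ennreal (q (l - i)) \<partial>dirichlet \<alpha>)"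
      unfolding True[symmetric]
      by (rule nn_integral_PiM_component[OF prob_space_dirichlet dirichlet_coordinate2_measurable])
    ultimately show ?thesis unfolding \<kappa> nn_integral_dirichlet_component2 by simp
  next
    case False
    have "(\<integral>\<^sup>+r. ennreal (r i (j - i)) * ennreal (r k (l - k)) \<partial>Pi\<^sub>M UNIV (\<lambda>_::int. dirichlet \<alpha>))
        = (\<integral>\<^sup>+q. ennreal (q (j - i)) \<partial>dirichlet \<alpha>) * (\<integral>\<^sup>+q. ennreal (q (l - k)) \<partial>dirichlet \<alpha>)"
      by (rule nn_integral_PiM_component2[OF prob_space_dirichlet False
            dirichlet_coordinate_measurable dirichlet_coordinate_measurable])
    then show ?thesis
      using False by (simp add: nn_integral_dirichlet_component \<kappa>_def \<delta>_def pmf_mean[symmetric] ennreal_mult[symmetric])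
  qed
  then show "(\<integral>\<^sup>+P. ennreal (P i j) * ennreal (P k l) \<partial>K) = ennreal (\<kappa> i k j l)" "0 \<le> \<kappa> i k j l"
    by (auto simp: rows)
qed

text \<open>Bounded means make all products with a random matrix finite almost surely, and they survive a step
  because the mean entries of a column sum to 1.\<close>
definition admissible :: "((int \<Rightarrow> real) \<times> (int \<Rightarrow> real)) measure \<Rightarrow> bool" where
  "admissible \<nu> \<longleftrightarrow> prob_space \<nu> \<and> sets \<nu> = sets pair_space \<and>
     (\<forall>h\<in>{fst, snd}. (AE z in \<nu>. \<forall>i. 0 \<le> h z i) \<and> (\<exists>B<\<infinity>. \<forall>i. (\<integral>\<^sup>+z. ennreal (h z i) \<partial>\<nu>) \<le> B))"

text \<open>The common matrix couples the two sequences, while each of them alone follows the dynamics.\<close>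
definition pair_step :: "((int \<Rightarrow> real) \<times> (int \<Rightarrow> real)) measure \<Rightarrow> ((int \<Rightarrow> real) \<times> (int \<Rightarrow> real)) measure" where
  "pair_step \<nu> = distr (\<nu> \<Otimes>\<^sub>M K) pair_space (\<lambda>w. (row_mult (fst (fst w)) (snd w), row_mult (snd (fst w)) (snd w)))"

definition corr where
  "corr \<nu> h h' c \<longleftrightarrow> (\<forall>i j. (\<integral>\<^sup>+z. ennreal (h z i) * ennreal (h' z j) \<partial>\<nu>) = ennreal (c (j - i)))"
    for h h' :: "(int \<Rightarrow> real) \<times> (int \<Rightarrow> real) \<Rightarrow> int \<Rightarrow> real" and c :: "int \<Rightarrow> real"

lemma measurable_fst_snd:
  "h \<in> {fst, snd} \<Longrightarrow> h \<in> pair_space \<rightarrow>\<^sub>M seq_space"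
  by auto

lemma pair_coordinate_measurable:
  "h \<in> {fst, snd} \<Longrightarrow> (\<lambda>z. h z i) \<in> borel_measurable pair_space"
  by (rule measurable_compose[OF measurable_fst_snd measurable_component_singleton]) simp_all

lemma admissible_sets_pair: "admissible \<nu> \<Longrightarrow> sets (\<nu> \<Otimes>\<^sub>M K) = sets (pair_space \<Otimes>\<^sub>M matrix_space)"
  by (intro sets_pair_measure_cong) (auto simp: admissible_def)

lemma admissible_coordinate_measurable:
  assumes "admissible \<nu>" "h \<in> {fst, snd}"
  shows "(\<lambda>z. h z i) \<in> borel_measurable \<nu>" "(\<lambda>w. h (fst w) i) \<in> borel_measurable (\<nu> \<Otimes>\<^sub>M K)"
    "(\<lambda>w. snd w i j) \<in> borel_measurable (\<nu> \<Otimes>\<^sub>M K)"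
proof -
  note 1 = pair_coordinate_measurable[OF assms(2)]
  have \<nu>: "sets \<nu> = sets pair_space" using assms(1) by (simp add: admissible_def)
  show "(\<lambda>z. h z i) \<in> borel_measurable \<nu>"
    using 1 by (simp only: measurable_cong_sets[OF \<nu> refl])
  then show "(\<lambda>w. h (fst w) i) \<in> borel_measurable (\<nu> \<Otimes>\<^sub>M K)"
    by (rule measurable_compose[OF measurable_fst])
  show "(\<lambda>w. snd w i j) \<in> borel_measurable (\<nu> \<Otimes>\<^sub>M K)"
    by (simp only: measurable_cong_sets[OF admissible_sets_pair[OF assms(1)] refl] measurable_entry_snd)
qed

lemma admissible_ennreal_measurable:
  assumes "admissible \<nu>" "h \<in> {fst, snd}"
  shows "(\<lambda>z. ennreal (h z i)) \<in> borel_measurable \<nu>"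
    "(\<lambda>w. ennreal (h (fst w) i)) \<in> borel_measurable (\<nu> \<Otimes>\<^sub>M K)"
    "(\<lambda>w. ennreal (snd w i j)) \<in> borel_measurable (\<nu> \<Otimes>\<^sub>M K)"
  by (rule measurable_compose[OF admissible_coordinate_measurable(1)[OF assms] measurable_ennreal]
      measurable_compose[OF admissible_coordinate_measurable(2)[OF assms] measurable_ennreal]
      measurable_compose[OF admissible_coordinate_measurable(3)[OF assms] measurable_ennreal])+

lemma K_entry_measurable: "(\<lambda>P. ennreal (P i j)) \<in> borel_measurable K"
  unfolding measurable_cong_sets[OF sets_matrix_law refl]
  by (rule measurable_compose[OF measurable_entry_at measurable_ennreal])

lemma admissible_prob: "admissible \<nu> \<Longrightarrow> prob_space \<nu>" by (simp add: admissible_def)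

text \<open>By Tonelli the mean of a column sum is an average of the means of the entries. So the sum of
  nonnegative terms is finite almost surely, and its real value agrees with the sum in \<open>[0, \<infinity>]\<close>.\<close>
lemma admissible_row_mult:
  assumes g: "admissible \<nu>" and h: "h \<in> {fst, snd}"
  shows admissible_row_mult_AE: "AE w in \<nu> \<Otimes>\<^sub>M K. row_mult_defined (h (fst w)) (snd w) \<and>
      (\<forall>j. ennreal (row_mult (h (fst w)) (snd w) j) = (\<integral>\<^sup>+i. ennreal (h (fst w) i) * ennreal (snd w i j) \<partial>count_space UNIV)
         \<and> 0 \<le> row_mult (h (fst w)) (snd w) j)" (is ?AE)
    and admissible_row_mult_mean: "\<exists>B<\<infinity>. \<forall>j. (\<integral>\<^sup>+w. ennreal (row_mult (h (fst w)) (snd w) j) \<partial>(\<nu> \<Otimes>\<^sub>M K)) \<le> B" (is ?mean)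
proof -
  interpret \<nu>: prob_space \<nu> using g by (rule admissible_prob)
  interpret K: prob_space K by (rule prob_space_matrix_law)
  interpret \<nu>K: pair_prob_space \<nu> K ..
  note m = admissible_ennreal_measurable[OF g h]
  obtain B where B: "B < \<infinity>" "\<And>i. (\<integral>\<^sup>+z. ennreal (h z i) \<partial>\<nu>) \<le> B" using g h unfolding admissible_def by blast
  have mean: "(\<integral>\<^sup>+w. (\<integral>\<^sup>+i. ennreal (h (fst w) i) * ennreal (snd w i j) \<partial>count_space UNIV) \<partial>(\<nu> \<Otimes>\<^sub>M K)) \<le> B" for j
  proof -
    have "(\<integral>\<^sup>+w. (\<integral>\<^sup>+i. ennreal (h (fst w) i) * ennreal (snd w i j) \<partial>count_space UNIV) \<partial>(\<nu> \<Otimes>\<^sub>M K))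
        = (\<integral>\<^sup>+i. (\<integral>\<^sup>+w. ennreal (h (fst w) i) * ennreal (snd w i j) \<partial>(\<nu> \<Otimes>\<^sub>M K)) \<partial>count_space UNIV)"
      by (rule nn_integral_count_space_Fubini) (unfold_locales, intro borel_measurable_times_ennreal m)
    also have "\<dots> = (\<integral>\<^sup>+i. (\<integral>\<^sup>+z. ennreal (h z i) \<partial>\<nu>) * ennreal (pmf mean_pmf (j - i)) \<partial>count_space UNIV)"
    proof (intro nn_integral_cong)
      fix i
      from nn_integral_pair_mult[OF \<nu>.prob_space_axioms K.prob_space_axioms m(1) K_entry_measurable]
      show "(\<integral>\<^sup>+w. ennreal (h (fst w) i) * ennreal (snd w i j) \<partial>(\<nu> \<Otimes>\<^sub>M K)) = (\<integral>\<^sup>+z. ennreal (h z i) \<partial>\<nu>) * ennreal (pmf mean_pmf (j - i))"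
        by (simp add: nn_integral_K_entry)
    qed
    also have "\<dots> \<le> (\<integral>\<^sup>+i. B * ennreal (pmf mean_pmf (j - i)) \<partial>count_space UNIV)"
      using B by (intro nn_integral_mono mult_right_mono) auto
    also have "\<dots> = B * (\<integral>\<^sup>+i. ennreal (pmf mean_pmf i) \<partial>count_space UNIV)"
      using nn_integral_count_space_reflect[of "\<lambda>i. ennreal (pmf mean_pmf i)" j] by (simp add: nn_integral_cmult)
    also have "(\<integral>\<^sup>+i. ennreal (pmf mean_pmf i) \<partial>count_space UNIV) = 1"
      using nn_integral_pmf[where p=mean_pmf and A=UNIV] measure_pmf.emeasure_space_1[of mean_pmf] by simp
    finally show ?thesis by simp
  qed
  have fin: "AE w in \<nu> \<Otimes>\<^sub>M K. \<forall>j. (\<integral>\<^sup>+i. ennreal (h (fst w) i) * ennreal (snd w i j) \<partial>count_space UNIV) \<noteq> \<infinity>"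
    unfolding AE_all_countable
  proof
    fix j
    show "AE w in \<nu> \<Otimes>\<^sub>M K. (\<integral>\<^sup>+i. ennreal (h (fst w) i) * ennreal (snd w i j) \<partial>count_space UNIV) \<noteq> \<infinity>"
    proof (rule nn_integral_PInf_AE)
      show "(\<integral>\<^sup>+w. (\<integral>\<^sup>+i. ennreal (h (fst w) i) * ennreal (snd w i j) \<partial>count_space UNIV) \<partial>(\<nu> \<Otimes>\<^sub>M K)) \<noteq> \<infinity>"
        using mean[of j] B(1) by (auto simp: top_unique)
    qed (intro nn_integral_count_space_measurable borel_measurable_times_ennreal m)
  qed
  have nn: "AE z in \<nu>. \<forall>i. 0 \<le> h z i" using g h unfolding admissible_def by blast
  show ?AE
    using fin AE_pair_fst[OF \<nu>.prob_space_axioms K.prob_space_axioms nn]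
      AE_pair_snd[OF \<nu>.prob_space_axioms K.prob_space_axioms AE_K_nonneg]
  proof eventually_elim
    case (elim w)
    then have "\<And>i. 0 \<le> h (fst w) i" "\<And>i j. 0 \<le> snd w i j"
        "\<And>j. (\<integral>\<^sup>+i. ennreal (h (fst w) i) * ennreal (snd w i j) \<partial>count_space UNIV) < \<infinity>"
      by (auto simp: less_top)
    from row_mult_eq_nn_integral[of "h (fst w)" "snd w", OF this] show ?case by blast
  qed
  note ae = this
  have "(\<integral>\<^sup>+w. ennreal (row_mult (h (fst w)) (snd w) j) \<partial>(\<nu> \<Otimes>\<^sub>M K))
      = (\<integral>\<^sup>+w. (\<integral>\<^sup>+i. ennreal (h (fst w) i) * ennreal (snd w i j) \<partial>count_space UNIV) \<partial>(\<nu> \<Otimes>\<^sub>M K))" for j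
  proof (rule nn_integral_cong_AE)
    show "AE w in \<nu> \<Otimes>\<^sub>M K. ennreal (row_mult (h (fst w)) (snd w) j)
      = (\<integral>\<^sup>+i. ennreal (h (fst w) i) * ennreal (snd w i j) \<partial>count_space UNIV)"
      using ae by eventually_elim blast
  qed
  with mean B(1) show ?mean by auto
qed

lemma pair_step_measurable:
  assumes g: "admissible \<nu>"
  shows "(\<lambda>w. (row_mult (fst (fst w)) (snd w), row_mult (snd (fst w)) (snd w))) \<in> \<nu> \<Otimes>\<^sub>M K \<rightarrow>\<^sub>M pair_space"
  unfolding measurable_cong_sets[OF admissible_sets_pair[OF g] refl] by measurable

lemma pair_step_coordinate:
  "h \<in> {fst, snd} \<Longrightarrow> h (row_mult (fst (fst w)) (snd w), row_mult (snd (fst w)) (snd w)) = row_mult (h (fst w)) (snd w)"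
  by auto

lemma admissible_pair_step:
  assumes g: "admissible \<nu>"
  shows "admissible (pair_step \<nu>)"
  unfolding admissible_def
proof (intro conjI ballI)
  interpret \<nu>: prob_space \<nu> using g by (rule admissible_prob)
  interpret K: prob_space K by (rule prob_space_matrix_law)
  interpret \<nu>K: pair_prob_space \<nu> K ..
  show "prob_space (pair_step \<nu>)" unfolding pair_step_def by (rule \<nu>K.prob_space_distr) (rule pair_step_measurable[OF g])
  show "sets (pair_step \<nu>) = sets pair_space" by (simp add: pair_step_def)
  fix h :: "(int \<Rightarrow> real) \<times> (int \<Rightarrow> real) \<Rightarrow> int \<Rightarrow> real" assume h: "h \<in> {fst, snd}"
  have hm: "(\<lambda>z. ennreal (h z i)) \<in> borel_measurable pair_space" for i
    by (rule measurable_compose[OF pair_coordinate_measurable[OF h] measurable_ennreal])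
  have "{z \<in> space pair_space. \<forall>i. 0 \<le> fst z i} \<in> sets pair_space"
    "{z \<in> space pair_space. \<forall>i. 0 \<le> snd z i} \<in> sets pair_space" by measurable
  with h have sets: "{z \<in> space pair_space. \<forall>i. 0 \<le> h z i} \<in> sets pair_space" by blast
  show "AE z in pair_step \<nu>. \<forall>i. 0 \<le> h z i"
    unfolding pair_step_def AE_distr_iff[OF pair_step_measurable[OF g] sets] pair_step_coordinate[OF h]
    using admissible_row_mult_AE[OF g h] by eventually_elim blast
  have "(\<integral>\<^sup>+z. ennreal (h z i) \<partial>pair_step \<nu>) = (\<integral>\<^sup>+w. ennreal (row_mult (h (fst w)) (snd w) i) \<partial>(\<nu> \<Otimes>\<^sub>M K))" for i
    unfolding pair_step_def
    by (subst nn_integral_distr[OF pair_step_measurable[OF g]])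
      (simp_all only: measurable_distr_eq1 hm pair_step_coordinate[OF h])
  then show "\<exists>B<\<infinity>. \<forall>i. (\<integral>\<^sup>+z. ennreal (h z i) \<partial>pair_step \<nu>) \<le> B"
    using admissible_row_mult_mean[OF g h] by simp
qed

text \<open>The matrix is independent of the pair, so the mean of a product of two column sums is a double sum of
  correlations against the mean products \<open>\<kappa>\<close>.\<close>
lemma corr_pair_step:
  assumes g: "admissible \<nu>" and h: "h \<in> {fst, snd}" and h': "h' \<in> {fst, snd}"
    and c: "\<And>d. 0 \<le> c d" "\<And>d. c d \<le> C" and corr: "corr \<nu> h h' c"
  shows "corr (pair_step \<nu>) h h' (corr_op c)" and "0 \<le> corr_op c d"
proof -
  interpret \<nu>: prob_space \<nu> using g by (rule admissible_prob)
  interpret K: prob_space K by (rule prob_space_matrix_law)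
  interpret \<nu>K: pair_prob_space \<nu> K ..
  note m = admissible_ennreal_measurable[OF g h] and m' = admissible_ennreal_measurable[OF g h']
  have "(\<integral>\<^sup>+z. ennreal (h z j) * ennreal (h' z j') \<partial>pair_step \<nu>) = ennreal (corr_op c (j' - j)) \<and> 0 \<le> corr_op c (j' - j)" for j j'
  proof -
    have hm: "(\<lambda>z. ennreal (h z j) * ennreal (h' z j')) \<in> borel_measurable pair_space"
      by (intro borel_measurable_times_ennreal measurable_compose[OF pair_coordinate_measurable[OF h] measurable_ennreal]
          measurable_compose[OF pair_coordinate_measurable[OF h'] measurable_ennreal])
    have "(\<integral>\<^sup>+z. ennreal (h z j) * ennreal (h' z j') \<partial>pair_step \<nu>)
      = (\<integral>\<^sup>+w. ennreal (row_mult (h (fst w)) (snd w) j) * ennreal (row_mult (h' (fst w)) (snd w) j') \<partial>(\<nu> \<Otimes>\<^sub>M K))"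
      unfolding pair_step_def
      by (subst nn_integral_distr[OF pair_step_measurable[OF g]])
        (simp_all only: measurable_distr_eq1 hm pair_step_coordinate[OF h] pair_step_coordinate[OF h'])
    also have "\<dots> = (\<integral>\<^sup>+w. (\<integral>\<^sup>+i. ennreal (h (fst w) i) * ennreal (snd w i j) \<partial>count_space UNIV)
        * (\<integral>\<^sup>+k. ennreal (h' (fst w) k) * ennreal (snd w k j') \<partial>count_space UNIV) \<partial>(\<nu> \<Otimes>\<^sub>M K))"
    proof (rule nn_integral_cong_AE)
      show "AE w in \<nu> \<Otimes>\<^sub>M K. ennreal (row_mult (h (fst w)) (snd w) j) * ennreal (row_mult (h' (fst w)) (snd w) j')
        = (\<integral>\<^sup>+i. ennreal (h (fst w) i) * ennreal (snd w i j) \<partial>count_space UNIV)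
        * (\<integral>\<^sup>+k. ennreal (h' (fst w) k) * ennreal (snd w k j') \<partial>count_space UNIV)"
        using admissible_row_mult_AE[OF g h] admissible_row_mult_AE[OF g h'] by eventually_elim simp
    qed
    also have "\<dots> = (\<integral>\<^sup>+w. dsum (\<lambda>i k. (ennreal (h (fst w) i) * ennreal (h' (fst w) k)) * (ennreal (snd w i j) * ennreal (snd w k j'))) \<partial>(\<nu> \<Otimes>\<^sub>M K))"
    proof (intro nn_integral_cong)
      fix w
      show "(\<integral>\<^sup>+i. ennreal (h (fst w) i) * ennreal (snd w i j) \<partial>count_space UNIV)
        * (\<integral>\<^sup>+k. ennreal (h' (fst w) k) * ennreal (snd w k j') \<partial>count_space UNIV)
        = dsum (\<lambda>i k. (ennreal (h (fst w) i) * ennreal (h' (fst w) k)) * (ennreal (snd w i j) * ennreal (snd w k j')))"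
        by (subst nn_integral_multc[symmetric], simp, subst nn_integral_cmult[symmetric])
          (auto intro!: nn_integral_cong simp: mult_ac)
    qed
    also have "\<dots> = dsum (\<lambda>i k. \<integral>\<^sup>+w. (ennreal (h (fst w) i) * ennreal (h' (fst w) k)) * (ennreal (snd w i j) * ennreal (snd w k j')) \<partial>(\<nu> \<Otimes>\<^sub>M K))"
    proof -
      have "(\<integral>\<^sup>+w. dsum (\<lambda>i k. (ennreal (h (fst w) i) * ennreal (h' (fst w) k)) * (ennreal (snd w i j) * ennreal (snd w k j'))) \<partial>(\<nu> \<Otimes>\<^sub>M K))
        = (\<integral>\<^sup>+i. (\<integral>\<^sup>+w. (\<integral>\<^sup>+k. (ennreal (h (fst w) i) * ennreal (h' (fst w) k)) * (ennreal (snd w i j) * ennreal (snd w k j')) \<partial>count_space UNIV) \<partial>(\<nu> \<Otimes>\<^sub>M K)) \<partial>count_space UNIV)"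
        by (rule nn_integral_count_space_Fubini)
          (unfold_locales, intro nn_integral_count_space_measurable borel_measurable_times_ennreal m m')
      also have "\<dots> = dsum (\<lambda>i k. \<integral>\<^sup>+w. (ennreal (h (fst w) i) * ennreal (h' (fst w) k)) * (ennreal (snd w i j) * ennreal (snd w k j')) \<partial>(\<nu> \<Otimes>\<^sub>M K))"
        by (intro nn_integral_cong nn_integral_count_space_Fubini)
          (unfold_locales, intro borel_measurable_times_ennreal m m')
      finally show ?thesis .
    qed
    also have "\<dots> = dsum (\<lambda>i k. ennreal (c (k - i)) * ennreal (\<kappa> i k j j'))"
    proof (intro nn_integral_cong)
      fix i k
      from nn_integral_pair_mult[OF \<nu>.prob_space_axioms K.prob_space_axioms
          borel_measurable_times_ennreal[OF m(1) m'(1)] borel_measurable_times_ennreal[OF K_entry_measurable K_entry_measurable]]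
      show "(\<integral>\<^sup>+w. (ennreal (h (fst w) i) * ennreal (h' (fst w) k)) * (ennreal (snd w i j) * ennreal (snd w k j')) \<partial>(\<nu> \<Otimes>\<^sub>M K))
        = ennreal (c (k - i)) * ennreal (\<kappa> i k j j')"
        using corr by (simp add: nn_integral_K_entry2 corr_def)
    qed
    finally show ?thesis using dsum_\<kappa>[of c C, OF c \<kappa>_nonneg] by simp
  qed
  note * = this
  show "corr (pair_step \<nu>) h h' (corr_op c)" using * by (simp add: corr_def)
  show "0 \<le> corr_op c d" using *[of 0 d] by simp
qed

lemma corr_pair_step_pow:
  assumes g: "admissible \<nu>" and h: "h \<in> {fst, snd}" and h': "h' \<in> {fst, snd}"
    and c: "\<And>d. 0 \<le> c d" "\<And>d. c d \<le> C" and corr: "corr \<nu> h h' c"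
  shows "admissible ((pair_step ^^ n) \<nu>) \<and> corr ((pair_step ^^ n) \<nu>) h h' ((corr_op ^^ n) c) \<and> (\<forall>d. 0 \<le> (corr_op ^^ n) c d)"
proof (induction n)
  case 0 then show ?case using assms by simp
next
  case (Suc n)
  have "\<bar>c d\<bar> \<le> C" for d using c[of d] by simp
  then obtain C' where C': "\<And>d. \<bar>(corr_op ^^ n) c d\<bar> \<le> C'" using corr_op_pow_bounded[of c C n] by auto
  have C2: "(corr_op ^^ n) c d \<le> C'" for d using C'[of d] by simp
  from Suc have "admissible ((pair_step ^^ n) \<nu>)" "corr ((pair_step ^^ n) \<nu>) h h' ((corr_op ^^ n) c)" "\<And>d. 0 \<le> (corr_op ^^ n) c d" by auto
  from admissible_pair_step[OF this(1)] corr_pair_step[OF this(1) h h' this(3) C2 this(2)] show ?case by simp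
qed

text \<open>The mean of \<open>(X - Y)\<^sup>2\<close> is a combination of three correlations, which all evolve under the same
  linear operator. So only the initial value of the combination matters, and this is a multiple of
  \<open>\<delta>\<close>.\<close>
lemma L2_distance_pair_step_pow:
  assumes g: "admissible \<nu>" and v: "0 \<le> v"
    and b: "\<And>d. 0 \<le> b d" "\<And>d. b d \<le> C1" "corr \<nu> fst fst b"
    and c: "\<And>d. 0 \<le> c d" "\<And>d. c d \<le> C2" "corr \<nu> fst snd c"
    and e: "\<And>d. 0 \<le> e d" "\<And>d. e d \<le> C3" "corr \<nu> snd snd e"
    and eq: "\<And>d. b d - 2 * c d + e d = v * \<delta> d"
  shows "(\<integral>\<^sup>+z. ennreal ((fst z i - snd z i)\<^sup>2) \<partial>(pair_step ^^ n) \<nu>) = ennreal (v * ret n)"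
proof -
  let ?\<nu> = "(pair_step ^^ n) \<nu>"
  have B: "admissible ?\<nu>" "corr ?\<nu> fst fst ((corr_op ^^ n) b)" "0 \<le> (corr_op ^^ n) b 0"
    using corr_pair_step_pow[OF g _ _ b, of n] by auto
  have Cc: "corr ?\<nu> fst snd ((corr_op ^^ n) c)" "0 \<le> (corr_op ^^ n) c 0" using corr_pair_step_pow[OF g _ _ c, of n] by auto
  have E: "corr ?\<nu> snd snd ((corr_op ^^ n) e)" "0 \<le> (corr_op ^^ n) e 0" using corr_pair_step_pow[OF g _ _ e, of n] by auto
  have comb: "(corr_op ^^ n) b 0 - 2 * (corr_op ^^ n) c 0 + (corr_op ^^ n) e 0 = v * ret n"
    unfolding ret_def
  proof (rule corr_op_pow_combination)
    show "\<bar>b d\<bar> \<le> C1" "\<bar>c d\<bar> \<le> C2" "\<bar>e d\<bar> \<le> C3" for d using b c e by simp_all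
  qed (rule eq)
  have [measurable_cong]: "sets ?\<nu> = sets pair_space" using B(1) by (simp add: admissible_def)
  let ?I = "\<integral>\<^sup>+z. ennreal ((fst z i - snd z i)\<^sup>2) \<partial>?\<nu>"
  have nn: "AE z in ?\<nu>. \<forall>i. 0 \<le> fst z i" "AE z in ?\<nu>. \<forall>i. 0 \<le> snd z i" using B(1) by (auto simp: admissible_def)
  have "?I + 2 * (\<integral>\<^sup>+z. ennreal (fst z i) * ennreal (snd z i) \<partial>?\<nu>)
      = (\<integral>\<^sup>+z. ennreal ((fst z i - snd z i)\<^sup>2) + 2 * (ennreal (fst z i) * ennreal (snd z i)) \<partial>?\<nu>)"
    by (simp add: nn_integral_add nn_integral_cmult)
  also have "\<dots> = (\<integral>\<^sup>+z. ennreal (fst z i) * ennreal (fst z i) + ennreal (snd z i) * ennreal (snd z i) \<partial>?\<nu>)"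
  proof (rule nn_integral_cong_AE)
    show "AE z in ?\<nu>. ennreal ((fst z i - snd z i)\<^sup>2) + 2 * (ennreal (fst z i) * ennreal (snd z i))
        = ennreal (fst z i) * ennreal (fst z i) + ennreal (snd z i) * ennreal (snd z i)"
      using nn
    proof eventually_elim
      case (elim z)
      have "ennreal ((fst z i - snd z i)\<^sup>2) + 2 * (ennreal (fst z i) * ennreal (snd z i))
          = ennreal ((fst z i - snd z i)\<^sup>2 + 2 * (fst z i * snd z i))"
        using elim by (simp add: ennreal_mult)
      also have "(fst z i - snd z i)\<^sup>2 + 2 * (fst z i * snd z i) = fst z i * fst z i + snd z i * snd z i"
        by (simp add: power2_eq_square algebra_simps)
      finally show ?case using elim by (simp add: ennreal_mult)
    qed
  qed
  also have "\<dots> = (\<integral>\<^sup>+z. ennreal (fst z i) * ennreal (fst z i) \<partial>?\<nu>) + (\<integral>\<^sup>+z. ennreal (snd z i) * ennreal (snd z i) \<partial>?\<nu>)"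
    by (rule nn_integral_add) measurable
  finally have "?I + ennreal (2 * (corr_op ^^ n) c 0) = ennreal ((corr_op ^^ n) b 0 + (corr_op ^^ n) e 0)"
    using B(2) Cc E B(3) by (simp add: corr_def ennreal_mult)
  then have "?I = ennreal ((corr_op ^^ n) b 0 + (corr_op ^^ n) e 0 - 2 * (corr_op ^^ n) c 0)"
    using ennreal_add_eq_imp_diff[of ?I "2 * (corr_op ^^ n) c 0" "(corr_op ^^ n) b 0 + (corr_op ^^ n) e 0"] B(3) Cc(2) E(2) by simp
  also have "(corr_op ^^ n) b 0 + (corr_op ^^ n) e 0 - 2 * (corr_op ^^ n) c 0 = v * ret n" using comb by simp
  finally show ?thesis .
qed

end

section \<open>Weak convergence of finite-dimensional laws\<close>

lemma continuous_on_restrict_compose: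
  fixes f :: "(int \<Rightarrow> real) \<Rightarrow> real"
  assumes "continuous_map (product_topology (\<lambda>_. euclideanreal) J) euclideanreal f"
  shows "continuous_on UNIV (\<lambda>x. f (restrict x J))"
proof -
  have "continuous_map euclidean (product_topology (\<lambda>_. euclideanreal) J) (\<lambda>x :: int \<Rightarrow> real. restrict x J)"
    unfolding continuous_map_componentwise by (auto intro!: continuous_intros)
  from continuous_map_compose[OF this assms] show ?thesis by (simp add: comp_def)
qed

lemma compact_box:
  fixes R :: "int \<Rightarrow> real"
  shows "compact {x. \<forall>i. \<bar>x i\<bar> \<le> R i}"
proof -
  have "compactin (product_topology (\<lambda>_. euclideanreal) UNIV) (\<Pi>\<^sub>E i\<in>UNIV. {- R i..R i})"
    by (subst compactin_PiE) auto
  moreover have "(\<Pi>\<^sub>E i\<in>UNIV. {- R i..R i}) = {x. \<forall>i. \<bar>x i\<bar> \<le> R i}"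
    by (auto simp: PiE_iff abs_le_iff minus_le_iff)
  ultimately show ?thesis by (simp add: euclidean_product_topology)
qed

lemma dist_fun_less:
  fixes x y :: "int \<Rightarrow> real"
  assumes "0 < d" "\<And>i. \<bar>x i - y i\<bar> \<le> d / 4"
  shows "dist x y < d"
proof -
  obtain N where N: "(1 / 2) ^ N < d / 2"
    using assms(1) real_arch_pow_inv[of "d / 2" "1 / 2"] by auto
  have "Max {dist (x (from_nat n)) (y (from_nat n)) |n. n \<le> N} \<le> d / 4"
  proof (rule Max.boundedI)
    fix z assume "z \<in> {dist (x (from_nat n)) (y (from_nat n)) |n. n \<le> N}"
    then obtain n where "z = \<bar>x (from_nat n) - y (from_nat n)\<bar>" by (auto simp: dist_real_def)
    then show "z \<le> d / 4" using assms(2) by simp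
  qed auto
  then show ?thesis using dist_fun_le_dist_first_terms[of x y N] N by linarith
qed

text \<open>Coordinates outside \<open>J\<close> do not influence \<open>g\<close> and may be set to 0. This moves the arguments into a
  box of sequences, which is compact in the product topology.\<close>
lemma uniformly_continuous_cylinder:
  fixes g :: "(int \<Rightarrow> real) \<Rightarrow> real"
  assumes g: "continuous_on UNIV g" and J: "\<And>x y. (\<And>i. i \<in> J \<Longrightarrow> x i = y i) \<Longrightarrow> g x = g y"
    and "0 < e" "0 \<le> R"
  obtains d where "0 < d" "\<And>x y. (\<And>i. i \<in> J \<Longrightarrow> \<bar>y i\<bar> \<le> R) \<Longrightarrow> (\<And>i. i \<in> J \<Longrightarrow> \<bar>x i - y i\<bar> \<le> d) \<Longrightarrow> \<bar>g x - g y\<bar> < e"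
proof -
  define b where "b i = (if i \<in> J then R + 1 else 0)" for i :: int
  define C where "C = {x. \<forall>i. \<bar>x i\<bar> \<le> b i}"
  have "uniformly_continuous_on C g"
    unfolding C_def by (rule compact_uniformly_continuous[OF continuous_on_subset[OF g] compact_box]) simp
  then obtain d where d: "0 < d" "\<And>x y. x \<in> C \<Longrightarrow> y \<in> C \<Longrightarrow> dist y x < d \<Longrightarrow> dist (g y) (g x) < e"
    using \<open>0 < e\<close> unfolding uniformly_continuous_on_def by metis
  show thesis
  proof
    show "0 < min 1 (d / 4)" using d(1) by simp
    fix x y :: "int \<Rightarrow> real"
    assume y: "\<And>i. i \<in> J \<Longrightarrow> \<bar>y i\<bar> \<le> R" and xy: "\<And>i. i \<in> J \<Longrightarrow> \<bar>x i - y i\<bar> \<le> min 1 (d / 4)"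
    define cut where "cut z = (\<lambda>i. if i \<in> J then z i else (0 :: real))" for z :: "int \<Rightarrow> real"
    have "cut x \<in> C" unfolding C_def
    proof (intro CollectI allI)
      fix i show "\<bar>cut x i\<bar> \<le> b i" using y[of i] xy[of i] by (auto simp: cut_def b_def)
    qed
    moreover have "cut y \<in> C" unfolding C_def
    proof (intro CollectI allI)
      fix i show "\<bar>cut y i\<bar> \<le> b i" using y[of i] by (auto simp: cut_def b_def)
    qed
    moreover have "dist (cut x) (cut y) < d"
    proof (rule dist_fun_less[OF d(1)])
      fix i show "\<bar>cut x i - cut y i\<bar> \<le> d / 4" using xy[of i] d(1) by (auto simp: cut_def)
    qed
    ultimately have "dist (g (cut x)) (g (cut y)) < e" by (intro d(2))
    moreover have "g (cut x) = g x" "g (cut y) = g y" by (auto intro!: J simp: cut_def)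
    ultimately show "\<bar>g x - g y\<bar> < e" by (simp add: dist_real_def)
  qed
qed

lemma cylinder_measurable:
  fixes g :: "(int \<Rightarrow> real) \<Rightarrow> real"
  assumes "continuous_on UNIV g"
  shows "g \<in> borel_measurable seq_space"
  using borel_measurable_continuous_onI[OF assms]
  by (simp only: measurable_cong_sets[OF sets_PiM_equal_borel refl])

text \<open>The second marginal is the same for all \<open>n\<close>, so up to a small probability its coordinates in \<open>J\<close> stay
  in a fixed cube, where the test function is uniformly continuous. The probability that the two
  sequences are far apart in one of these coordinates is controlled by the mean squared distance.\<close>
lemma weak_conv_fdd_if_L2_close:
  fixes \<nu> :: "nat \<Rightarrow> ((int \<Rightarrow> real) \<times> (int \<Rightarrow> real)) measure"
  assumes \<nu>: "\<And>n. prob_space (\<nu> n)" "\<And>n. sets (\<nu> n) = sets (seq_space \<Otimes>\<^sub>M seq_space)"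
    and N: "\<And>n. distr (\<nu> n) seq_space fst = N n" and L: "\<And>n. distr (\<nu> n) seq_space snd = L"
    and L2: "\<And>i. (\<lambda>n. \<integral>\<^sup>+z. ennreal ((fst z i - snd z i)\<^sup>2) \<partial>\<nu> n) \<longlonglongrightarrow> 0"
  shows "weak_conv_fdd N L"
  unfolding weak_conv_fdd_def
proof (intro allI impI, elim conjE)
  fix J and f :: "(int \<Rightarrow> real) \<Rightarrow> real"
  assume J: "finite J" and cont: "continuous_map (product_topology (\<lambda>_. euclideanreal) J) euclideanreal f"
    and bdd: "bounded (f ` (J \<rightarrow>\<^sub>E UNIV))"
  define g where "g x = f (restrict x J)" for x
  have gc: "continuous_on UNIV g" unfolding g_def[abs_def] by (rule continuous_on_restrict_compose[OF cont])
  have gm: "g \<in> borel_measurable seq_space" by (rule cylinder_measurable[OF gc])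
  have gJ: "g x = g y" if "\<And>i. i \<in> J \<Longrightarrow> x i = y i" for x y
    unfolding g_def using that by (metis restrict_ext)
  obtain B0 where B0: "\<And>x. x \<in> J \<rightarrow>\<^sub>E UNIV \<Longrightarrow> \<bar>f x\<bar> \<le> B0"
    using bdd unfolding bounded_iff by auto
  define B where "B = max B0 1"
  have B: "\<bar>g x\<bar> \<le> B" "1 \<le> B" for x using B0[of "restrict x J"] by (auto simp: g_def B_def)
  have fm: "fst \<in> \<nu> n \<rightarrow>\<^sub>M seq_space" "snd \<in> \<nu> n \<rightarrow>\<^sub>M seq_space" for n
    unfolding measurable_cong_sets[OF \<nu>(2) refl] by (rule measurable_fst measurable_snd)+
  interpret L: prob_space L using prob_space.prob_space_distr[OF \<nu>(1) fm(2), of 0] by (simp add: L)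
  have Lsets: "sets L = sets seq_space" using L[of 0, symmetric] by simp
  have Lspace: "space L = UNIV" using sets_eq_imp_space_eq[OF Lsets] by (simp add: space_PiM)
  have "(\<lambda>n. (\<integral>x. g x \<partial>N n) - (\<integral>x. g x \<partial>L)) \<longlonglongrightarrow> 0"
  proof (rule tendstoI)
    fix e :: real assume e: "0 < e"
    \<comment> \<open>a quarter of \<open>e\<close> is spent on the modulus of continuity and a quarter, \<open>2 B e'\<close>, on leaving the cube;
      the mean squared distance takes the rest for large \<open>n\<close>\<close>
    define e' where "e' = e / (8 * B)"
    have e': "0 < e'" "2 * B * e' = e / 4" using e B(2) by (auto simp: e'_def)
    obtain R :: nat where R: "measure L {x. \<exists>i\<in>J. real R < \<bar>x i\<bar>} < e'"
    proof -
      define D where "D m = {x. \<exists>i\<in>J. real m < \<bar>x i\<bar>}" for m :: nat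
      have Dm: "D m \<in> sets L" for m
      proof -
        have "D m = (\<Union>i\<in>J. {x \<in> space seq_space. real m < \<bar>x i\<bar>})" by (auto simp: D_def space_PiM)
        also have "\<dots> \<in> sets seq_space" using J by (intro sets.finite_UN) auto
        finally show ?thesis using Lsets by simp
      qed
      have "D n \<subseteq> D m" if "m \<le> n" for m n
        using that unfolding D_def by (smt (verit) Collect_mono of_nat_le_iff)
      then have "decseq D" by (simp add: decseq_def)
      moreover have "(\<Inter>m. D m) = {}"
      proof -
        have False if mem: "\<And>m. x \<in> D m" for x
        proof -
          obtain m :: nat where m: "(\<Sum>i\<in>J. \<bar>x i\<bar>) \<le> real m" using real_arch_simple by blast
          obtain i where "i \<in> J" "real m < \<bar>x i\<bar>" using mem[of m] by (auto simp: D_def)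
          moreover have "\<bar>x i\<bar> \<le> (\<Sum>i\<in>J. \<bar>x i\<bar>)" by (rule member_le_sum[OF \<open>i \<in> J\<close>]) (use J in auto)
          ultimately show False using m by linarith
        qed
        then show ?thesis by auto
      qed
      ultimately have "(\<lambda>m. measure L (D m)) \<longlonglongrightarrow> 0"
        using L.finite_Lim_measure_decseq[of D] Dm by auto
      then have "eventually (\<lambda>m. measure L (D m) < e') sequentially" by (rule order_tendstoD) (rule e'(1))
      then show thesis using that by (auto simp: eventually_sequentially D_def)
    qed
    obtain d where d: "0 < d"
      "\<And>x y. (\<And>i. i \<in> J \<Longrightarrow> \<bar>y i\<bar> \<le> real R) \<Longrightarrow> (\<And>i. i \<in> J \<Longrightarrow> \<bar>x i - y i\<bar> \<le> d) \<Longrightarrow> \<bar>g x - g y\<bar> < e / 4"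
      using uniformly_continuous_cylinder[OF gc gJ, of J "e / 4" "real R"] e by auto
    define bad where "bad = {x. \<exists>i\<in>J. real R < \<bar>x i\<bar>}"
    have bad: "bad \<in> sets seq_space"
    proof -
      have "bad = (\<Union>i\<in>J. {x \<in> space seq_space. real R < \<bar>x i\<bar>})" by (auto simp: bad_def space_PiM)
      also have "\<dots> \<in> sets seq_space" using J by (intro sets.finite_UN) auto
      finally show ?thesis .
    qed
    define V where "V n = (\<Sum>i\<in>J. \<integral>\<^sup>+z. ennreal ((fst z i - snd z i)\<^sup>2) \<partial>\<nu> n)" for n
    have "(\<lambda>n. ennreal (e / 4 + e / 4) + ennreal (2 * B / d\<^sup>2) * V n) \<longlonglongrightarrow> ennreal (e / 4 + e / 4) + ennreal (2 * B / d\<^sup>2) * (\<Sum>i\<in>J. 0)"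
      unfolding V_def by (intro tendsto_intros ennreal_tendsto_cmult L2) auto
    then have "eventually (\<lambda>n. ennreal (e / 4 + e / 4) + ennreal (2 * B / d\<^sup>2) * V n < ennreal e) sequentially"
      by (rule order_tendstoD) (use e in \<open>auto intro: ennreal_lessI\<close>)
    then show "eventually (\<lambda>n. dist ((\<integral>x. g x \<partial>N n) - (\<integral>x. g x \<partial>L)) 0 < e) sequentially"
    proof eventually_elim
      case (elim n)
      interpret \<nu>: prob_space "\<nu> n" by (rule \<nu>(1))
      have gi: "integrable (\<nu> n) (\<lambda>z. g (fst z))" "integrable (\<nu> n) (\<lambda>z. g (snd z))"
        using B(1) by (auto intro!: \<nu>.integrable_const_bound[where B=B] measurable_compose[OF fm(1) gm] measurable_compose[OF fm(2) gm])
      have I1: "(\<integral>x. g x \<partial>N n) = (\<integral>z. g (fst z) \<partial>\<nu> n)" unfolding N[symmetric] by (rule integral_distr[OF fm(1) gm])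
      have I2: "(\<integral>x. g x \<partial>L) = (\<integral>z. g (snd z) \<partial>\<nu> n)" unfolding L[of n, symmetric] by (rule integral_distr[OF fm(2) gm])
      \<comment> \<open>far from the cube or from each other the difference is at most \<open>2 B\<close>; the last term is then at least
        \<open>2 B\<close> by Chebyshev's argument, applied pointwise\<close>
      have pw: "ennreal \<bar>g (fst z) - g (snd z)\<bar>
          \<le> ennreal (e / 4) + (ennreal (2 * B) * indicator bad (snd z)
            + ennreal (2 * B / d\<^sup>2) * (\<Sum>i\<in>J. ennreal ((fst z i - snd z i)\<^sup>2)))" for z
      proof -
        have "\<bar>g (fst z) - g (snd z)\<bar> \<le> e / 4 + (2 * B * indicator bad (snd z) + 2 * B / d\<^sup>2 * (\<Sum>i\<in>J. (fst z i - snd z i)\<^sup>2))"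
        proof -
          have nn: "0 \<le> 2 * B / d\<^sup>2 * (\<Sum>i\<in>J. (fst z i - snd z i)\<^sup>2)" using B(2) by (intro mult_nonneg_nonneg sum_nonneg) auto
          have nn2: "0 \<le> 2 * B * indicator bad (snd z)" using B(2) by (simp add: indicator_def)
          have le2B: "\<bar>g (fst z) - g (snd z)\<bar> \<le> 2 * B" using B(1)[of "fst z"] B(1)[of "snd z"] by linarith
          consider "snd z \<in> bad" | "snd z \<notin> bad" "\<exists>i\<in>J. d < \<bar>fst z i - snd z i\<bar>"
            | "snd z \<notin> bad" "\<forall>i\<in>J. \<bar>fst z i - snd z i\<bar> \<le> d" by force
          then show ?thesis
          proof cases
            case 1
            then have "2 * B * indicator bad (snd z) = 2 * B" by simp
            then show ?thesis using le2B nn e by linarith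
          next
            case 2
            then obtain i where i: "i \<in> J" "d < \<bar>fst z i - snd z i\<bar>" by auto
            have "d\<^sup>2 \<le> (fst z i - snd z i)\<^sup>2" using i(2) d(1) by (intro abs_le_square_iff[THEN iffD1]) auto
            also have "\<dots> \<le> (\<Sum>i\<in>J. (fst z i - snd z i)\<^sup>2)" by (rule member_le_sum[OF i(1)]) (use J in auto)
            finally have "2 * B / d\<^sup>2 * d\<^sup>2 \<le> 2 * B / d\<^sup>2 * (\<Sum>i\<in>J. (fst z i - snd z i)\<^sup>2)"
              using B(2) by (intro mult_left_mono) auto
            then have "2 * B \<le> 2 * B / d\<^sup>2 * (\<Sum>i\<in>J. (fst z i - snd z i)\<^sup>2)" using d(1) by simp
            then show ?thesis using le2B nn2 e by linarith
          next
            case 3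
            then have "\<bar>g (fst z) - g (snd z)\<bar> < e / 4" by (intro d(2)) (auto simp: bad_def not_less)
            then show ?thesis using nn nn2 by linarith
          qed
        qed
        then have "ennreal \<bar>g (fst z) - g (snd z)\<bar> \<le> ennreal (e / 4 + (2 * B * indicator bad (snd z) + 2 * B / d\<^sup>2 * (\<Sum>i\<in>J. (fst z i - snd z i)\<^sup>2)))"
          by (rule ennreal_leI)
        also have "\<dots> = ennreal (e / 4) + (ennreal (2 * B * indicator bad (snd z)) + ennreal (2 * B / d\<^sup>2 * (\<Sum>i\<in>J. (fst z i - snd z i)\<^sup>2)))"
          using e B(2) by (subst ennreal_plus[symmetric], simp_all add: sum_nonneg)+
        also have "ennreal (2 * B * indicator bad (snd z)) = ennreal (2 * B) * indicator bad (snd z)"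
          by (simp add: indicator_def)
        also have "ennreal (2 * B / d\<^sup>2 * (\<Sum>i\<in>J. (fst z i - snd z i)\<^sup>2)) = ennreal (2 * B / d\<^sup>2) * (\<Sum>i\<in>J. ennreal ((fst z i - snd z i)\<^sup>2))"
        proof -
          have "ennreal (2 * B / d\<^sup>2 * (\<Sum>i\<in>J. (fst z i - snd z i)\<^sup>2)) = ennreal (2 * B / d\<^sup>2) * ennreal (\<Sum>i\<in>J. (fst z i - snd z i)\<^sup>2)"
            using B(2) by (intro ennreal_mult sum_nonneg) auto
          then show ?thesis by (simp add: sum_ennreal)
        qed
        finally show ?thesis .
      qed
      have m1: "(\<lambda>z. ennreal (2 * B) * indicator bad (snd z)) \<in> borel_measurable (\<nu> n)"
        by (intro borel_measurable_times_ennreal borel_measurable_const measurable_compose[OF fm(2) borel_measurable_indicator[OF bad]])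
      have m2: "(\<lambda>z. ennreal ((fst z i - snd z i)\<^sup>2)) \<in> borel_measurable (\<nu> n)" for i
        unfolding measurable_cong_sets[OF \<nu>(2) refl] by measurable
      have m3: "(\<lambda>z. ennreal (2 * B / d\<^sup>2) * (\<Sum>i\<in>J. ennreal ((fst z i - snd z i)\<^sup>2))) \<in> borel_measurable (\<nu> n)"
        by (intro borel_measurable_times_ennreal borel_measurable_const borel_measurable_sum m2)
      have "ennreal \<bar>(\<integral>x. g x \<partial>N n) - (\<integral>x. g x \<partial>L)\<bar> = ennreal \<bar>\<integral>z. g (fst z) - g (snd z) \<partial>\<nu> n\<bar>"
        unfolding I1 I2 by (simp add: gi)
      also have "\<dots> \<le> ennreal (\<integral>z. \<bar>g (fst z) - g (snd z)\<bar> \<partial>\<nu> n)"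
        by (intro ennreal_leI integral_abs_bound)
      also have "\<dots> = (\<integral>\<^sup>+z. ennreal \<bar>g (fst z) - g (snd z)\<bar> \<partial>\<nu> n)"
        using gi by (intro nn_integral_eq_integral[symmetric]) auto
      also have "\<dots> \<le> (\<integral>\<^sup>+z. ennreal (e / 4) + (ennreal (2 * B) * indicator bad (snd z)
            + ennreal (2 * B / d\<^sup>2) * (\<Sum>i\<in>J. ennreal ((fst z i - snd z i)\<^sup>2))) \<partial>\<nu> n)"
        by (rule nn_integral_mono) (rule pw)
      also have "\<dots> = (\<integral>\<^sup>+z. ennreal (e / 4) \<partial>\<nu> n) + ((\<integral>\<^sup>+z. ennreal (2 * B) * indicator bad (snd z) \<partial>\<nu> n)
            + (\<integral>\<^sup>+z. ennreal (2 * B / d\<^sup>2) * (\<Sum>i\<in>J. ennreal ((fst z i - snd z i)\<^sup>2)) \<partial>\<nu> n))"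
        by (subst nn_integral_add, simp, intro borel_measurable_add m1 m3, subst nn_integral_add[OF m1 m3], rule refl)
      also have "(\<integral>\<^sup>+z. ennreal (e / 4) \<partial>\<nu> n) = ennreal (e / 4)" using \<nu>.emeasure_space_1 by simp
      also have "(\<integral>\<^sup>+z. ennreal (2 * B) * indicator bad (snd z) \<partial>\<nu> n) = ennreal (2 * B) * emeasure L bad"
      proof -
        have "(\<integral>\<^sup>+z. ennreal (2 * B) * indicator bad (snd z) \<partial>\<nu> n) = ennreal (2 * B) * (\<integral>\<^sup>+z. indicator bad (snd z) \<partial>\<nu> n)"
          by (intro nn_integral_cmult measurable_compose[OF fm(2) borel_measurable_indicator[OF bad]])
        also have "(\<integral>\<^sup>+z. indicator bad (snd z) \<partial>\<nu> n) = (\<integral>\<^sup>+x. indicator bad x \<partial>distr (\<nu> n) seq_space snd)"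
          by (rule nn_integral_distr[symmetric, OF fm(2)])
            (simp only: measurable_distr_eq1 borel_measurable_indicator[OF bad])
        also have "\<dots> = emeasure L bad" unfolding L using bad Lsets by simp
        finally show ?thesis .
      qed
      also have "(\<integral>\<^sup>+z. ennreal (2 * B / d\<^sup>2) * (\<Sum>i\<in>J. ennreal ((fst z i - snd z i)\<^sup>2)) \<partial>\<nu> n) = ennreal (2 * B / d\<^sup>2) * V n"
        unfolding V_def by (subst nn_integral_cmult, intro borel_measurable_sum m2, subst nn_integral_sum, rule m2, rule refl)
      also have "ennreal (2 * B) * emeasure L bad \<le> ennreal (e / 4)"
      proof -
        have "ennreal (2 * B) * emeasure L bad = ennreal (2 * B * measure L bad)"
          using B(2) by (simp add: L.emeasure_eq_measure ennreal_mult)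
        also have "\<dots> \<le> ennreal (2 * B * e')"
          using R B(2) by (intro ennreal_leI mult_left_mono) (auto simp: bad_def)
        finally show ?thesis by (simp add: e')
      qed
      finally have "ennreal \<bar>(\<integral>x. g x \<partial>N n) - (\<integral>x. g x \<partial>L)\<bar> \<le> ennreal (e / 4) + (ennreal (e / 4) + ennreal (2 * B / d\<^sup>2) * V n)"
        by (simp add: add_left_mono add_right_mono)
      also have "\<dots> = ennreal (e / 4 + e / 4) + ennreal (2 * B / d\<^sup>2) * V n"
        using e by (subst ennreal_plus) (auto simp: add.assoc)
      also have "\<dots> < ennreal e" by (rule elim)
      finally show ?case by (simp add: ennreal_less_iff dist_real_def)
    qed
  qed
  then have "(\<lambda>n. \<integral>x. g x \<partial>N n) \<longlonglongrightarrow> (\<integral>x. g x \<partial>L)" by (rule LIM_zero_cancel)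
  then show "(\<lambda>n. \<integral>x. f (restrict x J) \<partial>N n) \<longlonglongrightarrow> (\<integral>x. f (restrict x J) \<partial>L)" by (simp add: g_def)
qed


lemma finite_measure_eqI_continuous:
  fixes M N :: "real measure"
  assumes "finite_measure M" and "finite_measure N"
    and sM: "sets M = sets borel" and sN: "sets N = sets borel"
    and eq: "\<And>c. continuous_on UNIV c \<Longrightarrow> (\<And>x. 0 \<le> c x) \<Longrightarrow> (\<And>x. c x \<le> 1) \<Longrightarrow>
      (\<integral>\<^sup>+x. ennreal (c x) \<partial>M) = (\<integral>\<^sup>+x. ennreal (c x) \<partial>N)"
  shows "M = N"
proof -
  have "cdf M t = cdf N t" for t
  proof -
    \<comment> \<open>continuous, with limit the indicator of \<open>x \<le> t\<close>\<close>
    define f where "f n x = max 0 (1 - real n * max 0 (x - t))" for n x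
    have fc: "continuous_on UNIV (f n)" for n unfolding f_def by (intro continuous_intros)
    have lim: "(\<lambda>n. f n x) \<longlonglongrightarrow> indicator {..t} x" for x
    proof (cases "x \<le> t")
      case True
      then show ?thesis by (simp add: f_def)
    next
      case False
      then obtain n0 where n0: "1 < real n0 * (x - t)" using reals_Archimedean3[of "x - t"] by auto
      have "f n x = 0" if "n \<ge> n0" for n
      proof -
        have "real n0 * (x - t) \<le> real n * (x - t)" using that False by (intro mult_right_mono) auto
        then have "1 - real n * (x - t) \<le> 0" using n0 by linarith
        then show ?thesis using False by (simp add: f_def)
      qed
      then have "eventually (\<lambda>n. f n x = 0) sequentially" by (auto simp: eventually_sequentially)
      then show ?thesis using False by (simp add: tendsto_eventually)
    qed
    have conv: "(\<lambda>n. \<integral>\<^sup>+x. ennreal (f n x) \<partial>L) \<longlonglongrightarrow> emeasure L {..t}" if L: "finite_measure L" "sets L = sets borel" for L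
    proof -
      interpret L: finite_measure L by fact
      have "(\<lambda>n. \<integral>\<^sup>+x. ennreal (f n x) \<partial>L) \<longlonglongrightarrow> (\<integral>\<^sup>+x. indicator {..t} x \<partial>L)"
      proof (rule nn_integral_dominated_convergence[where w="\<lambda>_. 1"])
        show "(\<lambda>x. indicator {..t} x :: ennreal) \<in> borel_measurable L"
          using L(2) by (intro borel_measurable_indicator) auto
        show "(\<lambda>x. ennreal (f n x)) \<in> borel_measurable L" for n
          unfolding measurable_cong_sets[OF L(2) refl]
          by (rule measurable_compose[OF borel_measurable_continuous_onI[OF fc] measurable_ennreal])
        show "AE x in L. (\<lambda>n. ennreal (f n x)) \<longlonglongrightarrow> indicator {..t} x"
        proof (rule AE_I2)
          fix x show "(\<lambda>n. ennreal (f n x)) \<longlonglongrightarrow> indicator {..t} x"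
            using tendsto_ennrealI[OF lim[of x]] by (cases "x \<le> t") simp_all
        qed
      qed (auto simp: f_def ennreal_le_1 L.emeasure_eq_measure)
      then show ?thesis using L(2) by simp
    qed
    have "emeasure M {..t} = emeasure N {..t}"
      using LIMSEQ_unique[OF conv[OF assms(1) sM]] conv[OF assms(2) sN] eq[OF fc] by (simp add: f_def)
    then show ?thesis by (simp add: cdf_def measure_def)
  qed
  then have "cdf M = cdf N" by auto
  then show ?thesis
    by (intro cdf_unique') (auto simp: finite_borel_measure_def finite_borel_measure_axioms_def assms)
qed

text \<open>Products of continuous functions of single coordinates are test functions. Their factors are replaced
  by indicators one coordinate at a time: with the other factors held fixed, the integrals are finite
  measures on the line in the remaining factor, and these are determined by continuous functions. In
  the end all factors are indicators, and the laws agree on cylinders.\<close>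
lemma weak_conv_fdd_unique:
  assumes N: "weak_conv_fdd N L" "weak_conv_fdd N L'"
    and L: "prob_space L" "sets L = sets seq_space" and L': "prob_space L'" "sets L' = sets seq_space"
  shows "L = L'"
proof -
  interpret L: prob_space L by fact
  interpret L': prob_space L' by fact
  have coord: "(\<lambda>x. x i) \<in> borel_measurable seq_space" for i :: int
    by (rule measurable_component_singleton) simp
  define good where "good k h \<longleftrightarrow> (continuous_on UNIV h \<and> (\<forall>x. 0 \<le> h x \<and> h x \<le> 1)) \<or> (k \<and> (\<exists>A\<in>sets borel. h = indicator A))"
    for k and h :: "real \<Rightarrow> real"
  have good_m: "h \<in> borel_measurable borel \<and> (\<forall>x. 0 \<le> h x \<and> h x \<le> 1)" if g: "good k h" for k h
  proof -
    from g[unfolded good_def] show ?thesis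
    proof
      assume c: "continuous_on UNIV h \<and> (\<forall>x. 0 \<le> h x \<and> h x \<le> 1)"
      then have "h \<in> borel_measurable borel" by (intro borel_measurable_continuous_onI) (rule conjunct1)
      from conjI[OF this conjunct2[OF c]] show ?thesis .
    next
      assume "k \<and> (\<exists>A\<in>sets borel. h = indicator A)"
      then obtain A where A: "A \<in> sets borel" and h: "h = indicator A" by (elim conjE bexE)
      show ?thesis unfolding h by (intro conjI borel_measurable_indicator A) (simp add: indicator_def)
    qed
  qed
  \<comment> \<open>\<open>S\<close> is the set of coordinates whose factor may already be an indicator\<close>
  have main: "(\<integral>\<^sup>+x. ennreal (\<Prod>i\<in>J. h i (x i)) \<partial>L) = (\<integral>\<^sup>+x. ennreal (\<Prod>i\<in>J. h i (x i)) \<partial>L')"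
    if J: "finite J" and S: "finite S" "\<And>i. good (i \<in> S) (h i)" for J S :: "int set" and h :: "int \<Rightarrow> real \<Rightarrow> real"
    using S
  proof (induction S arbitrary: h rule: finite_induct)
    case empty
    have h: "continuous_on UNIV (h i)" "0 \<le> h i y" "h i y \<le> 1" for i y
      using empty[of i] unfolding good_def by simp_all
    define f where "f x = (\<Prod>i\<in>J. h i (x i))" for x :: "int \<Rightarrow> real"
    have fb: "0 \<le> f x" "f x \<le> 1" for x
      unfolding f_def by (intro prod_nonneg prod_le_1 conjI ballI h)+
    have fr: "f (restrict x J) = f x" for x unfolding f_def by (intro prod.cong) simp_all
    have "continuous_map (product_topology (\<lambda>_. euclideanreal) J) euclideanreal f"
      unfolding f_def
    proof (intro continuous_map_prod[OF J])
      fix i assume "i \<in> J"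
      then have "continuous_map (product_topology (\<lambda>_. euclideanreal) J) euclideanreal (\<lambda>x. x i)"
        by (rule continuous_map_product_projection)
      moreover have "continuous_map euclideanreal euclideanreal (h i)" using h(1) by simp
      ultimately show "continuous_map (product_topology (\<lambda>_. euclideanreal) J) euclideanreal (\<lambda>x. h i (x i))"
        using continuous_map_compose[of "product_topology (\<lambda>_. euclideanreal) J" euclideanreal "\<lambda>x. x i" euclideanreal "h i"]
        by (simp only: comp_def)
    qed
    moreover have "bounded (f ` (J \<rightarrow>\<^sub>E UNIV))"
    proof -
      have "norm (f x) \<le> 1" for x using fb(1)[of x] fb(2)[of x] by simp
      then show ?thesis unfolding bounded_iff by blast
    qed
    ultimately have test: "finite J \<and> continuous_map (product_topology (\<lambda>_. euclideanreal) J) euclideanreal f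
        \<and> bounded (f ` (J \<rightarrow>\<^sub>E UNIV))" using J by blast
    have "(\<lambda>n. \<integral>x. f (restrict x J) \<partial>N n) \<longlonglongrightarrow> (\<integral>x. f (restrict x J) \<partial>L)"
      using N(1) test unfolding weak_conv_fdd_def by simp
    moreover have "(\<lambda>n. \<integral>x. f (restrict x J) \<partial>N n) \<longlonglongrightarrow> (\<integral>x. f (restrict x J) \<partial>L')"
      using N(2) test unfolding weak_conv_fdd_def by simp
    ultimately have "(\<integral>x. f (restrict x J) \<partial>L) = (\<integral>x. f (restrict x J) \<partial>L')" by (rule LIMSEQ_unique)
    then have eq: "(\<integral>x. f x \<partial>L) = (\<integral>x. f x \<partial>L')" by (simp add: fr)
    have "(\<integral>\<^sup>+x. ennreal (f x) \<partial>Q) = ennreal (\<integral>x. f x \<partial>Q)" if Q: "prob_space Q" "sets Q = sets seq_space" for Q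
    proof (rule nn_integral_eq_integral)
      interpret Q: prob_space Q by fact
      have "(\<lambda>x. h i (x i)) \<in> borel_measurable seq_space" for i
        by (rule measurable_compose[OF coord borel_measurable_continuous_onI[OF h(1)]])
      then have "f \<in> borel_measurable seq_space" unfolding f_def[abs_def] by (intro borel_measurable_prod)
      then have "f \<in> borel_measurable Q" by (simp only: measurable_cong_sets[OF Q(2) refl])
      moreover have "norm (f x) \<le> 1" for x using fb(1)[of x] fb(2)[of x] by simp
      ultimately show "integrable Q f" by (intro Q.integrable_const_bound[where B=1] AE_I2)
      show "AE x in Q. 0 \<le> f x" by (intro AE_I2 fb)
    qed
    from this[OF L] this[OF L'] eq show ?case by (simp add: f_def)
  next
    case (insert k S)
    show ?case
    proof (cases "k \<in> J")
      case False
      define h' where "h' = h(k := (\<lambda>_. 1))"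
      have "good (i \<in> S) (h' i)" for i using insert.prems[of i] by (auto simp: h'_def good_def)
      moreover have "(\<Prod>i\<in>J. h' i (x i)) = (\<Prod>i\<in>J. h i (x i))" for x :: "int \<Rightarrow> real"
        using False by (intro prod.cong refl) (auto simp: h'_def)
      ultimately show ?thesis using insert.IH[of h'] by (simp only:)
    next
      case True
      define r where "r x = (\<Prod>i\<in>J - {k}. h i (x i))" for x :: "int \<Rightarrow> real"
      have hb: "0 \<le> h i y" "h i y \<le> 1" "h i \<in> borel_measurable borel" for i y
      proof -
        note g = good_m[OF insert.prems[of i]]
        show "h i \<in> borel_measurable borel" by (rule conjunct1[OF g])
        show "0 \<le> h i y" "h i y \<le> 1" using spec[OF conjunct2[OF g], of y] by (rule conjunct1, rule conjunct2)
      qed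
      have rb: "0 \<le> r x" "r x \<le> 1" for x
        unfolding r_def by (intro prod_nonneg prod_le_1 conjI ballI hb)+
      have rm: "r \<in> borel_measurable seq_space" unfolding r_def[abs_def]
        by (intro borel_measurable_prod measurable_compose[OF coord hb(3)])
      \<comment> \<open>the law of the coordinate \<open>k\<close>, weighted with all other factors\<close>
      define \<mu> where "\<mu> Q = distr (density Q (\<lambda>x. ennreal (r x))) borel (\<lambda>x. x k)" for Q
      have \<mu>_int: "(\<integral>\<^sup>+y. ennreal (c y) \<partial>\<mu> Q) = (\<integral>\<^sup>+x. ennreal (\<Prod>i\<in>J. (h(k := c)) i (x i)) \<partial>Q)"
        if c: "c \<in> borel_measurable borel" "\<And>y. 0 \<le> c y" and Q: "sets Q = sets seq_space" for c Q
      proof -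
        have xk: "(\<lambda>x. x k) \<in> borel_measurable (density Q (\<lambda>x. ennreal (r x)))"
          unfolding measurable_cong_sets[OF trans[OF sets_density Q] refl] by (rule coord)
        have cm: "(\<lambda>x. ennreal (c (x k))) \<in> borel_measurable Q"
          unfolding measurable_cong_sets[OF Q refl]
          by (rule measurable_compose[OF measurable_compose[OF coord c(1)] measurable_ennreal])
        have rm': "(\<lambda>x. ennreal (r x)) \<in> borel_measurable Q"
          unfolding measurable_cong_sets[OF Q refl] by (rule measurable_compose[OF rm measurable_ennreal])
        have "(\<integral>\<^sup>+y. ennreal (c y) \<partial>\<mu> Q) = (\<integral>\<^sup>+x. ennreal (c (x k)) \<partial>density Q (\<lambda>x. ennreal (r x)))"
          unfolding \<mu>_def
          by (rule nn_integral_distr[OF xk])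
            (simp only: measurable_distr_eq1 measurable_compose[OF c(1) measurable_ennreal])
        also have "\<dots> = (\<integral>\<^sup>+x. ennreal (r x) * ennreal (c (x k)) \<partial>Q)"
          by (rule nn_integral_density[OF rm' cm])
        also have "\<dots> = (\<integral>\<^sup>+x. ennreal (\<Prod>i\<in>J. (h(k := c)) i (x i)) \<partial>Q)"
        proof (intro nn_integral_cong)
          fix x
          have "(\<Prod>i\<in>J. (h(k := c)) i (x i)) = c (x k) * r x"
            unfolding r_def by (subst prod.remove[OF J True]) (auto intro!: prod.cong)
          then show "ennreal (r x) * ennreal (c (x k)) = ennreal (\<Prod>i\<in>J. (h(k := c)) i (x i))"
            using rb(1)[of x] c(2)[of "x k"] by (simp add: ennreal_mult mult.commute)
        qed
        finally show ?thesis .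
      qed
      have fin: "finite_measure (\<mu> Q)" if Q: "prob_space Q" "sets Q = sets seq_space" for Q
      proof (rule finite_measureI)
        interpret Q: prob_space Q by fact
        have "emeasure (\<mu> Q) (space (\<mu> Q)) = (\<integral>\<^sup>+y. ennreal 1 \<partial>\<mu> Q)" by simp
        also have "\<dots> = (\<integral>\<^sup>+x. ennreal (\<Prod>i\<in>J. (h(k := (\<lambda>_. 1))) i (x i)) \<partial>Q)"
          by (rule \<mu>_int) (simp_all add: Q)
        also have "\<dots> \<le> (\<integral>\<^sup>+x. 1 \<partial>Q)"
        proof (intro nn_integral_mono)
          fix x :: "int \<Rightarrow> real"
          have "(\<Prod>i\<in>J. (h(k := (\<lambda>_. 1))) i (x i)) \<le> 1"
          proof (intro prod_le_1 conjI)
            fix i show "0 \<le> (h(k := (\<lambda>_. 1))) i (x i)" "(h(k := (\<lambda>_. 1))) i (x i) \<le> 1"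
              using hb(1)[of i "x i"] hb(2)[of i "x i"] by (simp_all add: fun_upd_def)
          qed
          then show "ennreal (\<Prod>i\<in>J. (h(k := (\<lambda>_. 1))) i (x i)) \<le> 1" by (simp add: ennreal_le_1)
        qed
        also have "\<dots> < \<infinity>" using Q.emeasure_space_1 by simp
        finally show "emeasure (\<mu> Q) (space (\<mu> Q)) \<noteq> \<infinity>" by simp
      qed
      have "\<mu> L = \<mu> L'"
      proof (rule finite_measure_eqI_continuous[OF fin[OF L] fin[OF L']])
        fix c :: "real \<Rightarrow> real" assume c: "continuous_on UNIV c" "\<And>x. 0 \<le> c x" "\<And>x. c x \<le> 1"
        have "good (i \<in> S) ((h(k := c)) i)" for i
        proof (cases "i = k")
          case True
          have "\<forall>x. 0 \<le> c x \<and> c x \<le> 1" by (intro allI conjI c)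
          with True c(1) show ?thesis unfolding good_def by simp
        next
          case False
          with insert.prems[of i] show ?thesis unfolding good_def by simp
        qed
        from insert.IH[of "h(k := c)", OF this]
        show "(\<integral>\<^sup>+x. ennreal (c x) \<partial>\<mu> L) = (\<integral>\<^sup>+x. ennreal (c x) \<partial>\<mu> L')"
          by (simp only: \<mu>_int[OF borel_measurable_continuous_onI[OF c(1)] c(2)] L(2) L'(2))
      qed (simp_all add: \<mu>_def)
      then have "(\<integral>\<^sup>+y. ennreal (h k y) \<partial>\<mu> L) = (\<integral>\<^sup>+y. ennreal (h k y) \<partial>\<mu> L')" by simp
      then show ?thesis
        by (simp only: \<mu>_int[OF hb(3) hb(1) L(2)] \<mu>_int[OF hb(3) hb(1) L'(2)] fun_upd_triv)
    qed
  qed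
  show ?thesis
  proof (rule measure_eqI_PiM_infinite)
    show "sets L = sets seq_space" "sets L' = sets seq_space" by fact+
    show "finite_measure L" by unfold_locales
    fix A and J :: "int set" assume J: "finite J" "J \<subseteq> UNIV" and A: "\<And>i. i \<in> J \<Longrightarrow> A i \<in> sets (borel :: real measure)"
    define h where "h i = (if i \<in> J then indicator (A i) else (\<lambda>_. 1 :: real))" for i
    have gh: "good (i \<in> J) (h i)" for i using A[of i] by (auto simp: good_def h_def)
    have em: "emeasure Q (prod_emb UNIV (\<lambda>_. borel) J (Pi\<^sub>E J A)) = (\<integral>\<^sup>+x. ennreal (\<Prod>i\<in>J. h i (x i)) \<partial>Q)"
      if Q: "sets Q = sets seq_space" for Q
    proof -
      have B: "prod_emb UNIV (\<lambda>_. borel) J (Pi\<^sub>E J A) \<in> sets Q" using A J Q by (simp add: sets_PiM_I)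
      have "(\<Prod>i\<in>J. h i (x i)) = indicator (prod_emb UNIV (\<lambda>_. borel) J (Pi\<^sub>E J A)) x" for x
        using J(1) by (auto simp: h_def indicator_def prod_emb_def PiE_iff intro!: prod.neutral prod_zero)
      then show ?thesis using B by (simp add: ennreal_indicator)
    qed
    show "emeasure L (prod_emb UNIV (\<lambda>_. borel) J (Pi\<^sub>E J A)) = emeasure L' (prod_emb UNIV (\<lambda>_. borel) J (Pi\<^sub>E J A))"
      unfolding em[OF L(2)] em[OF L'(2)] by (rule main[OF J(1) J(1) gh])
  qed
qed

section \<open>The dynamics as the iteration of a kernel\<close>

lemma distr_fst_pair:
  assumes "f \<in> M \<rightarrow>\<^sub>M S" "prob_space N"
  shows "distr M S f \<Otimes>\<^sub>M N = distr (M \<Otimes>\<^sub>M N) (S \<Otimes>\<^sub>M N) (\<lambda>w. (f (fst w), snd w))"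
proof -
  interpret N: prob_space N by fact
  have "distr M S f \<Otimes>\<^sub>M distr N N (\<lambda>y. y) = distr (M \<Otimes>\<^sub>M N) (S \<Otimes>\<^sub>M N) (\<lambda>(x, y). (f x, y))"
    by (rule pair_measure_distr[OF assms(1)]) (simp_all add: distr_id2 N.sigma_finite_measure_axioms)
  then show ?thesis by (simp add: distr_id2 case_prod_beta')
qed

lemma distr_pair_snd:
  assumes "g \<in> N \<rightarrow>\<^sub>M T" "prob_space N"
  shows "M \<Otimes>\<^sub>M distr N T g = distr (M \<Otimes>\<^sub>M N) (M \<Otimes>\<^sub>M T) (\<lambda>w. (fst w, g (snd w)))"
proof -
  interpret D: prob_space "distr N T g" by (rule prob_space.prob_space_distr[OF assms(2,1)])
  have "distr M M (\<lambda>x. x) \<Otimes>\<^sub>M distr N T g = distr (M \<Otimes>\<^sub>M N) (M \<Otimes>\<^sub>M T) (\<lambda>(x, y). (x, g y))"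
    by (rule pair_measure_distr[OF _ assms(1)]) (simp_all add: D.sigma_finite_measure_axioms)
  then show ?thesis by (simp add: distr_id2 case_prod_beta')
qed

lemma initial_law_moments:
  assumes "initial_law \<rho>"
  shows "(\<integral>\<^sup>+x. ennreal x \<partial>\<rho>) = ennreal (\<integral>x. x \<partial>\<rho>)"
    and "(\<integral>\<^sup>+x. ennreal x * ennreal x \<partial>\<rho>) = ennreal (\<integral>x. x\<^sup>2 \<partial>\<rho>)"
    and "(\<integral>x. x \<partial>\<rho>)\<^sup>2 \<le> (\<integral>x. x\<^sup>2 \<partial>\<rho>)"
proof -
  interpret prob_space \<rho> using assms by (simp add: initial_law_def)
  have nn: "AE x in \<rho>. 0 \<le> x" and i1: "integrable \<rho> (\<lambda>x. x)" and i2: "integrable \<rho> (\<lambda>x. x\<^sup>2)"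
    using assms by (auto simp: initial_law_def)
  show "(\<integral>\<^sup>+x. ennreal x \<partial>\<rho>) = ennreal (\<integral>x. x \<partial>\<rho>)" by (rule nn_integral_eq_integral[OF i1 nn])
  have "(\<integral>\<^sup>+x. ennreal x * ennreal x \<partial>\<rho>) = (\<integral>\<^sup>+x. ennreal (x\<^sup>2) \<partial>\<rho>)"
  proof (rule nn_integral_cong_AE)
    show "AE x in \<rho>. ennreal x * ennreal x = ennreal (x\<^sup>2)"
      using nn by eventually_elim (simp add: power2_eq_square ennreal_mult)
  qed
  also have "\<dots> = ennreal (\<integral>x. x\<^sup>2 \<partial>\<rho>)" by (rule nn_integral_eq_integral[OF i2]) simp
  finally show "(\<integral>\<^sup>+x. ennreal x * ennreal x \<partial>\<rho>) = ennreal (\<integral>x. x\<^sup>2 \<partial>\<rho>)" .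
  show "(\<integral>x. x \<partial>\<rho>)\<^sup>2 \<le> (\<integral>x. x\<^sup>2 \<partial>\<rho>)"
    using variance_positive[of "\<lambda>x. x"] variance_eq[OF i1 i2] by simp
qed

lemma initial_law_gamma:
  assumes "0 < a" "0 < g"
  shows "initial_law (gamma_distr a g)" and "(\<integral>x. x \<partial>gamma_distr a g) = a / g"
proof -
  interpret prob_space "gamma_distr a g" by (rule prob_space_gamma_distr[OF assms])
  have eq: "gamma0 a g = gamma_distr a g" using assms by (simp add: gamma0_def)
  have nn: "AE x in gamma_distr a g. 0 \<le> x" using AE_gamma_distr_pos[of a g] by eventually_elim simp
  have m1: "(\<integral>\<^sup>+x. ennreal x \<partial>gamma_distr a g) = ennreal (a / g)"
    using nn_integral_gamma0_ident[of a g] assms unfolding eq by simp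
  have "(\<integral>\<^sup>+x. ennreal (x\<^sup>2) \<partial>gamma_distr a g) = (\<integral>\<^sup>+x. ennreal x * ennreal x \<partial>gamma_distr a g)"
  proof (rule nn_integral_cong_AE)
    show "AE x in gamma_distr a g. ennreal (x\<^sup>2) = ennreal x * ennreal x"
      using nn by eventually_elim (simp add: power2_eq_square ennreal_mult)
  qed
  also have "\<dots> = ennreal (a * (a + 1) / g\<^sup>2)"
    using nn_integral_gamma0_square[of a g] assms unfolding eq by simp
  finally have m2: "(\<integral>\<^sup>+x. ennreal (x\<^sup>2) \<partial>gamma_distr a g) = ennreal (a * (a + 1) / g\<^sup>2)" .
  have i1: "integrable (gamma_distr a g) (\<lambda>x. x)"
  proof (rule integrableI_nn_integral_finite[OF _ nn m1])
    show "(\<lambda>x. x) \<in> borel_measurable (gamma_distr a g)"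
      unfolding measurable_cong_sets[OF sets_gamma_distr refl] by measurable
  qed
  have i2: "integrable (gamma_distr a g) (\<lambda>x. x\<^sup>2)"
  proof (rule integrableI_nn_integral_finite[OF _ _ m2])
    show "(\<lambda>x. x\<^sup>2) \<in> borel_measurable (gamma_distr a g)"
      unfolding measurable_cong_sets[OF sets_gamma_distr refl] by measurable
  qed simp
  have "ennreal (\<integral>x. x \<partial>gamma_distr a g) = ennreal (a / g)"
    using nn_integral_eq_integral[OF i1 nn] m1 by simp
  moreover have "0 \<le> (\<integral>x. x \<partial>gamma_distr a g)" using nn by (rule integral_nonneg_AE)
  ultimately show mean: "(\<integral>x. x \<partial>gamma_distr a g) = a / g" using assms by simp
  show "initial_law (gamma_distr a g)"
    unfolding initial_law_def mean using assms nn i1 i2 prob_space_axioms by simp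
qed

lemma row_mult_defined_sets:
  "{w \<in> space (seq_space \<Otimes>\<^sub>M matrix_space). row_mult_defined (fst w) (snd w)} \<in> sets (seq_space \<Otimes>\<^sub>M matrix_space)"
proof -
  have "row_mult_defined t P \<longleftrightarrow> (\<forall>j. (\<integral>\<^sup>+i. ennreal (norm (t i * P i j)) \<partial>count_space UNIV) < \<infinity>)"
    for t :: "int \<Rightarrow> real" and P :: "int \<Rightarrow> int \<Rightarrow> real"
    by (simp add: row_mult_defined_def summable_on_iff_integrable_count_space integrable_iff_bounded)
  moreover have "{w \<in> space (seq_space \<Otimes>\<^sub>M matrix_space).
      \<forall>j. (\<integral>\<^sup>+i. ennreal (norm (fst w i * snd w i j)) \<partial>count_space UNIV) < \<infinity>} \<in> sets (seq_space \<Otimes>\<^sub>M matrix_space)"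
    by measurable
  ultimately show ?thesis by simp
qed

context dirichlet_exchange
begin

definition step :: "(int \<Rightarrow> real) measure \<Rightarrow> (int \<Rightarrow> real) measure" where
  "step \<nu> = distr (\<nu> \<Otimes>\<^sub>M K) seq_space (\<lambda>w. row_mult (fst w) (snd w))"

lemma prob_space_K: "prob_space K" by (rule prob_space_matrix_law)

lemma row_mult_law_measurable:
  "sets \<nu> = sets seq_space \<Longrightarrow> (\<lambda>w. row_mult (fst w) (snd w)) \<in> \<nu> \<Otimes>\<^sub>M K \<rightarrow>\<^sub>M seq_space"
  using measurable_row_mult' measurable_cong_sets[OF sets_pair_measure_cong[OF _ sets_matrix_law] refl, of \<nu> seq_space]
  by blast

lemma pair_K_marginal:
  assumes g: "admissible \<nu>" and h: "h \<in> {fst, snd}"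
  shows "distr \<nu> seq_space h \<Otimes>\<^sub>M K = distr (\<nu> \<Otimes>\<^sub>M K) (seq_space \<Otimes>\<^sub>M K) (\<lambda>w. (h (fst w), snd w))"
    and "(\<lambda>w. (h (fst w), snd w)) \<in> \<nu> \<Otimes>\<^sub>M K \<rightarrow>\<^sub>M seq_space \<Otimes>\<^sub>M K"
proof -
  have hm: "h \<in> \<nu> \<rightarrow>\<^sub>M seq_space"
    using measurable_fst_snd[OF h] measurable_cong_sets[of \<nu> pair_space seq_space seq_space] g by (simp add: admissible_def)
  show "distr \<nu> seq_space h \<Otimes>\<^sub>M K = distr (\<nu> \<Otimes>\<^sub>M K) (seq_space \<Otimes>\<^sub>M K) (\<lambda>w. (h (fst w), snd w))"
    by (rule distr_fst_pair[OF hm prob_space_K])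
  show "(\<lambda>w. (h (fst w), snd w)) \<in> \<nu> \<Otimes>\<^sub>M K \<rightarrow>\<^sub>M seq_space \<Otimes>\<^sub>M K"
    by (intro measurable_Pair measurable_compose[OF measurable_fst hm] measurable_snd)
qed

lemma pair_step_marginal:
  assumes g: "admissible \<nu>" and h: "h \<in> {fst, snd}"
  shows "distr (pair_step \<nu>) seq_space h = step (distr \<nu> seq_space h)"
proof -
  have "distr (pair_step \<nu>) seq_space h = distr (\<nu> \<Otimes>\<^sub>M K) seq_space (\<lambda>w. row_mult (h (fst w)) (snd w))"
    unfolding pair_step_def distr_distr[OF measurable_fst_snd[OF h] pair_step_measurable[OF g]]
    by (intro distr_cong refl) (simp add: pair_step_coordinate[OF h])
  also have "\<dots> = step (distr \<nu> seq_space h)"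
    unfolding step_def pair_K_marginal(1)[OF g h]
    by (subst distr_distr[OF row_mult_law_measurable[OF refl] pair_K_marginal(2)[OF g h]]) (simp add: comp_def)
  finally show ?thesis .
qed

lemma pair_step_pow_marginal:
  assumes g: "admissible \<nu>" and h: "h \<in> {fst, snd}"
  shows "admissible ((pair_step ^^ n) \<nu>) \<and> distr ((pair_step ^^ n) \<nu>) seq_space h = (step ^^ n) (distr \<nu> seq_space h)"
proof (induction n)
  case (Suc n)
  then show ?case using admissible_pair_step pair_step_marginal[OF _ h] by simp
qed (use g in simp)

lemma row_mult_defined_marginal:
  assumes g: "admissible \<nu>" and h: "h \<in> {fst, snd}"
  shows "AE w in distr \<nu> seq_space h \<Otimes>\<^sub>M K. row_mult_defined (fst w) (snd w)"
proof -
  have sets: "{w \<in> space (seq_space \<Otimes>\<^sub>M K). row_mult_defined (fst w) (snd w)} \<in> sets (seq_space \<Otimes>\<^sub>M K)"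
    using row_mult_defined_sets sets_pair_measure_cong[OF refl sets_matrix_law, of seq_space]
    by (simp add: sets_eq_imp_space_eq[OF sets_pair_measure_cong[OF refl sets_matrix_law, of seq_space]])
  show ?thesis
    unfolding pair_K_marginal(1)[OF g h] AE_distr_iff[OF pair_K_marginal(2)[OF g h] sets]
    using admissible_row_mult_AE[OF g h] by eventually_elim simp
qed

abbreviation iid :: "real measure \<Rightarrow> (int \<Rightarrow> real) measure" where
  "iid \<rho> \<equiv> Pi\<^sub>M UNIV (\<lambda>_. \<rho>)"

lemma iid_law: "initial_law \<rho> \<Longrightarrow> prob_space (iid \<rho>) \<and> sets (iid \<rho>) = sets seq_space"
  by (auto simp: initial_law_def intro!: prob_space_PiM sets_PiM_cong)

lemma iid_moments:
  assumes \<rho>: "initial_law \<rho>"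
  shows "AE x in iid \<rho>. \<forall>i. 0 \<le> x i"
    and "(\<lambda>x. ennreal (x i)) \<in> borel_measurable (iid \<rho>)"
    and "(\<integral>\<^sup>+x. ennreal (x i) \<partial>iid \<rho>) = ennreal (\<integral>x. x \<partial>\<rho>)"
    and "(\<integral>\<^sup>+x. ennreal (x i) * ennreal (x j) \<partial>iid \<rho>)
      = ennreal ((\<integral>x. x \<partial>\<rho>)\<^sup>2 + \<delta> (j - i) * ((\<integral>x. x\<^sup>2 \<partial>\<rho>) - (\<integral>x. x \<partial>\<rho>)\<^sup>2))"
proof -
  interpret \<rho>: prob_space \<rho> using \<rho> by (simp add: initial_law_def)
  have s: "sets \<rho> = sets borel" using \<rho> by (simp add: initial_law_def)
  have sA: "sets (iid \<rho>) = sets seq_space" using iid_law[OF \<rho>] by simp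
  show "AE x in iid \<rho>. \<forall>i. 0 \<le> x i"
    unfolding AE_all_countable using \<rho>
    by (auto intro!: AE_PiM_component \<rho>.prob_space_axioms simp: initial_law_def)
  have em: "ennreal \<in> borel_measurable \<rho>"
    unfolding measurable_cong_sets[OF s refl] by (rule measurable_ennreal)
  show "(\<lambda>x. ennreal (x i)) \<in> borel_measurable (iid \<rho>)"
    unfolding measurable_cong_sets[OF sA refl] by measurable
  show "(\<integral>\<^sup>+x. ennreal (x i) \<partial>iid \<rho>) = ennreal (\<integral>x. x \<partial>\<rho>)"
    using nn_integral_PiM_component[where N="\<lambda>_. \<rho>" and f=ennreal and i=i, OF \<rho>.prob_space_axioms em]
      initial_law_moments(1)[OF \<rho>] by simp
  show "(\<integral>\<^sup>+x. ennreal (x i) * ennreal (x j) \<partial>iid \<rho>)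
      = ennreal ((\<integral>x. x \<partial>\<rho>)\<^sup>2 + \<delta> (j - i) * ((\<integral>x. x\<^sup>2 \<partial>\<rho>) - (\<integral>x. x \<partial>\<rho>)\<^sup>2))"
  proof (cases "i = j")
    case True
    then show ?thesis
      using nn_integral_PiM_component[where N="\<lambda>_. \<rho>" and f="\<lambda>x. ennreal x * ennreal x" and i=i,
          OF \<rho>.prob_space_axioms borel_measurable_times_ennreal[OF em em]] initial_law_moments(2)[OF \<rho>]
      by (simp add: \<delta>_def)
  next
    case False
    have "0 \<le> (\<integral>x. x \<partial>\<rho>)" using \<rho> by (simp add: initial_law_def)
    then show ?thesis using False
      nn_integral_PiM_component2[where N="\<lambda>_. \<rho>" and f=ennreal and g=ennreal and i=i and k=j,
          OF \<rho>.prob_space_axioms False em em] initial_law_moments(1)[OF \<rho>]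
      by (simp add: \<delta>_def ennreal_mult[symmetric] power2_eq_square)
  qed
qed

lemma admissible_product:
  assumes \<rho>: "initial_law \<rho>" and \<rho>': "initial_law \<rho>'"
  shows "admissible (iid \<rho> \<Otimes>\<^sub>M iid \<rho>')"
    and "distr (iid \<rho> \<Otimes>\<^sub>M iid \<rho>') seq_space fst = iid \<rho>"
    and "distr (iid \<rho> \<Otimes>\<^sub>M iid \<rho>') seq_space snd = iid \<rho>'"
    and "corr (iid \<rho> \<Otimes>\<^sub>M iid \<rho>') fst fst (\<lambda>d. (\<integral>x. x \<partial>\<rho>)\<^sup>2 + \<delta> d * ((\<integral>x. x\<^sup>2 \<partial>\<rho>) - (\<integral>x. x \<partial>\<rho>)\<^sup>2))"
    and "corr (iid \<rho> \<Otimes>\<^sub>M iid \<rho>') fst snd (\<lambda>d. (\<integral>x. x \<partial>\<rho>) * (\<integral>x. x \<partial>\<rho>'))"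
    and "corr (iid \<rho> \<Otimes>\<^sub>M iid \<rho>') snd snd (\<lambda>d. (\<integral>x. x \<partial>\<rho>')\<^sup>2 + \<delta> d * ((\<integral>x. x\<^sup>2 \<partial>\<rho>') - (\<integral>x. x \<partial>\<rho>')\<^sup>2))"
proof -
  let ?A = "iid \<rho>" and ?B = "iid \<rho>'"
  interpret A: prob_space ?A using iid_law[OF \<rho>] by simp
  interpret B: prob_space ?B using iid_law[OF \<rho>'] by simp
  interpret AB: pair_prob_space ?A ?B ..
  have sA: "sets ?A = sets seq_space" "sets ?B = sets seq_space" using iid_law[OF \<rho>] iid_law[OF \<rho>'] by simp_all
  note mA = iid_moments[OF \<rho>] and mB = iid_moments[OF \<rho>']
  note pm = nn_integral_pair_mult[OF A.prob_space_axioms B.prob_space_axioms]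
  have int_fst: "(\<integral>\<^sup>+w. f (fst w) \<partial>(?A \<Otimes>\<^sub>M ?B)) = (\<integral>\<^sup>+x. f x \<partial>?A)" if "f \<in> borel_measurable ?A" for f
    using pm[OF that, of "\<lambda>_. 1"] B.emeasure_space_1 by simp
  have int_snd: "(\<integral>\<^sup>+w. f (snd w) \<partial>(?A \<Otimes>\<^sub>M ?B)) = (\<integral>\<^sup>+x. f x \<partial>?B)" if "f \<in> borel_measurable ?B" for f
    using pm[OF _ that, of "\<lambda>_. 1"] A.emeasure_space_1 by simp
  show "admissible (?A \<Otimes>\<^sub>M ?B)"
    unfolding admissible_def
  proof (intro conjI ballI)
    show "prob_space (?A \<Otimes>\<^sub>M ?B)" by unfold_locales
    show "sets (?A \<Otimes>\<^sub>M ?B) = sets pair_space" by (intro sets_pair_measure_cong sA)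
    fix h :: "(int \<Rightarrow> real) \<times> (int \<Rightarrow> real) \<Rightarrow> int \<Rightarrow> real" assume h: "h \<in> {fst, snd}"
    have "AE z in ?A \<Otimes>\<^sub>M ?B. \<forall>i. 0 \<le> fst z i" "AE z in ?A \<Otimes>\<^sub>M ?B. \<forall>i. 0 \<le> snd z i"
      by (rule AE_pair_fst[OF A.prob_space_axioms B.prob_space_axioms mA(1)]
          AE_pair_snd[OF A.prob_space_axioms B.prob_space_axioms mB(1)])+
    with h show "AE z in ?A \<Otimes>\<^sub>M ?B. \<forall>i. 0 \<le> h z i" by blast
    have "(\<integral>\<^sup>+z. ennreal (fst z i) \<partial>(?A \<Otimes>\<^sub>M ?B)) = ennreal (\<integral>x. x \<partial>\<rho>)"
      "(\<integral>\<^sup>+z. ennreal (snd z i) \<partial>(?A \<Otimes>\<^sub>M ?B)) = ennreal (\<integral>x. x \<partial>\<rho>')" for i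
      using int_fst[OF mA(2)[of i]] int_snd[OF mB(2)[of i]] mA(3) mB(3) by simp_all
    with h show "\<exists>B<\<infinity>. \<forall>i. (\<integral>\<^sup>+z. ennreal (h z i) \<partial>(?A \<Otimes>\<^sub>M ?B)) \<le> B"
      by (auto intro: exI[of _ "ennreal _"])
  qed
  have "distr (?A \<Otimes>\<^sub>M ?B) ?A fst = ?A" by (rule B.distr_pair_fst)
  then show "distr (?A \<Otimes>\<^sub>M ?B) seq_space fst = ?A"
    using distr_cong[OF refl sA(1), of "?A \<Otimes>\<^sub>M ?B" fst fst] by simp
  have "distr (?A \<Otimes>\<^sub>M ?B) ?B snd = ?B"
    by (rule distr_pair_snd_marginal) unfold_locales
  then show "distr (?A \<Otimes>\<^sub>M ?B) seq_space snd = ?B"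
    using distr_cong[OF refl sA(2), of "?A \<Otimes>\<^sub>M ?B" snd snd] by simp
  show "corr (?A \<Otimes>\<^sub>M ?B) fst fst (\<lambda>d. (\<integral>x. x \<partial>\<rho>)\<^sup>2 + \<delta> d * ((\<integral>x. x\<^sup>2 \<partial>\<rho>) - (\<integral>x. x \<partial>\<rho>)\<^sup>2))"
    unfolding corr_def using int_fst[OF borel_measurable_times_ennreal[OF mA(2) mA(2)]] mA(4) by simp
  show "corr (?A \<Otimes>\<^sub>M ?B) snd snd (\<lambda>d. (\<integral>x. x \<partial>\<rho>')\<^sup>2 + \<delta> d * ((\<integral>x. x\<^sup>2 \<partial>\<rho>') - (\<integral>x. x \<partial>\<rho>')\<^sup>2))"
    unfolding corr_def using int_snd[OF borel_measurable_times_ennreal[OF mB(2) mB(2)]] mB(4) by simp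
  show "corr (?A \<Otimes>\<^sub>M ?B) fst snd (\<lambda>d. (\<integral>x. x \<partial>\<rho>) * (\<integral>x. x \<partial>\<rho>'))"
  proof -
    have "0 \<le> (\<integral>x. x \<partial>\<rho>)" "0 \<le> (\<integral>x. x \<partial>\<rho>')" using \<rho> \<rho>' by (simp_all add: initial_law_def)
    then show ?thesis unfolding corr_def using pm[OF mA(2) mB(2)] mA(3) mB(3) by (simp add: ennreal_mult)
  qed
qed

text \<open>Independent sequences with entries of laws \<open>\<rho>\<close> and \<open>\<rho>'\<close> are sent through the same matrices. Their
  means agree, so initially the mean squared difference is the sum of the variances on the diagonal
  and 0 elsewhere; it then decays like \<open>ret n\<close>, while the law of the second sequence stays the same.\<close>
lemma step_pow_coupling:
  assumes \<rho>: "initial_law \<rho>" and \<rho>': "initial_law \<rho>'" and mean: "(\<integral>x. x \<partial>\<rho>) = (\<integral>x. x \<partial>\<rho>')"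
    and inv: "step (Pi\<^sub>M UNIV (\<lambda>_. \<rho>')) = Pi\<^sub>M UNIV (\<lambda>_. \<rho>')"
  shows "weak_conv_fdd (\<lambda>n. (step ^^ n) (Pi\<^sub>M UNIV (\<lambda>_. \<rho>))) (Pi\<^sub>M UNIV (\<lambda>_. \<rho>'))"
proof -
  define \<nu> where "\<nu> = Pi\<^sub>M UNIV (\<lambda>_::int. \<rho>) \<Otimes>\<^sub>M Pi\<^sub>M UNIV (\<lambda>_::int. \<rho>')"
  define m where "m = (\<integral>x. x \<partial>\<rho>)"
  define v where "v = (\<integral>x. x\<^sup>2 \<partial>\<rho>) - m\<^sup>2"
  define v' where "v' = (\<integral>x. x\<^sup>2 \<partial>\<rho>') - m\<^sup>2"
  have v: "0 \<le> v" "0 \<le> v'"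
    using initial_law_moments(3)[OF \<rho>] initial_law_moments(3)[OF \<rho>'] mean by (simp_all add: v_def v'_def m_def)
  note gp = admissible_product[OF \<rho> \<rho>', folded \<nu>_def]
  have g: "admissible \<nu>" by (rule gp)
  have \<delta>: "0 \<le> \<delta> d" "\<delta> d \<le> 1" for d by (auto simp: \<delta>_def)
  have corrs: "corr \<nu> fst fst (\<lambda>d. m\<^sup>2 + \<delta> d * v)" "corr \<nu> fst snd (\<lambda>d. m * m)" "corr \<nu> snd snd (\<lambda>d. m\<^sup>2 + \<delta> d * v')"
    using gp(4,5,6) by (simp_all add: m_def v_def v'_def mean)
  have L2: "(\<integral>\<^sup>+z. ennreal ((fst z i - snd z i)\<^sup>2) \<partial>(pair_step ^^ n) \<nu>) = ennreal ((v + v') * ret n)" for i n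
  proof (rule L2_distance_pair_step_pow[OF g _ _ _ corrs(1) _ _ corrs(2) _ _ corrs(3)])
    show "0 \<le> v + v'" using v by simp
    show "0 \<le> m\<^sup>2 + \<delta> d * v" "0 \<le> m * m" "0 \<le> m\<^sup>2 + \<delta> d * v'" for d using v \<delta>(1)[of d] by simp_all
    show "m\<^sup>2 + \<delta> d * v \<le> m\<^sup>2 + v" "m * m \<le> m * m" "m\<^sup>2 + \<delta> d * v' \<le> m\<^sup>2 + v'" for d
      using v \<delta>(2)[of d] \<delta>(1)[of d] by (simp_all add: mult_left_le_one_le)
    show "m\<^sup>2 + \<delta> d * v - 2 * (m * m) + (m\<^sup>2 + \<delta> d * v') = (v + v') * \<delta> d" for d
      by (simp add: power2_eq_square algebra_simps)
  qed
  have adm_n: "admissible ((pair_step ^^ n) \<nu>)" for n using pair_step_pow_marginal[OF g, of fst n] by simp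
  show ?thesis
  proof (rule weak_conv_fdd_if_L2_close[where \<nu>="\<lambda>n. (pair_step ^^ n) \<nu>"])
    show "prob_space ((pair_step ^^ n) \<nu>)" "sets ((pair_step ^^ n) \<nu>) = sets (seq_space \<Otimes>\<^sub>M seq_space)" for n
      using adm_n[of n] by (simp_all add: admissible_def)
    show "distr ((pair_step ^^ n) \<nu>) seq_space fst = (step ^^ n) (Pi\<^sub>M UNIV (\<lambda>_. \<rho>))" for n
      using pair_step_pow_marginal[OF g, of fst n] gp(2) by simp
    show "distr ((pair_step ^^ n) \<nu>) seq_space snd = Pi\<^sub>M UNIV (\<lambda>_. \<rho>')" for n
    proof -
      have "(step ^^ n) (Pi\<^sub>M UNIV (\<lambda>_. \<rho>')) = Pi\<^sub>M UNIV (\<lambda>_. \<rho>')" by (induction n) (simp_all add: inv)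
      then show ?thesis using pair_step_pow_marginal[OF g, of snd n] gp(3) by simp
    qed
    fix i
    have "(\<lambda>n. ennreal ((v + v') * ret n)) \<longlonglongrightarrow> ennreal ((v + v') * 0)"
      by (intro tendsto_ennrealI tendsto_mult tendsto_const ret_tendsto_0)
    then show "(\<lambda>n. \<integral>\<^sup>+z. ennreal ((fst z i - snd z i)\<^sup>2) \<partial>(pair_step ^^ n) \<nu>) \<longlonglongrightarrow> 0"
      unfolding L2 by simp
  qed
qed

lemma step_gamma: "0 < g \<Longrightarrow> step (Pi\<^sub>M UNIV (\<lambda>_. gamma_distr a g)) = Pi\<^sub>M UNIV (\<lambda>_. gamma_distr a g)"
  unfolding step_def by (rule row_mult_gamma_invariant)

lemma step_pow_converges:
  assumes "initial_law \<rho>"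
  shows "weak_conv_fdd (\<lambda>n. (step ^^ n) (Pi\<^sub>M UNIV (\<lambda>_. \<rho>))) (Pi\<^sub>M UNIV (\<lambda>_. gamma_distr a (a / (\<integral>x. x \<partial>\<rho>))))"
proof -
  have "0 < a / (\<integral>x. x \<partial>\<rho>)" using assms total_pos by (simp add: initial_law_def)
  note g = this
  show ?thesis
  proof (rule step_pow_coupling[OF assms initial_law_gamma(1)[OF total_pos g] _ step_gamma[OF g]])
    show "(\<integral>x. x \<partial>\<rho>) = (\<integral>x. x \<partial>gamma_distr a (a / (\<integral>x. x \<partial>\<rho>)))"
      using initial_law_gamma(2)[OF total_pos g] total_pos by simp
  qed
qed

lemma row_mult_defined_step_pow:
  assumes "initial_law \<rho>"
  shows "AE w in (step ^^ n) (Pi\<^sub>M UNIV (\<lambda>_. \<rho>)) \<Otimes>\<^sub>M K. row_mult_defined (fst w) (snd w)"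
proof -
  note gp = admissible_product[OF assms assms]
  have fst: "fst \<in> {fst, snd :: (int \<Rightarrow> real) \<times> (int \<Rightarrow> real) \<Rightarrow> _}" by simp
  note m = pair_step_pow_marginal[OF gp(1) fst, of n]
  show ?thesis using row_mult_defined_marginal[OF conjunct1[OF m] fst] unfolding conjunct2[OF m] gp(2) .
qed

end

abbreviation matrices_space :: "(nat \<Rightarrow> int \<Rightarrow> int \<Rightarrow> real) measure" where
  "matrices_space \<equiv> Pi\<^sub>M UNIV (\<lambda>_. matrix_space)"

lemma exchange_cong:
  "(\<And>m. m < n \<Longrightarrow> Q (Suc m) = Q' (Suc m)) \<Longrightarrow> exchange t Q n = exchange t Q' n"
  by (induction n) auto

lemma exchange_peel:
  "exchange t (\<lambda>k. case_nat s p (k - 1)) (Suc n) = exchange (row_mult t s) (\<lambda>k. p (k - 1)) n"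
  by (induction n) auto

lemma measurable_exchange:
  "(\<lambda>w. exchange (fst w) (\<lambda>k. snd w (k - 1)) n) \<in> seq_space \<Otimes>\<^sub>M matrices_space \<rightarrow>\<^sub>M seq_space"
proof (induction n)
  case (Suc n)
  have "(\<lambda>w. snd w n) \<in> seq_space \<Otimes>\<^sub>M matrices_space \<rightarrow>\<^sub>M matrix_space"
    by (rule measurable_compose[OF measurable_snd measurable_component_singleton]) simp
  from measurable_row_mult[OF Suc this] show ?case by simp
qed simp

lemma initial_sequenceD:
  assumes "initial_sequence M P \<tau>"
  shows "prob_space.indep_vars M (\<lambda>_. borel) (\<lambda>i \<omega>. \<tau> \<omega> i) UNIV"
    and "distr M borel (\<lambda>\<omega>. \<tau> \<omega> i) = distr M borel (\<lambda>\<omega>. \<tau> \<omega> 0)"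
    and "initial_law (distr M borel (\<lambda>\<omega>. \<tau> \<omega> 0))"
    and "prob_space.indep_set M (sets (vimage_algebra (space M) \<tau> seq_space))
       (sets (vimage_algebra (space M) (\<lambda>\<omega> n. P (Suc n) \<omega>) matrices_space))"
proof -
  note d = assms[unfolded initial_sequence_def]
  show "prob_space.indep_vars M (\<lambda>_. borel) (\<lambda>i \<omega>. \<tau> \<omega> i) UNIV" by (rule conjunct1[OF d])
  show "distr M borel (\<lambda>\<omega>. \<tau> \<omega> i) = distr M borel (\<lambda>\<omega>. \<tau> \<omega> 0)" by (rule spec[OF conjunct1[OF conjunct2[OF d]]])
  show "initial_law (distr M borel (\<lambda>\<omega>. \<tau> \<omega> 0))" by (rule conjunct1[OF conjunct2[OF conjunct2[OF d]]])
  show "prob_space.indep_set M (sets (vimage_algebra (space M) \<tau> seq_space))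
       (sets (vimage_algebra (space M) (\<lambda>\<omega> n. P (Suc n) \<omega>) matrices_space))"
    by (rule conjunct2[OF conjunct2[OF conjunct2[OF d]]])
qed

context dirichlet_exchange
begin

abbreviation Ks :: "(nat \<Rightarrow> int \<Rightarrow> int \<Rightarrow> real) measure" where "Ks \<equiv> Pi\<^sub>M UNIV (\<lambda>_. K)"

lemma sets_Ks: "sets Ks = sets matrices_space"
  by (intro sets_PiM_cong refl sets_matrix_law)

lemma prob_space_Ks: "prob_space Ks" by (intro prob_space_PiM prob_space_K)

lemma step_law:
  assumes "prob_space \<nu>" "sets \<nu> = sets seq_space"
  shows "prob_space (step \<nu>)" "sets (step \<nu>) = sets seq_space"
proof -
  interpret \<nu>: prob_space \<nu> by fact
  interpret K: prob_space K by (rule prob_space_K)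
  interpret \<nu>K: pair_prob_space \<nu> K ..
  show "prob_space (step \<nu>)" unfolding step_def by (rule \<nu>K.prob_space_distr[OF row_mult_law_measurable[OF assms(2)]])
  show "sets (step \<nu>) = sets seq_space" by (simp add: step_def)
qed

lemma step_pow_law:
  assumes "prob_space \<nu>" "sets \<nu> = sets seq_space"
  shows "prob_space ((step ^^ n) \<nu>) \<and> sets ((step ^^ n) \<nu>) = sets seq_space"
  by (induction n) (use assms step_law in auto)

text \<open>The law of the first \<open>n + 1\<close> steps is that of \<open>n\<close> steps from the image of the initial law under one
  step: the first matrix is split off from the i.i.d. sequence and absorbed into the initial law. The
  next matrix is kept along, as it is independent of the past.\<close>
lemma nn_integral_exchange:
  fixes f :: "(int \<Rightarrow> real) \<times> (int \<Rightarrow> int \<Rightarrow> real) \<Rightarrow> ennreal"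
  assumes "prob_space \<nu>" "sets \<nu> = sets seq_space" and f: "f \<in> borel_measurable (seq_space \<Otimes>\<^sub>M matrix_space)"
  shows "(\<integral>\<^sup>+w. f (exchange (fst w) (\<lambda>k. snd w (k - 1)) n, snd w n) \<partial>(\<nu> \<Otimes>\<^sub>M Ks)) = (\<integral>\<^sup>+z. f z \<partial>((step ^^ n) \<nu> \<Otimes>\<^sub>M K))"
  using assms(1,2)
proof (induction n arbitrary: \<nu>)
  case (0 \<nu>)
  have comp: "(\<lambda>p. p 0) \<in> Ks \<rightarrow>\<^sub>M K" by (rule measurable_component_singleton) simp
  have "\<nu> \<Otimes>\<^sub>M K = \<nu> \<Otimes>\<^sub>M distr Ks K (\<lambda>p. p 0)"
    using distr_PiM_component[of UNIV "\<lambda>_. K" "0::nat"] prob_space_K by simp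
  also have "\<dots> = distr (\<nu> \<Otimes>\<^sub>M Ks) (\<nu> \<Otimes>\<^sub>M K) (\<lambda>w. (fst w, snd w 0))"
    by (rule distr_pair_snd[OF comp prob_space_Ks])
  finally have eq: "\<nu> \<Otimes>\<^sub>M K = distr (\<nu> \<Otimes>\<^sub>M Ks) (\<nu> \<Otimes>\<^sub>M K) (\<lambda>w. (fst w, snd w 0))" .
  have f': "f \<in> borel_measurable (\<nu> \<Otimes>\<^sub>M K)"
    using f by (simp only: measurable_cong_sets[OF sets_pair_measure_cong[OF 0(2) sets_matrix_law] refl])
  have "(\<integral>\<^sup>+z. f z \<partial>(\<nu> \<Otimes>\<^sub>M K)) = (\<integral>\<^sup>+w. f (fst w, snd w 0) \<partial>(\<nu> \<Otimes>\<^sub>M Ks))"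
    by (subst eq, rule nn_integral_distr)
      (intro measurable_Pair measurable_fst measurable_compose[OF measurable_snd comp],
       simp only: measurable_distr_eq1 f')
  then show ?case by simp
next
  case (Suc n \<nu>)
  interpret \<nu>: prob_space \<nu> by fact
  interpret K: prob_space K by (rule prob_space_K)
  interpret Ks: prob_space Ks by (rule prob_space_Ks)
  interpret KK: pair_prob_space K Ks ..
  interpret \<nu>K: pair_prob_space \<nu> K ..
  interpret sq: sequence_space K
    by (simp add: sequence_space_def product_prob_space_def product_prob_space_axioms_def product_sigma_finite_def
        K.prob_space_axioms K.sigma_finite_measure_axioms)
  define h where "h z = f (exchange (fst z) (\<lambda>k. snd z (k - 1)) n, snd z n)" for z
  have h: "h \<in> borel_measurable (seq_space \<Otimes>\<^sub>M Ks)"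
  proof -
    have "(\<lambda>w. snd w n) \<in> seq_space \<Otimes>\<^sub>M matrices_space \<rightarrow>\<^sub>M matrix_space"
      by (rule measurable_compose[OF measurable_snd measurable_component_singleton]) simp
    from measurable_compose[OF measurable_Pair[OF measurable_exchange[of n] this] f]
    show ?thesis unfolding h_def[abs_def] by (simp only: measurable_cong_sets[OF sets_pair_measure_cong[OF refl sets_Ks] refl])
  qed
  have sets_sp: "sets (seq_space \<Otimes>\<^sub>M Ks) = sets (\<nu> \<Otimes>\<^sub>M Ks)"
    by (rule sets_pair_measure_cong[OF Suc.prems(2)[symmetric] refl])
  have cn: "(\<lambda>(s, p). case_nat s p) \<in> K \<Otimes>\<^sub>M Ks \<rightarrow>\<^sub>M Ks"
    by measurable
  have iter: "\<nu> \<Otimes>\<^sub>M Ks = distr (\<nu> \<Otimes>\<^sub>M (K \<Otimes>\<^sub>M Ks)) (\<nu> \<Otimes>\<^sub>M Ks) (\<lambda>w. (fst w, case snd w of (s, p) \<Rightarrow> case_nat s p))"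
    using distr_pair_snd[OF cn KK.prob_space_axioms, of \<nu>] unfolding sq.PiM_iter .
  define F where "F z = f (exchange (fst z) (\<lambda>k. snd z (k - 1)) (Suc n), snd z (Suc n))" for z
  have F: "F \<in> borel_measurable (\<nu> \<Otimes>\<^sub>M Ks)"
  proof -
    have "(\<lambda>w. snd w (Suc n)) \<in> seq_space \<Otimes>\<^sub>M matrices_space \<rightarrow>\<^sub>M matrix_space"
      by (rule measurable_compose[OF measurable_snd measurable_component_singleton]) simp
    from measurable_compose[OF measurable_Pair[OF measurable_exchange[of "Suc n"] this] f]
    show ?thesis unfolding F_def[abs_def]
      by (simp only: measurable_cong_sets[OF sets_pair_measure_cong[OF Suc.prems(2) sets_Ks] refl])
  qed
  have rm: "(\<lambda>w. row_mult (fst w) (snd w)) \<in> \<nu> \<Otimes>\<^sub>M K \<rightarrow>\<^sub>M seq_space"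
    by (rule row_mult_law_measurable[OF Suc.prems(2)])
  have Fh: "F (t, case_nat s p) = h (row_mult t s, p)" for t s p
    unfolding F_def h_def fst_conv snd_conv by (simp only: exchange_peel nat.case)
  have m1: "(\<lambda>w. (fst w, case snd w of (s, p) \<Rightarrow> case_nat s p)) \<in> \<nu> \<Otimes>\<^sub>M (K \<Otimes>\<^sub>M Ks) \<rightarrow>\<^sub>M \<nu> \<Otimes>\<^sub>M Ks"
    by (intro measurable_Pair measurable_fst measurable_compose[OF measurable_snd cn])
  have H: "(\<lambda>t. \<integral>\<^sup>+p. h (t, p) \<partial>Ks) \<in> borel_measurable seq_space"
    by (rule Ks.borel_measurable_nn_integral_fst[OF h])
  have "(\<integral>\<^sup>+w. F w \<partial>(\<nu> \<Otimes>\<^sub>M Ks)) = (\<integral>\<^sup>+w. F (fst w, case snd w of (s, p) \<Rightarrow> case_nat s p) \<partial>(\<nu> \<Otimes>\<^sub>M (K \<Otimes>\<^sub>M Ks)))"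
    by (subst iter, rule nn_integral_distr[OF m1]) (simp only: measurable_distr_eq1 F)
  also have "\<dots> = (\<integral>\<^sup>+t. (\<integral>\<^sup>+y. F (t, case y of (s, p) \<Rightarrow> case_nat s p) \<partial>(K \<Otimes>\<^sub>M Ks)) \<partial>\<nu>)"
    using KK.nn_integral_fst[OF measurable_compose[OF m1 F]] by simp
  also have "\<dots> = (\<integral>\<^sup>+t. (\<integral>\<^sup>+s. (\<integral>\<^sup>+p. h (row_mult t s, p) \<partial>Ks) \<partial>K) \<partial>\<nu>)"
  proof (intro nn_integral_cong)
    fix t assume t: "t \<in> space \<nu>"
    have "(\<lambda>y. F (t, case y of (s, p) \<Rightarrow> case_nat s p)) \<in> borel_measurable (K \<Otimes>\<^sub>M Ks)"
      using measurable_compose[OF measurable_Pair1'[OF t] measurable_compose[OF m1 F]] by simp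
    from Ks.nn_integral_fst[OF this]
    show "(\<integral>\<^sup>+y. F (t, case y of (s, p) \<Rightarrow> case_nat s p) \<partial>(K \<Otimes>\<^sub>M Ks)) = (\<integral>\<^sup>+s. (\<integral>\<^sup>+p. h (row_mult t s, p) \<partial>Ks) \<partial>K)"
      by (simp add: Fh)
  qed
  also have "\<dots> = (\<integral>\<^sup>+w. (\<integral>\<^sup>+p. h (row_mult (fst w) (snd w), p) \<partial>Ks) \<partial>(\<nu> \<Otimes>\<^sub>M K))"
    using K.nn_integral_fst[OF measurable_compose[OF rm H]] by simp
  also have "\<dots> = (\<integral>\<^sup>+t. (\<integral>\<^sup>+p. h (t, p) \<partial>Ks) \<partial>step \<nu>)"
    unfolding step_def by (rule nn_integral_distr[symmetric, OF rm]) (simp only: measurable_distr_eq1 H)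
  also have "\<dots> = (\<integral>\<^sup>+z. h z \<partial>(step \<nu> \<Otimes>\<^sub>M Ks))"
  proof (rule Ks.nn_integral_fst)
    show "h \<in> borel_measurable (step \<nu> \<Otimes>\<^sub>M Ks)"
      using h by (simp only: measurable_cong_sets[OF sets_pair_measure_cong[OF step_law(2)[OF Suc.prems] refl] refl])
  qed
  also have "\<dots> = (\<integral>\<^sup>+z. f z \<partial>((step ^^ n) (step \<nu>) \<Otimes>\<^sub>M K))"
    unfolding h_def by (rule Suc.IH[OF step_law[OF Suc.prems]])
  finally show ?case by (simp only: F_def funpow_Suc_right comp_def)
qed

lemma exchange_law:
  fixes X :: "'w \<Rightarrow> int \<Rightarrow> real" and Q :: "'w \<Rightarrow> nat \<Rightarrow> int \<Rightarrow> int \<Rightarrow> real"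
  assumes \<nu>: "prob_space \<nu>" "sets \<nu> = sets seq_space"
    and XQ: "(\<lambda>\<omega>. (X \<omega>, Q \<omega>)) \<in> N \<rightarrow>\<^sub>M seq_space \<Otimes>\<^sub>M matrices_space"
    and joint: "distr N (seq_space \<Otimes>\<^sub>M matrices_space) (\<lambda>\<omega>. (X \<omega>, Q \<omega>)) = \<nu> \<Otimes>\<^sub>M Ks"
  shows "distr N seq_space (\<lambda>\<omega>. exchange (X \<omega>) (\<lambda>k. Q \<omega> (k - 1)) n) = (step ^^ n) \<nu>"
    and "(AE w in (step ^^ n) \<nu> \<Otimes>\<^sub>M K. row_mult_defined (fst w) (snd w)) \<Longrightarrow>
      AE \<omega> in N. row_mult_defined (exchange (X \<omega>) (\<lambda>k. Q \<omega> (k - 1)) n) (Q \<omega> n)"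
proof -
  interpret K: prob_space K by (rule prob_space_K)
  let ?S = "seq_space \<Otimes>\<^sub>M matrix_space" and ?J = "seq_space \<Otimes>\<^sub>M matrices_space"
  define E where "E w = (exchange (fst w) (\<lambda>k. snd w (k - 1)) n, snd w n)" for w :: "(int \<Rightarrow> real) \<times> (nat \<Rightarrow> int \<Rightarrow> int \<Rightarrow> real)"
  have E: "E \<in> ?J \<rightarrow>\<^sub>M ?S"
  proof -
    have "(\<lambda>w. snd w n) \<in> ?J \<rightarrow>\<^sub>M matrix_space"
      by (rule measurable_compose[OF measurable_snd measurable_component_singleton]) simp
    from measurable_Pair[OF measurable_exchange[of n] this] show ?thesis by (simp only: E_def[abs_def])
  qed
  have EXQ: "(\<lambda>\<omega>. E (X \<omega>, Q \<omega>)) \<in> N \<rightarrow>\<^sub>M ?S" by (rule measurable_compose[OF XQ E])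
  have sets_n: "sets ((step ^^ n) \<nu>) = sets seq_space" using step_pow_law[OF \<nu>] by simp
  have sets_nK: "sets ((step ^^ n) \<nu> \<Otimes>\<^sub>M K) = sets ?S" by (intro sets_pair_measure_cong sets_n sets_matrix_law)
  have law: "distr N ?S (\<lambda>\<omega>. E (X \<omega>, Q \<omega>)) = (step ^^ n) \<nu> \<Otimes>\<^sub>M K"
  proof (rule measure_eqI)
    show "sets (distr N ?S (\<lambda>\<omega>. E (X \<omega>, Q \<omega>))) = sets ((step ^^ n) \<nu> \<Otimes>\<^sub>M K)"
      by (simp only: sets_distr sets_nK)
    fix B assume "B \<in> sets (distr N ?S (\<lambda>\<omega>. E (X \<omega>, Q \<omega>)))"
    then have B: "B \<in> sets ?S" by simp
    have ind: "indicator B \<in> borel_measurable ?S" by (rule borel_measurable_indicator[OF B])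
    have "emeasure (distr N ?S (\<lambda>\<omega>. E (X \<omega>, Q \<omega>))) B = (\<integral>\<^sup>+z. indicator B z \<partial>distr N ?S (\<lambda>\<omega>. E (X \<omega>, Q \<omega>)))"
      using B by simp
    also have "\<dots> = (\<integral>\<^sup>+\<omega>. indicator B (E (X \<omega>, Q \<omega>)) \<partial>N)"
      by (rule nn_integral_distr[OF EXQ]) (simp only: measurable_distr_eq1 ind)
    also have "\<dots> = (\<integral>\<^sup>+w. indicator B (E w) \<partial>distr N ?J (\<lambda>\<omega>. (X \<omega>, Q \<omega>)))"
      by (rule nn_integral_distr[symmetric, OF XQ]) (simp only: measurable_distr_eq1 measurable_compose[OF E ind])
    also have "\<dots> = (\<integral>\<^sup>+z. indicator B z \<partial>((step ^^ n) \<nu> \<Otimes>\<^sub>M K))"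
      unfolding joint E_def by (rule nn_integral_exchange[OF \<nu> ind])
    also have "\<dots> = emeasure ((step ^^ n) \<nu> \<Otimes>\<^sub>M K) B" using B sets_nK by simp
    finally show "emeasure (distr N ?S (\<lambda>\<omega>. E (X \<omega>, Q \<omega>))) B = emeasure ((step ^^ n) \<nu> \<Otimes>\<^sub>M K) B" .
  qed
  have "distr N seq_space (\<lambda>\<omega>. exchange (X \<omega>) (\<lambda>k. Q \<omega> (k - 1)) n) = distr (distr N ?S (\<lambda>\<omega>. E (X \<omega>, Q \<omega>))) seq_space fst"
    by (subst distr_distr[OF measurable_fst EXQ]) (simp add: comp_def E_def)
  also have "\<dots> = distr ((step ^^ n) \<nu> \<Otimes>\<^sub>M K) ((step ^^ n) \<nu>) fst"
    unfolding law by (rule distr_cong[OF refl sets_n[symmetric] refl])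
  also have "\<dots> = (step ^^ n) \<nu>" by (rule K.distr_pair_fst)
  finally show "distr N seq_space (\<lambda>\<omega>. exchange (X \<omega>) (\<lambda>k. Q \<omega> (k - 1)) n) = (step ^^ n) \<nu>" .
  assume ae: "AE w in (step ^^ n) \<nu> \<Otimes>\<^sub>M K. row_mult_defined (fst w) (snd w)"
  have "AE \<omega> in N. row_mult_defined (fst (E (X \<omega>, Q \<omega>))) (snd (E (X \<omega>, Q \<omega>)))"
    using ae unfolding law[symmetric] AE_distr_iff[OF EXQ row_mult_defined_sets] .
  then show "AE \<omega> in N. row_mult_defined (exchange (X \<omega>) (\<lambda>k. Q \<omega> (k - 1)) n) (Q \<omega> n)"
    by (simp only: E_def fst_conv snd_conv)
qed

text \<open>The given family of rows is indexed by pairs \<open>(n, i)\<close> with \<open>n \<ge> 1\<close>. After a shift of \<open>n\<close> it is a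
  family over all pairs, which is grouped into matrices; finally each row is moved to its place
  relative to the diagonal.\<close>
lemma matrices_law:
  assumes "prob_space M" and P: "iid_dirichlet_rows M \<alpha> P"
  shows "(\<lambda>\<omega> n. P (Suc n) \<omega>) \<in> M \<rightarrow>\<^sub>M matrices_space"
    and "distr M matrices_space (\<lambda>\<omega> n. P (Suc n) \<omega>) = Ks"
proof -
  interpret M: prob_space M by fact
  define I where "I = {1 :: nat..} \<times> (UNIV :: int set)"
  define X where "X = (\<lambda>(n, i) \<omega> j. P n \<omega> i (i + j) :: real)"
  have ind: "M.indep_vars (\<lambda>_. seq_space) X I" and X_law: "\<And>z. z \<in> I \<Longrightarrow> distr M seq_space (X z) = dirichlet \<alpha>"
    using P by (auto simp: iid_dirichlet_rows_def I_def X_def)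
  have Xm: "X z \<in> M \<rightarrow>\<^sub>M seq_space" if "z \<in> I" for z
    using ind that by (auto simp: M.indep_vars_def)
  \<comment> \<open>matrices are numbered from 1, the coordinates of the product measure from 0\<close>
  define e :: "nat \<times> int \<Rightarrow> nat \<times> int" where "e z = (Suc (fst z), snd z)" for z
  have eI: "e z \<in> I" for z by (simp add: e_def I_def)
  have PX: "P (Suc n) \<omega> = (\<lambda>i j. X (e (n, i)) \<omega> (j - i))" for n \<omega> by (simp add: X_def e_def)
  have Xe: "(\<lambda>\<omega>. X (e z) \<omega>) \<in> M \<rightarrow>\<^sub>M seq_space" for z by (rule Xm[OF eI])
  have rows_m: "(\<lambda>\<omega> n i. X (e (n, i)) \<omega>) \<in> M \<rightarrow>\<^sub>M matrices_space"
    by (rule measurable_into_PiM, rule measurable_into_PiM) (rule Xe)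
  have shift: "(\<lambda>v n. (\<lambda>i j. v n i (j - i))) \<in> matrices_space \<rightarrow>\<^sub>M matrices_space"
  proof (rule measurable_into_PiM)
    fix n :: nat
    have "(\<lambda>v. v n) \<in> matrices_space \<rightarrow>\<^sub>M matrix_space" by (rule measurable_component_singleton) simp
    then show "(\<lambda>v i j. v n i (j - i)) \<in> matrices_space \<rightarrow>\<^sub>M matrix_space"
      by (rule measurable_compose[OF _ measurable_shift_rows])
  qed
  show Pm: "(\<lambda>\<omega> n. P (Suc n) \<omega>) \<in> M \<rightarrow>\<^sub>M matrices_space"
    unfolding PX using measurable_compose[OF rows_m shift] .
  have ne: "I \<noteq> {}" by (auto simp: I_def)
  have "distr M (Pi\<^sub>M I (\<lambda>_. seq_space)) (\<lambda>\<omega>. \<lambda>z\<in>I. X z \<omega>) = Pi\<^sub>M I (\<lambda>z. distr M seq_space (X z))"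
    using M.indep_vars_iff_distr_eq_PiM'[where I=I and M'="\<lambda>_. seq_space" and X=X, OF ne Xm] ind by (rule iffD1)
  also have "\<dots> = Pi\<^sub>M I (\<lambda>_. dirichlet \<alpha>)" by (intro PiM_cong refl X_law)
  finally have flatI: "distr M (Pi\<^sub>M I (\<lambda>_. seq_space)) (\<lambda>\<omega>. \<lambda>z\<in>I. X z \<omega>) = Pi\<^sub>M I (\<lambda>_. dirichlet \<alpha>)" .
  have sI: "sets (Pi\<^sub>M I (\<lambda>_. dirichlet \<alpha>)) = sets (Pi\<^sub>M I (\<lambda>_. seq_space))" by (intro sets_PiM_cong refl sets_dirichlet)
  have sF: "sets (Pi\<^sub>M UNIV (\<lambda>_::nat \<times> int. dirichlet \<alpha>)) = sets (Pi\<^sub>M UNIV (\<lambda>_. seq_space))"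
    by (intro sets_PiM_cong refl sets_dirichlet)
  have XIm: "(\<lambda>\<omega>. \<lambda>z\<in>I. X z \<omega>) \<in> M \<rightarrow>\<^sub>M Pi\<^sub>M I (\<lambda>_. seq_space)" by (intro measurable_restrict Xm)
  have re: "(\<lambda>v. \<lambda>z. v (e z)) \<in> Pi\<^sub>M I (\<lambda>_. seq_space) \<rightarrow>\<^sub>M Pi\<^sub>M UNIV (\<lambda>_. seq_space)"
    by (rule measurable_into_PiM, rule measurable_component_singleton[OF eI])
  have "Pi\<^sub>M UNIV (\<lambda>_::nat \<times> int. dirichlet \<alpha>)
      = distr (Pi\<^sub>M I (\<lambda>_. dirichlet \<alpha>)) (Pi\<^sub>M UNIV (\<lambda>_. dirichlet \<alpha>)) (\<lambda>v. \<lambda>z\<in>UNIV. v (e z))"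
    using prob_space_dirichlet eI by (intro distr_PiM_reindex[symmetric]) (auto simp: inj_on_def e_def)
  also have "\<dots> = distr (distr M (Pi\<^sub>M I (\<lambda>_. seq_space)) (\<lambda>\<omega>. \<lambda>z\<in>I. X z \<omega>)) (Pi\<^sub>M UNIV (\<lambda>_. seq_space)) (\<lambda>v z. v (e z))"
    unfolding flatI restrict_UNIV by (rule distr_cong[OF refl sF refl])
  also have "\<dots> = distr M (Pi\<^sub>M UNIV (\<lambda>_. seq_space)) (\<lambda>\<omega> z. X (e z) \<omega>)"
    by (subst distr_distr[OF re XIm]) (simp add: comp_def eI)
  finally have flat: "Pi\<^sub>M UNIV (\<lambda>_::nat \<times> int. dirichlet \<alpha>) = distr M (Pi\<^sub>M UNIV (\<lambda>_. seq_space)) (\<lambda>\<omega> z. X (e z) \<omega>)" .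
  let ?N = "Pi\<^sub>M UNIV (\<lambda>_::nat. Pi\<^sub>M UNIV (\<lambda>_::int. dirichlet \<alpha>))"
  have sN: "sets ?N = sets matrices_space" by (intro sets_PiM_cong refl sets_PiM_dirichlet)
  have cur: "(\<lambda>v n i. v (n, i)) \<in> Pi\<^sub>M UNIV (\<lambda>_. seq_space) \<rightarrow>\<^sub>M matrices_space"
    by (rule measurable_into_PiM, rule measurable_into_PiM, rule measurable_component_singleton) simp
  have Fm: "(\<lambda>\<omega> z. X (e z) \<omega>) \<in> M \<rightarrow>\<^sub>M Pi\<^sub>M UNIV (\<lambda>_. seq_space)" by (rule measurable_into_PiM) (rule Xe)
  have "?N = distr (Pi\<^sub>M UNIV (\<lambda>_::nat \<times> int. dirichlet \<alpha>)) ?N (\<lambda>v n i. v (n, i))"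
    by (rule distr_PiM_group[where N="\<lambda>_. dirichlet \<alpha>" and e="\<lambda>n i. (n, i)", symmetric]) (simp_all add: prob_space_dirichlet)
  also have "\<dots> = distr (Pi\<^sub>M UNIV (\<lambda>_::nat \<times> int. dirichlet \<alpha>)) matrices_space (\<lambda>v n i. v (n, i))"
    by (rule distr_cong[OF refl sN refl])
  also have "\<dots> = distr M matrices_space (\<lambda>\<omega> n i. X (e (n, i)) \<omega>)"
    unfolding flat by (subst distr_distr[OF cur Fm]) (simp add: comp_def)
  finally have nested: "?N = distr M matrices_space (\<lambda>\<omega> n i. X (e (n, i)) \<omega>)" .
  have "Ks = distr ?N matrices_space (\<lambda>v n. (\<lambda>i j. v n i (j - i)))"
    unfolding matrix_law_def
  proof (rule distr_PiM_coordinatewise[symmetric])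
    show "prob_space (Pi\<^sub>M UNIV (\<lambda>_::int. dirichlet \<alpha>))" by (intro prob_space_PiM prob_space_dirichlet)
    show "(\<lambda>r i j. r i (j - i)) \<in> Pi\<^sub>M UNIV (\<lambda>_. dirichlet \<alpha>) \<rightarrow>\<^sub>M matrix_space"
      unfolding measurable_cong_sets[OF sets_PiM_dirichlet refl] by (rule measurable_shift_rows)
  qed
  also have "\<dots> = distr M matrices_space (\<lambda>\<omega> n. P (Suc n) \<omega>)"
    unfolding nested PX by (subst distr_distr[OF shift rows_m]) (simp add: comp_def)
  finally show "distr M matrices_space (\<lambda>\<omega> n. P (Suc n) \<omega>) = Ks" ..
qed

lemma joint_law_product:
  assumes M: "prob_space M" and P: "iid_dirichlet_rows M \<alpha> P" and \<nu>: "prob_space \<nu>" "sets \<nu> = sets seq_space"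
  shows "(\<lambda>w. (fst w, \<lambda>n. P (Suc n) (snd w))) \<in> \<nu> \<Otimes>\<^sub>M M \<rightarrow>\<^sub>M seq_space \<Otimes>\<^sub>M matrices_space"
    and "distr (\<nu> \<Otimes>\<^sub>M M) (seq_space \<Otimes>\<^sub>M matrices_space) (\<lambda>w. (fst w, \<lambda>n. P (Suc n) (snd w))) = \<nu> \<Otimes>\<^sub>M Ks"
proof -
  note law = matrices_law[OF M P]
  have "fst \<in> \<nu> \<Otimes>\<^sub>M M \<rightarrow>\<^sub>M seq_space"
    using measurable_fst[of \<nu> M] by (simp only: measurable_cong_sets[OF refl \<nu>(2)])
  then show "(\<lambda>w. (fst w, \<lambda>n. P (Suc n) (snd w))) \<in> \<nu> \<Otimes>\<^sub>M M \<rightarrow>\<^sub>M seq_space \<Otimes>\<^sub>M matrices_space"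
    by (intro measurable_Pair measurable_compose[OF measurable_snd law(1)])
  have "\<nu> \<Otimes>\<^sub>M Ks = distr (\<nu> \<Otimes>\<^sub>M M) (\<nu> \<Otimes>\<^sub>M matrices_space) (\<lambda>w. (fst w, \<lambda>n. P (Suc n) (snd w)))"
    unfolding law(2)[symmetric] by (rule distr_pair_snd[OF law(1) M])
  also have "\<dots> = distr (\<nu> \<Otimes>\<^sub>M M) (seq_space \<Otimes>\<^sub>M matrices_space) (\<lambda>w. (fst w, \<lambda>n. P (Suc n) (snd w)))"
    by (rule distr_cong[OF refl sets_pair_measure_cong[OF \<nu>(2) refl] refl])
  finally show "distr (\<nu> \<Otimes>\<^sub>M M) (seq_space \<Otimes>\<^sub>M matrices_space) (\<lambda>w. (fst w, \<lambda>n. P (Suc n) (snd w))) = \<nu> \<Otimes>\<^sub>M Ks" ..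
qed

lemma joint_law_initial_sequence:
  assumes M: "prob_space M" and P: "iid_dirichlet_rows M \<alpha> P" and \<tau>: "initial_sequence M P \<tau>"
  defines "\<rho> \<equiv> distr M borel (\<lambda>\<omega>. \<tau> \<omega> 0)"
  shows "(\<lambda>\<omega>. (\<tau> \<omega>, \<lambda>n. P (Suc n) \<omega>)) \<in> M \<rightarrow>\<^sub>M seq_space \<Otimes>\<^sub>M matrices_space"
    and "distr M (seq_space \<Otimes>\<^sub>M matrices_space) (\<lambda>\<omega>. (\<tau> \<omega>, \<lambda>n. P (Suc n) \<omega>)) = iid \<rho> \<Otimes>\<^sub>M Ks"
proof -
  interpret M: prob_space M by fact
  interpret Ks: prob_space Ks by (rule prob_space_Ks)
  note law = matrices_law[OF M P]
  note ind = initial_sequenceD(1)[OF \<tau>] and same = initial_sequenceD(2)[OF \<tau>, folded \<rho>_def]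
    and il = initial_sequenceD(3)[OF \<tau>, folded \<rho>_def] and indep = initial_sequenceD(4)[OF \<tau>]
  interpret \<rho>: prob_space \<rho> using il by (simp add: initial_law_def)
  interpret I: prob_space "iid \<rho>" by (intro prob_space_PiM \<rho>.prob_space_axioms)
  have \<tau>m: "\<tau> \<in> M \<rightarrow>\<^sub>M seq_space"
  proof (rule measurable_into_PiM)
    show "(\<lambda>\<omega>. \<tau> \<omega> i) \<in> borel_measurable M" for i using ind unfolding M.indep_vars_def by blast
  qed
  have \<tau>law: "distr M seq_space \<tau> = iid \<rho>"
    using distr_eq_PiM_if_indep[OF M ind] by (simp add: same)
  show XQ: "(\<lambda>\<omega>. (\<tau> \<omega>, \<lambda>n. P (Suc n) \<omega>)) \<in> M \<rightarrow>\<^sub>M seq_space \<Otimes>\<^sub>M matrices_space"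
    by (intro measurable_Pair \<tau>m law(1))
  have sI: "sets (iid \<rho>) = sets seq_space" using \<tau>law[symmetric] by simp
  show "distr M (seq_space \<Otimes>\<^sub>M matrices_space) (\<lambda>\<omega>. (\<tau> \<omega>, \<lambda>n. P (Suc n) \<omega>)) = iid \<rho> \<Otimes>\<^sub>M Ks"
  proof (rule pair_measure_eqI[symmetric])
    show "sigma_finite_measure (iid \<rho>)" "sigma_finite_measure Ks" by unfold_locales
    show "sets (iid \<rho> \<Otimes>\<^sub>M Ks) = sets (distr M (seq_space \<Otimes>\<^sub>M matrices_space) (\<lambda>\<omega>. (\<tau> \<omega>, \<lambda>n. P (Suc n) \<omega>)))"
      unfolding sets_distr by (intro sets_pair_measure_cong sI sets_Ks)
    fix A B assume "A \<in> sets (iid \<rho>)" "B \<in> sets Ks"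
    then have A: "A \<in> sets seq_space" and B: "B \<in> sets matrices_space" by (simp_all only: sI sets_Ks)
    define a' where "a' = \<tau> -` A \<inter> space M"
    define b' where "b' = (\<lambda>\<omega> n. P (Suc n) \<omega>) -` B \<inter> space M"
    have a': "a' \<in> sets (vimage_algebra (space M) \<tau> seq_space)" unfolding a'_def using A by (rule in_vimage_algebra)
    have b': "b' \<in> sets (vimage_algebra (space M) (\<lambda>\<omega> n. P (Suc n) \<omega>) matrices_space)"
      unfolding b'_def using B by (rule in_vimage_algebra)
    have "emeasure (distr M (seq_space \<Otimes>\<^sub>M matrices_space) (\<lambda>\<omega>. (\<tau> \<omega>, \<lambda>n. P (Suc n) \<omega>))) (A \<times> B) = emeasure M (a' \<inter> b')"
      by (subst emeasure_distr[OF XQ]) (auto intro!: pair_measureI A B arg_cong[where f="emeasure M"] simp: a'_def b'_def)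
    also have "\<dots> = emeasure M a' * emeasure M b'"
      using M.indep_setD[OF indep a' b'] by (simp add: M.emeasure_eq_measure ennreal_mult)
    also have "emeasure M a' = emeasure (iid \<rho>) A"
      unfolding \<tau>law[symmetric] a'_def by (rule emeasure_distr[symmetric, OF \<tau>m A])
    also have "emeasure M b' = emeasure Ks B"
      unfolding law(2)[symmetric] b'_def by (rule emeasure_distr[symmetric, OF law(1) B])
    finally show "emeasure (iid \<rho>) A * emeasure Ks B
        = emeasure (distr M (seq_space \<Otimes>\<^sub>M matrices_space) (\<lambda>\<omega>. (\<tau> \<omega>, \<lambda>n. P (Suc n) \<omega>))) (A \<times> B)" ..
  qed
qed

lemma exchange_shift_index: "exchange t (\<lambda>k. (\<lambda>n. Q (Suc n)) (k - 1)) n = exchange t Q n"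
  by (rule exchange_cong) simp

lemma distr_scale_iid_gamma:
  assumes "0 < c" "0 < g"
  shows "distr (iid (gamma_distr a g)) seq_space (\<lambda>t i. c * t i) = iid (gamma_distr a (g / c))"
proof -
  have "distr (iid (gamma_distr a g)) seq_space (\<lambda>t i. t i / (1 / c)) = (\<Pi>\<^sub>M i\<in>UNIV. distr (gamma_distr a g) borel (\<lambda>x. x / (1 / c)))"
  proof (rule distr_PiM_coordinatewise)
    show "prob_space (gamma_distr a g)" by (rule prob_space_gamma_distr[OF total_pos assms(2)])
    show "(\<lambda>x. x / (1 / c)) \<in> borel_measurable (gamma_distr a g)"
      unfolding measurable_cong_sets[OF sets_gamma_distr refl] by measurable
  qed
  also have "\<dots> = iid (gamma_distr a (g / c))"
    using distr_gamma_distr_scale[OF total_pos, of "1 / c" g] assms by simp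
  finally show ?thesis by (simp add: mult.commute)
qed

lemma exchange_converges_product:
  assumes M: "prob_space M" and P: "iid_dirichlet_rows M \<alpha> P" and \<rho>: "initial_law \<rho>"
  shows "weak_conv_fdd
     (\<lambda>n. distr (iid \<rho> \<Otimes>\<^sub>M M) seq_space (\<lambda>(t, \<omega>). exchange t (\<lambda>k. P k \<omega>) n))
     (iid (gamma_distr a (a / (\<integral>x. x \<partial>\<rho>))))"
proof -
  have \<nu>: "prob_space (iid \<rho>)" "sets (iid \<rho>) = sets seq_space" using iid_law[OF \<rho>] by auto
  note j = joint_law_product[OF M P \<nu>]
  have "distr (iid \<rho> \<Otimes>\<^sub>M M) seq_space (\<lambda>(t, \<omega>). exchange t (\<lambda>k. P k \<omega>) n) = (step ^^ n) (iid \<rho>)" for n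
    using exchange_law(1)[OF \<nu> j, of n] exchange_shift_index[of _ "\<lambda>k. P k _" n]
    by (simp add: case_prod_beta')
  then show ?thesis using step_pow_converges[OF \<rho>] by simp
qed

text \<open>The limit from an initial law of mean \<open>\<mu>\<close> has rate \<open>a / \<mu>\<close>, so the scaling factor that leads there
  from the rate \<open>g\<close> is \<open>g \<mu> / a\<close>.\<close>
lemma gamma_fixed_point:
  assumes M: "prob_space M" and P: "iid_dirichlet_rows M \<alpha> P" and g: "0 < g"
  shows "exchange_fixed_point M P (iid (gamma_distr a g))"
proof -
  have il: "initial_law (gamma_distr a g)" by (rule initial_law_gamma(1)[OF total_pos g])
  have \<nu>: "prob_space (iid (gamma_distr a g))" "sets (iid (gamma_distr a g)) = sets seq_space" using iid_law[OF il] by auto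
  note j = joint_law_product[OF M P \<nu>]
  have "AE w in iid (gamma_distr a g) \<Otimes>\<^sub>M M. row_mult_defined (fst w) (P 1 (snd w))"
    using exchange_law(2)[OF \<nu> j, of 0] row_mult_defined_step_pow[OF il, of 0] by simp
  moreover have "distr (iid (gamma_distr a g) \<Otimes>\<^sub>M M) seq_space (\<lambda>w. row_mult (fst w) (P 1 (snd w))) = iid (gamma_distr a g)"
    using exchange_law(1)[OF \<nu> j, of 1] step_gamma[OF g] by simp
  moreover have "\<exists>c>0. weak_conv_fdd
      (\<lambda>n. distr (iid \<rho> \<Otimes>\<^sub>M M) seq_space (\<lambda>(t, \<omega>). exchange t (\<lambda>k. P k \<omega>) n))
      (distr (iid (gamma_distr a g)) seq_space (\<lambda>t i. c * t i))" if \<rho>: "initial_law \<rho>" for \<rho>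
  proof (intro exI conjI)
    have m: "0 < (\<integral>x. x \<partial>\<rho>)" using \<rho> by (simp add: initial_law_def)
    let ?c = "g * (\<integral>x. x \<partial>\<rho>) / a"
    show c: "0 < ?c" using m g total_pos by simp
    have "g / ?c = a / (\<integral>x. x \<partial>\<rho>)" using g by simp
    then show "weak_conv_fdd
      (\<lambda>n. distr (iid \<rho> \<Otimes>\<^sub>M M) seq_space (\<lambda>(t, \<omega>). exchange t (\<lambda>k. P k \<omega>) n))
      (distr (iid (gamma_distr a g)) seq_space (\<lambda>t i. ?c * t i))"
      using exchange_converges_product[OF M P \<rho>] unfolding distr_scale_iid_gamma[OF c g] by simp
  qed
  ultimately show ?thesis
    unfolding exchange_fixed_point_def using \<nu> by (simp add: case_prod_beta')
qed

text \<open>A single initial law suffices. From i.i.d. Gamma entries of rate \<open>a\<close>, which have mean 1, the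
  dynamics converges to a multiple of the fixed point and also stays at its initial law.\<close>
lemma fixed_point_is_gamma:
  assumes M: "prob_space M" and P: "iid_dirichlet_rows M \<alpha> P" and fp: "exchange_fixed_point M P \<nu>"
  shows "\<exists>g>0. \<nu> = iid (gamma_distr a g)"
proof -
  have \<nu>: "prob_space \<nu>" "sets \<nu> = sets seq_space" using fp by (simp_all add: exchange_fixed_point_def)
  have il: "initial_law (gamma_distr a a)" by (rule initial_law_gamma(1)[OF total_pos total_pos])
  have mean: "(\<integral>x. x \<partial>gamma_distr a a) = 1" using initial_law_gamma(2)[OF total_pos total_pos] total_pos by simp
  from fp il obtain c where c: "0 < c" and conv: "weak_conv_fdd
     (\<lambda>n. distr (iid (gamma_distr a a) \<Otimes>\<^sub>M M) seq_space (\<lambda>(t, \<omega>). exchange t (\<lambda>k. P k \<omega>) n))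
     (distr \<nu> seq_space (\<lambda>t i. c * t i))"
    unfolding exchange_fixed_point_def by blast
  have sc: "(\<lambda>t i. d * t i) \<in> seq_space \<rightarrow>\<^sub>M (seq_space :: (int \<Rightarrow> real) measure)" for d :: real
    by (rule measurable_into_PiM) measurable
  have sc\<nu>: "(\<lambda>t i. c * t i) \<in> \<nu> \<rightarrow>\<^sub>M seq_space" using sc by (simp only: measurable_cong_sets[OF \<nu>(2) refl])
  have "distr \<nu> seq_space (\<lambda>t i. c * t i) = iid (gamma_distr a a)"
  proof (rule weak_conv_fdd_unique[OF conv])
    show "weak_conv_fdd (\<lambda>n. distr (iid (gamma_distr a a) \<Otimes>\<^sub>M M) seq_space (\<lambda>(t, \<omega>). exchange t (\<lambda>k. P k \<omega>) n)) (iid (gamma_distr a a))"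
      using exchange_converges_product[OF M P il] unfolding mean by simp
    show "prob_space (distr \<nu> seq_space (\<lambda>t i. c * t i))" by (rule prob_space.prob_space_distr[OF \<nu>(1) sc\<nu>])
    show "prob_space (iid (gamma_distr a a))" "sets (iid (gamma_distr a a)) = sets seq_space"
      using iid_law[OF il] by auto
  qed simp
  then have "distr (distr \<nu> seq_space (\<lambda>t i. c * t i)) seq_space (\<lambda>t i. (1 / c) * t i) = iid (gamma_distr a (a / (1 / c)))"
    using distr_scale_iid_gamma[of "1 / c" a] c total_pos by simp
  also have "distr (distr \<nu> seq_space (\<lambda>t i. c * t i)) seq_space (\<lambda>t i. (1 / c) * t i) = distr \<nu> seq_space (\<lambda>t. t)"
    using c by (subst distr_distr[OF sc sc\<nu>]) (simp add: comp_def)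
  also have "\<dots> = \<nu>" by (rule distr_id2[OF \<nu>(2)[symmetric]])
  finally show ?thesis using c total_pos by (intro exI[of _ "a / (1 / c)"]) simp
qed

lemma exchange_converges:
  assumes M: "prob_space M" and P: "iid_dirichlet_rows M \<alpha> P" and \<tau>: "initial_sequence M P \<tau>"
  shows "AE \<omega> in M. \<forall>n. row_mult_defined (exchange (\<tau> \<omega>) (\<lambda>k. P k \<omega>) n) (P (Suc n) \<omega>)"
    and "weak_conv_fdd (\<lambda>n. distr M seq_space (\<lambda>\<omega>. exchange (\<tau> \<omega>) (\<lambda>k. P k \<omega>) n))
      (iid (gamma_distr a (a / (\<integral>\<omega>. \<tau> \<omega> 0 \<partial>M))))"
proof -
  define \<rho> where "\<rho> = distr M borel (\<lambda>\<omega>. \<tau> \<omega> 0)"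
  have \<rho>: "initial_law \<rho>" unfolding \<rho>_def by (rule initial_sequenceD(3)[OF \<tau>])
  have \<nu>: "prob_space (iid \<rho>)" "sets (iid \<rho>) = sets seq_space" using iid_law[OF \<rho>] by auto
  note j = joint_law_initial_sequence[OF M P \<tau>, folded \<rho>_def]
  have "AE \<omega> in M. row_mult_defined (exchange (\<tau> \<omega>) (\<lambda>k. P k \<omega>) n) (P (Suc n) \<omega>)" for n
    using exchange_law(2)[OF \<nu> j row_mult_defined_step_pow[OF \<rho>], of n] exchange_shift_index[of _ "\<lambda>k. P k _" n] by simp
  then show "AE \<omega> in M. \<forall>n. row_mult_defined (exchange (\<tau> \<omega>) (\<lambda>k. P k \<omega>) n) (P (Suc n) \<omega>)"
    by (simp add: AE_all_countable)
  have "distr M seq_space (\<lambda>\<omega>. exchange (\<tau> \<omega>) (\<lambda>k. P k \<omega>) n) = (step ^^ n) (iid \<rho>)" for n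
    using exchange_law(1)[OF \<nu> j, of n] exchange_shift_index[of _ "\<lambda>k. P k _" n] by simp
  moreover have "(\<integral>x. x \<partial>\<rho>) = (\<integral>\<omega>. \<tau> \<omega> 0 \<partial>M)"
    unfolding \<rho>_def
  proof (rule integral_distr)
    show "(\<lambda>\<omega>. \<tau> \<omega> 0) \<in> borel_measurable M"
      using initial_sequenceD(1)[OF \<tau>] unfolding prob_space.indep_vars_def[OF M] by blast
  qed simp
  ultimately show "weak_conv_fdd (\<lambda>n. distr M seq_space (\<lambda>\<omega>. exchange (\<tau> \<omega>) (\<lambda>k. P k \<omega>) n))
      (iid (gamma_distr a (a / (\<integral>\<omega>. \<tau> \<omega> 0 \<partial>M))))"
    using step_pow_converges[OF \<rho>] by simp
qed

end

theorem corollary3: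
  fixes M :: "'w measure"
    and \<alpha> :: "int \<Rightarrow> real" and a :: real
    and P :: "nat \<Rightarrow> 'w \<Rightarrow> int \<Rightarrow> int \<Rightarrow> real"
  assumes "prob_space M"
    and "\<And>i. 0 \<le> \<alpha> i"
    and "(\<alpha> has_sum a) UNIV"
    and "\<exists>i j. i \<noteq> j \<and> 0 < \<alpha> i \<and> 0 < \<alpha> j"
    and "iid_dirichlet_rows M \<alpha> P"
  shows "(\<forall>\<nu>. exchange_fixed_point M P \<nu> \<longleftrightarrow>
              (\<exists>\<gamma>>0. \<nu> = Pi\<^sub>M UNIV (\<lambda>_. gamma_distr a \<gamma>))) \<and>
         (\<forall>\<tau>. initial_sequence M P \<tau> \<longrightarrow>
              (AE \<omega> in M. \<forall>n. row_mult_defined (exchange (\<tau> \<omega>) (\<lambda>k. P k \<omega>) n) (P (Suc n) \<omega>)) \<and>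
              weak_conv_fdd
                (\<lambda>n. distr M seq_space (\<lambda>\<omega>. exchange (\<tau> \<omega>) (\<lambda>k. P k \<omega>) n))
                (Pi\<^sub>M UNIV (\<lambda>_. gamma_distr a (a / (\<integral>\<omega>. \<tau> \<omega> 0 \<partial>M)))))"
proof -
  obtain i where i: "0 < \<alpha> i" using assms(4) by blast
  have "(\<alpha> has_sum \<alpha> i) {i}" using has_sum_finite[of "{i}" \<alpha>] by simp
  then have "\<alpha> i \<le> a" by (rule has_sum_mono_neutral[OF _ assms(3)]) (simp_all add: assms(2))
  with i have "0 < a" by simp
  then interpret dirichlet_exchange \<alpha> a
    using assms(2,3,4) by unfold_locales
  show ?thesis
    using gamma_fixed_point[OF assms(1,5)] fixed_point_is_gamma[OF assms(1,5)] exchange_converges[OF assms(1,5)]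
    by blast
qed

end
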